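(* Let $Z\subset\mathbb{P}^{\mathbf{n}}$ be a closed subscheme of codimension $c$ and let $I$ be the corresponding $B$-saturated $S$-ideal. If $S/I$ has a virtual resolution of length $c$, then every associated prime of $I$ has codimension $c$.
   Context: Let $\Bbbk$ be a field, $\mathbf{n}=(n_1,\dotsc,n_r)\in\mathbb{N}^r$, and $\mathbb{P}^{\mathbf{n}}=\mathbb{P}^{n_1}\times\dotsb\times\mathbb{P}^{n_r}$ over $\Bbbk$. Its Cox ring is $S=\Bbbk[x_{i,j}: 1\le i\le r,\ 0\le j\le n_i]$, graded by $\operatorname{Pic}(\mathbb{P}^{\mathbf{n}})=\mathbb{Z}^r$ via $\deg(x_{i,j})=\mathbf{e}_i$, and its irrelevant ideal is $B=\bigcap_{i=1}^r\langle x_{i,0},\dotsc,x_{i,n_i}\rangle$. A graded $S$-module $M$ determines a quasi-coherent sheaf $\widetilde{M}$ on $\mathbb{P}^{\mathbf{n}}$ (on the open set where a product $x_{1,j_1}\dotsb x_{r,j_r}$ is nonzero, its sections are the degree-$\mathbf{0}$ part of the localization of $M$ at that product). The $B$-saturated ideal of a closed subscheme $Z$ is the unique homogeneous ideal $I$ with $(I:B^\infty)=I$ and $\widetilde{I}=\mathcal{I}_Z$. A complex $F=[F_0\leftarrow F_1\leftarrow\dotsb]$ of finitely generated graded free $S$-modules is a virtual resolution of $M$ if $\widetilde{F}$ is a locally free resolution of $\widetilde{M}$. An associated prime of $I$ means an associated prime of the $S$-module $S/I$. *)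

theory Defs
  imports
    "HOL-Library.Poly_Mapping"
    "HOL-Library.Extended_Nat"
    "HOL-Algebra.Module"
    "HOL-Algebra.QuotRing"
    "HOL-Algebra.Ideal_Product"
begin

section \<open>Codimension and associated primes\<close>

definition height :: "('a, 'z) ring_scheme \<Rightarrow> 'a set \<Rightarrow> enat" where
  "height R P = Sup {enat k | k. \<exists>C. C k = P \<and> (\<forall>i\<le>k. primeideal (C i) R) \<and> (\<forall>i<k. C i \<subset> C (Suc i))}"

text \<open>The codimension of the closed subset \<open>V(\<aa>)\<close> of the spectrum of \<open>R\<close>; it is infinite if
  \<open>\<aa>\<close> is the unit ideal.\<close>

definition ideal_codim :: "('a, 'z) ring_scheme \<Rightarrow> 'a set \<Rightarrow> enat" where
  "ideal_codim R \<aa> = (INF P\<in>{P. primeideal P R \<and> \<aa> \<subseteq> P}. height R P)"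

definition associated_prime ::
    "('a, 'y) ring_scheme \<Rightarrow> ('a, 'b, 'z) module_scheme \<Rightarrow> 'a set \<Rightarrow> bool" where
  "associated_prime R M P \<longleftrightarrow>
     primeideal P R \<and> (\<exists>x\<in>carrier M. P = {a \<in> carrier R. a \<odot>\<^bsub>M\<^esub> x = \<zero>\<^bsub>M\<^esub>})"


section \<open>The Cox ring of a product of projective spaces\<close>

text \<open>The list \<open>n = [n\<^sub>1, \<dots>, n\<^sub>r]\<close> encodes the product of the projective spaces of dimension
  \<open>n\<^sub>i\<close>; its factors are numbered from \<open>0\<close> to \<open>r - 1\<close> below. A polynomial is a finitely supported
  family of coefficients indexed by monomials, a monomial being a finitely supported family of
  exponents. The multidegree group \<open>\<int>\<^sup>r\<close> consists of the \<open>d :: nat \<Rightarrow>\<^sub>0 int\<close> supported below \<open>r\<close>.\<close>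

type_synonym 'k mpoly = "((nat \<times> nat) \<Rightarrow>\<^sub>0 nat) \<Rightarrow>\<^sub>0 'k"

type_synonym mdegree = "nat \<Rightarrow>\<^sub>0 int"

text \<open>A module record also carries the multiplication and unit of a ring. They are irrelevant for
  modules, but they allow the Cox ring to be at the same time a ring and a module over itself.\<close>

record ('a, 'b) gmodule = "('a, 'b) module" +
  hpart :: "mdegree \<Rightarrow> 'b set"

definition multidegrees :: "nat list \<Rightarrow> mdegree set" where
  "multidegrees n = {d. Poly_Mapping.keys d \<subseteq> {..<length n}}"

definition variables :: "nat list \<Rightarrow> (nat \<times> nat) set" where
  "variables n = {(i, j). i < length n \<and> j \<le> n ! i}"

definition var :: "nat \<times> nat \<Rightarrow> 'k::field mpoly" where
  "var v = Poly_Mapping.single (Poly_Mapping.single v 1) 1"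

definition monom_degree :: "((nat \<times> nat) \<Rightarrow>\<^sub>0 nat) \<Rightarrow> mdegree" where
  "monom_degree m =
     (\<Sum>v\<in>Poly_Mapping.keys m. Poly_Mapping.single (fst v) (int (Poly_Mapping.lookup m v)))"

definition cox_carrier :: "nat list \<Rightarrow> 'k::field mpoly set" where
  "cox_carrier n = {p. \<forall>m\<in>Poly_Mapping.keys p. Poly_Mapping.keys m \<subseteq> variables n}"

definition cox :: "nat list \<Rightarrow> ('k::field mpoly, 'k mpoly) gmodule" where
  "cox n = \<lparr>carrier = cox_carrier n, mult = (*), one = 1, zero = 0, add = (+), smult = (*),
     hpart = (\<lambda>d. {p \<in> cox_carrier n. \<forall>m\<in>Poly_Mapping.keys p. monom_degree m = d})\<rparr>"

definition irrelevant_ideal :: "nat list \<Rightarrow> 'k::field mpoly set" where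
  "irrelevant_ideal n =
     carrier (cox n) \<inter> (\<Inter>i<length n. Idl\<^bsub>cox n\<^esub> {var (i, j) | j. j \<le> n ! i})"

definition homogeneous_ideal :: "nat list \<Rightarrow> 'k::field mpoly set \<Rightarrow> bool" where
  "homogeneous_ideal n I \<longleftrightarrow>
     ideal I (cox n) \<and> I = Idl\<^bsub>cox n\<^esub> (I \<inter> (\<Union>d\<in>multidegrees n. hpart (cox n) d))"

text \<open>The saturation \<open>(I : B\<^sup>\<infinity>)\<close>, the union of the colon ideals \<open>(I : B\<^sup>k)\<close>.\<close>

definition B_saturation :: "nat list \<Rightarrow> 'k::field mpoly set \<Rightarrow> 'k mpoly set" where
  "B_saturation n I =
     {s \<in> carrier (cox n). \<exists>k::nat. \<forall>b\<in>irrelevant_ideal n [^]\<^bsub>ideals_set (cox n)\<^esub> k.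
        s \<otimes>\<^bsub>cox n\<^esub> b \<in> I}"


section \<open>Graded modules\<close>

definition graded_module :: "nat list \<Rightarrow> ('k::field mpoly, 'b) gmodule \<Rightarrow> bool" where
  "graded_module n M \<longleftrightarrow>
     module (cox n) M \<and>
     (\<forall>d\<in>multidegrees n. additive_subgroup (hpart M d) M) \<and>
     (\<forall>d\<in>multidegrees n. \<forall>e\<in>multidegrees n. \<forall>a\<in>hpart (cox n) d. \<forall>x\<in>hpart M e.
        a \<odot>\<^bsub>M\<^esub> x \<in> hpart M (d + e)) \<and>
     (\<forall>d. d \<notin> multidegrees n \<longrightarrow> hpart M d = {\<zero>\<^bsub>M\<^esub>}) \<and>
     (\<forall>x\<in>carrier M. \<exists>!h. (\<forall>d. h d \<in> hpart M d) \<and> finite {d. h d \<noteq> \<zero>\<^bsub>M\<^esub>} \<and>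
        x = (\<Oplus>\<^bsub>M\<^esub>d\<in>{d. h d \<noteq> \<zero>\<^bsub>M\<^esub>}. h d))"

text \<open>A finitely generated graded free module is one with a finite basis of homogeneous elements,
  i.e. a finite direct sum of twists of the Cox ring.\<close>

definition fg_graded_free :: "nat list \<Rightarrow> ('k::field mpoly, 'b) gmodule \<Rightarrow> bool" where
  "fg_graded_free n M \<longleftrightarrow>
     graded_module n M \<and>
     (\<exists>E. finite E \<and> E \<subseteq> (\<Union>d\<in>multidegrees n. hpart M d) \<and>
        (\<forall>x\<in>carrier M. \<exists>!a. a \<in> E \<rightarrow>\<^sub>E carrier (cox n) \<and> x = (\<Oplus>\<^bsub>M\<^esub>e\<in>E. a e \<odot>\<^bsub>M\<^esub> e)))"

definition linear_maps :: "('a, 'x) ring_scheme \<Rightarrow> ('a, 'b, 'y) module_scheme \<Rightarrow>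
    ('a, 'c, 'z) module_scheme \<Rightarrow> ('b \<Rightarrow> 'c) set" where
  "linear_maps R M N = {h \<in> carrier M \<rightarrow> carrier N.
     (\<forall>x\<in>carrier M. \<forall>y\<in>carrier M. h (x \<oplus>\<^bsub>M\<^esub> y) = h x \<oplus>\<^bsub>N\<^esub> h y) \<and>
     (\<forall>a\<in>carrier R. \<forall>x\<in>carrier M. h (a \<odot>\<^bsub>M\<^esub> x) = a \<odot>\<^bsub>N\<^esub> h x)}"

definition graded_maps :: "nat list \<Rightarrow> ('k::field mpoly, 'b) gmodule \<Rightarrow>
    ('k mpoly, 'c) gmodule \<Rightarrow> ('b \<Rightarrow> 'c) set" where
  "graded_maps n M N = {h \<in> linear_maps (cox n) M N. \<forall>d. h ` hpart M d \<subseteq> hpart N d}"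

definition cox_mod :: "nat list \<Rightarrow> 'k::field mpoly set \<Rightarrow> ('k mpoly, 'k mpoly set) gmodule" where
  "cox_mod n I = \<lparr>carrier = carrier (cox n Quot I), mult = mult (cox n Quot I),
     one = one (cox n Quot I), zero = zero (cox n Quot I), add = add (cox n Quot I),
     smult = (\<lambda>a. rcoset_mult (cox n) I (I +>\<^bsub>cox n\<^esub> a)),
     hpart = (\<lambda>d. (\<lambda>s. I +>\<^bsub>cox n\<^esub> s) ` hpart (cox n) d)\<rparr>"


section \<open>Quasi-coherent sheaves on the product of projective spaces\<close>

text \<open>\<open>loc_frac n M f x k\<close> is the fraction \<open>x / f\<^sup>k\<close> in the localization of the module \<open>M\<close> at \<open>f\<close>.\<close>

definition loc_frac :: "nat list \<Rightarrow> ('k::field mpoly, 'b) gmodule \<Rightarrow> 'k mpoly \<Rightarrow> 'b \<Rightarrow> nat \<Rightarrow>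
    ('b \<times> nat) set" where
  "loc_frac n M f x k = {(y, l). y \<in> carrier M \<and>
     (\<exists>q::nat. (f [^]\<^bsub>cox n\<^esub> (q + l)) \<odot>\<^bsub>M\<^esub> x = (f [^]\<^bsub>cox n\<^esub> (q + k)) \<odot>\<^bsub>M\<^esub> y)}"

text \<open>For a monomial \<open>f\<close>, the degree zero part of the localization of \<open>M\<close> at \<open>f\<close>. For \<open>M = cox n\<close>
  it is the coordinate ring of the open set \<open>f \<noteq> 0\<close>, and in general a module over that ring.\<close>

definition sections :: "nat list \<Rightarrow> ('k::field mpoly, 'b) gmodule \<Rightarrow> 'k mpoly \<Rightarrow>
    (('k mpoly \<times> nat) set, ('b \<times> nat) set) module" where
  "sections n M f = \<lparr>
     carrier = {loc_frac n M f x k | x k d. x \<in> hpart M d \<and> f [^]\<^bsub>cox n\<^esub> k \<in> hpart (cox n) d},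
     mult = (\<lambda>s t. \<Union>(x, k)\<in>s. \<Union>(y, l)\<in>t. loc_frac n M f (x \<otimes>\<^bsub>M\<^esub> y) (k + l)),
     one = loc_frac n M f \<one>\<^bsub>M\<^esub> 0,
     zero = loc_frac n M f \<zero>\<^bsub>M\<^esub> 0,
     add = (\<lambda>s t. \<Union>(x, k)\<in>s. \<Union>(y, l)\<in>t.
       loc_frac n M f ((f [^]\<^bsub>cox n\<^esub> l) \<odot>\<^bsub>M\<^esub> x \<oplus>\<^bsub>M\<^esub> (f [^]\<^bsub>cox n\<^esub> k) \<odot>\<^bsub>M\<^esub> y) (k + l)),
     smult = (\<lambda>s t. \<Union>(a, k)\<in>s. \<Union>(y, l)\<in>t. loc_frac n M f (a \<odot>\<^bsub>M\<^esub> y) (k + l))\<rparr>"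

abbreviation structure_ring :: "nat list \<Rightarrow> 'k::field mpoly \<Rightarrow>
    (('k mpoly \<times> nat) set, ('k mpoly \<times> nat) set) module" where
  "structure_ring n f \<equiv> sections n (cox n) f"

text \<open>Restriction of sections from \<open>f \<noteq> 0\<close> to \<open>f g \<noteq> 0\<close>: \<open>x / f\<^sup>k = g\<^sup>k x / (f g)\<^sup>k\<close>.\<close>

definition restrict_section :: "nat list \<Rightarrow> ('k::field mpoly, 'b) gmodule \<Rightarrow> 'k mpoly \<Rightarrow>
    'k mpoly \<Rightarrow> ('b \<times> nat) set \<Rightarrow> ('b \<times> nat) set" where
  "restrict_section n M f g s =
     (\<Union>(x, k)\<in>s. loc_frac n M (f \<otimes>\<^bsub>cox n\<^esub> g) ((g [^]\<^bsub>cox n\<^esub> k) \<odot>\<^bsub>M\<^esub> x) k)"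

text \<open>The standard affine cover, given by the products of one variable from each factor. An affine
  open set of the cover is represented by the corresponding monomial.\<close>

definition charts :: "nat list \<Rightarrow> 'k::field mpoly set" where
  "charts n = {\<Prod>i<length n. var (i, j i) | j. \<forall>i<length n. j i \<le> n ! i}"

definition overlaps :: "nat list \<Rightarrow> 'k::field mpoly set" where
  "overlaps n = {f \<otimes>\<^bsub>cox n\<^esub> g | f g. f \<in> charts n \<and> g \<in> charts n}"

text \<open>A morphism between the sheaves of \<open>M\<close> and \<open>N\<close> is given by linear maps on the charts and on
  their pairwise intersections that are compatible with restriction. It need not be induced by a
  homomorphism from \<open>M\<close> to \<open>N\<close>.\<close>

definition sheaf_morphisms :: "nat list \<Rightarrow> ('k::field mpoly, 'b) gmodule \<Rightarrow>
    ('k mpoly, 'c) gmodule \<Rightarrow> ('k mpoly \<Rightarrow> ('b \<times> nat) set \<Rightarrow> ('c \<times> nat) set) set" where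
  "sheaf_morphisms n M N = {\<phi>.
     (\<forall>f\<in>charts n \<union> overlaps n.
        \<phi> f \<in> linear_maps (structure_ring n f) (sections n M f) (sections n N f)) \<and>
     (\<forall>f\<in>charts n. \<forall>g\<in>charts n. \<forall>s\<in>carrier (sections n M f).
        \<phi> (f \<otimes>\<^bsub>cox n\<^esub> g) (restrict_section n M f g s) = restrict_section n N f g (\<phi> f s))}"

text \<open>The map on sections induced by a graded homomorphism into \<open>N\<close>.\<close>

definition induced_map :: "nat list \<Rightarrow> ('k::field mpoly, 'c) gmodule \<Rightarrow> ('b \<Rightarrow> 'c) \<Rightarrow> 'k mpoly \<Rightarrow>
    ('b \<times> nat) set \<Rightarrow> ('c \<times> nat) set" where
  "induced_map n N h f s = (\<Union>(x, k)\<in>s. loc_frac n N f (h x) k)"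


section \<open>Closed subschemes\<close>

text \<open>A closed subscheme is given by its quasi-coherent ideal sheaf, that is, by an ideal in the
  coordinate ring of each chart such that the ideals of two charts generate the same ideal on their
  intersection.\<close>

definition closed_subscheme :: "nat list \<Rightarrow> ('k::field mpoly \<Rightarrow> ('k mpoly \<times> nat) set set) \<Rightarrow> bool"
  where
  "closed_subscheme n Z \<longleftrightarrow>
     (\<forall>f\<in>charts n. ideal (Z f) (structure_ring n f)) \<and>
     (\<forall>f\<in>charts n. \<forall>g\<in>charts n.
        Idl\<^bsub>structure_ring n (f \<otimes>\<^bsub>cox n\<^esub> g)\<^esub> (restrict_section n (cox n) f g ` Z f) =
        Idl\<^bsub>structure_ring n (f \<otimes>\<^bsub>cox n\<^esub> g)\<^esub> (restrict_section n (cox n) g f ` Z g))"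

text \<open>Codimension is local: an irreducible closed subset has the same codimension in the whole space
  as its trace on any open set that it meets. The empty subscheme has infinite codimension.\<close>

definition subscheme_codim :: "nat list \<Rightarrow> ('k::field mpoly \<Rightarrow> ('k mpoly \<times> nat) set set) \<Rightarrow> enat"
  where
  "subscheme_codim n Z = (INF f\<in>charts n. ideal_codim (structure_ring n f) (Z f))"

text \<open>The sheaf of a homogeneous ideal \<open>I\<close>, as a subsheaf of the structure sheaf.\<close>

definition ideal_sheaf :: "nat list \<Rightarrow> 'k::field mpoly set \<Rightarrow> 'k mpoly \<Rightarrow> ('k mpoly \<times> nat) set set"
  where
  "ideal_sheaf n I f =
     {loc_frac n (cox n) f x k | x k d. x \<in> I \<inter> hpart (cox n) d \<and> f [^]\<^bsub>cox n\<^esub> k \<in> hpart (cox n) d}"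

definition B_saturated_ideal_of :: "nat list \<Rightarrow> ('k::field mpoly \<Rightarrow> ('k mpoly \<times> nat) set set) \<Rightarrow>
    'k mpoly set \<Rightarrow> bool" where
  "B_saturated_ideal_of n Z I \<longleftrightarrow>
     homogeneous_ideal n I \<and> B_saturation n I = I \<and> (\<forall>f\<in>charts n. ideal_sheaf n I f = Z f)"


section \<open>Virtual resolutions\<close>

text \<open>\<open>F\<close> is the complex with differentials \<open>D i\<close> from \<open>F (Suc i)\<close> to \<open>F i\<close>. Exactness of a
  sequence of quasi-coherent sheaves is tested on the charts.\<close>

definition virtual_resolution :: "nat list \<Rightarrow> ('k::field mpoly, 'c) gmodule \<Rightarrow>
    (nat \<Rightarrow> ('k mpoly, 'b) gmodule) \<Rightarrow> (nat \<Rightarrow> 'b \<Rightarrow> 'b) \<Rightarrow> bool" where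
  "virtual_resolution n M F D \<longleftrightarrow>
     (\<forall>i. fg_graded_free n (F i)) \<and>
     (\<forall>i. D i \<in> graded_maps n (F (Suc i)) (F i)) \<and>
     (\<forall>i. \<forall>x\<in>carrier (F (Suc (Suc i))). D i (D (Suc i) x) = \<zero>\<^bsub>F i\<^esub>) \<and>
     (\<exists>\<epsilon>\<in>sheaf_morphisms n (F 0) M. \<forall>f\<in>charts n.
        \<epsilon> f ` carrier (sections n (F 0) f) = carrier (sections n M f) \<and>
        a_kernel (sections n (F 0) f) (sections n M f) (\<epsilon> f) =
          induced_map n (F 0) (D 0) f ` carrier (sections n (F 1) f) \<and>
        (\<forall>i. a_kernel (sections n (F (Suc i)) f) (sections n (F i) f)
              (induced_map n (F i) (D i) f) =
          induced_map n (F (Suc i)) (D (Suc i)) f ` carrier (sections n (F (Suc (Suc i))) f)))"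

text \<open>The terms of index greater than \<open>c\<close> vanish. The term of index \<open>c\<close> itself may vanish as well.\<close>

definition has_length :: "(nat \<Rightarrow> ('a, 'b) gmodule) \<Rightarrow> nat \<Rightarrow> bool" where
  "has_length F c \<longleftrightarrow> (\<forall>i>c. carrier (F i) = {\<zero>\<^bsub>F i\<^esub>})"

end

theory Submission
  imports Defs "HOL-Computational_Algebra.Polynomial" "HOL-Library.Product_Lexorder"
begin

text \<open>Write \<open>S\<close> for the Cox ring and let \<open>P = (I : x)\<close> be an associated prime of \<open>I\<close>. Since \<open>I\<close> is
  saturated, \<open>P\<close> does not contain the irrelevant ideal, and so some chart monomial \<open>f\<close> lies outside
  \<open>P\<close> (lemma \<open>irrelevant_not_in_associated_prime\<close>). The height of \<open>P\<close> is bounded from both sides.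

  The fractions \<open>p / f\<^sup>k\<close> of degree zero with \<open>p \<in> P\<close> form a prime of the coordinate ring of the chart \<open>f \<noteq> 0\<close>, and
  this prime contains the ideal of \<open>Z\<close>, so its height is at least \<open>c\<close>. A chain of primes below it
  lifts to a chain of homogeneous primes of \<open>S\<close> below \<open>P\<close> (\<open>height_prime_on_chart_le\<close>). Hence \<open>P\<close>
  has height at least \<open>c\<close>.

  The other bound says that depth does not exceed projective dimension in the local ring at \<open>P\<close>,
  together with the fact that \<open>S\<close> is Cohen-Macaulay. Both have elementary substitutes here. Suppose
  that a chain of primes of length \<open>k > c\<close> ends in \<open>P\<close>. Let \<open>Y\<close> be a maximal set of variables such
  that \<open>P\<close> contains no nonzero polynomial in \<open>Y\<close>; a transcendence degree argument leaves at least
  \<open>k\<close> variables outside \<open>Y\<close>. By maximality each of them, say \<open>y\<close>, occurs in a nonzero polynomial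
  of \<open>P\<close> in the variables \<open>Y\<close> and \<open>y\<close> alone. After inverting the nonzero polynomials in \<open>Y\<close>, none
  of which lies in \<open>P\<close>, such polynomials in separate variables form a regular sequence
  (\<open>regular_sequence_of_chain\<close>). On the other hand, the elements of this sequence kill a nonzero
  element of the module that \<open>F\<close> resolves at \<open>P\<close>, that is, a Koszul homology group of degree \<open>k\<close>
  does not vanish. It is also a Tor group that can be computed from \<open>F\<close>, so the term of \<open>F\<close> of
  index \<open>k\<close> is not zero (\<open>free_resolution_reaches_length_of_regular_sequence\<close>), against the
  assumption on the length.

  A virtual resolution is exact only as a complex of sheaves. On the chart of \<open>f\<close> this concerns
  degree zero, but a monomial in the variables dividing \<open>f\<close> moves any degree to a multiple of the
  degree of \<open>f\<close>, and these monomials lie outside \<open>P\<close>. So the complex of modules is exact up to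
  multipliers outside \<open>P\<close> (\<open>exact_outside_prime\<close>). The augmentation need not come from a map of
  modules, so the killed element is found by lifting the section \<open>x / f\<^sup>k\<close> to the term of index \<open>0\<close>
  (\<open>augmentation_lift\<close>). For this \<open>x\<close> must be homogeneous, which it can be taken to be
  (\<open>associated_prime_homogeneous\<close>).\<close>

section \<open>Subrings, ideals and localized ideals\<close>

text \<open>The coordinate rings at hand are subsets of one polynomial type, and many arguments mix several of
  them. Plain predicates on subsets of a commutative ring type keep ordinary ring arithmetic
  available.\<close>

definition unital_subring :: "'r::comm_ring_1 set \<Rightarrow> bool" where
  "unital_subring R \<longleftrightarrow> 0 \<in> R \<and> 1 \<in> R \<and> (\<forall>x\<in>R. - x \<in> R) \<and>
     (\<forall>x\<in>R. \<forall>y\<in>R. x + y \<in> R) \<and> (\<forall>x\<in>R. \<forall>y\<in>R. x * y \<in> R)"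

lemma unital_subringD:
  assumes "unital_subring R"
  shows "0 \<in> R" "1 \<in> R" "x \<in> R \<Longrightarrow> - x \<in> R" "x \<in> R \<Longrightarrow> y \<in> R \<Longrightarrow> x + y \<in> R"
    "x \<in> R \<Longrightarrow> y \<in> R \<Longrightarrow> x - y \<in> R" "x \<in> R \<Longrightarrow> y \<in> R \<Longrightarrow> x * y \<in> R"
proof -
  show "x \<in> R \<Longrightarrow> y \<in> R \<Longrightarrow> x - y \<in> R"
    using assms unfolding unital_subring_def by (metis add_uminus_conv_diff)
qed (use assms in \<open>auto simp: unital_subring_def\<close>)

lemma unital_subring_sum:
  assumes "unital_subring R" "\<And>x. x \<in> X \<Longrightarrow> f x \<in> R"
  shows "sum f X \<in> R"
  using assms(2) by (induction X rule: infinite_finite_induct) (auto intro: unital_subringD[OF assms(1)])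

definition ring_ideal :: "'r::comm_ring_1 set \<Rightarrow> 'r set \<Rightarrow> bool" where
  "ring_ideal R J \<longleftrightarrow> J \<subseteq> R \<and> 0 \<in> J \<and> (\<forall>x\<in>J. \<forall>y\<in>J. x + y \<in> J) \<and> (\<forall>r\<in>R. \<forall>x\<in>J. r * x \<in> J)"

lemma ring_idealD:
  assumes "unital_subring R" "ring_ideal R J"
  shows "J \<subseteq> R" "0 \<in> J" "x \<in> J \<Longrightarrow> y \<in> J \<Longrightarrow> x + y \<in> J" "r \<in> R \<Longrightarrow> x \<in> J \<Longrightarrow> r * x \<in> J"
    "x \<in> J \<Longrightarrow> - x \<in> J" "x \<in> J \<Longrightarrow> y \<in> J \<Longrightarrow> x - y \<in> J"
proof -
  show uminus: "- x \<in> J" if "x \<in> J" for x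
  proof -
    have "- 1 \<in> R" using unital_subringD(2,3)[OF assms(1)] by blast
    then have "- 1 * x \<in> J" using assms(2) that unfolding ring_ideal_def by blast
    then show ?thesis by simp
  qed
  show "x \<in> J \<Longrightarrow> y \<in> J \<Longrightarrow> x - y \<in> J"
    using uminus[of y] assms(2) unfolding ring_ideal_def by (metis add_uminus_conv_diff)
qed (use assms(2) in \<open>auto simp: ring_ideal_def\<close>)

lemma ring_ideal_sum:
  assumes "unital_subring R" "ring_ideal R J" "\<And>x. x \<in> X \<Longrightarrow> f x \<in> J"
  shows "sum f X \<in> J"
  using assms(3) by (induction X rule: infinite_finite_induct) (auto intro: ring_idealD[OF assms(1,2)])

definition mult_closed :: "'r::comm_ring_1 set \<Rightarrow> 'r set \<Rightarrow> bool" where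
  "mult_closed R T \<longleftrightarrow> T \<subseteq> R \<and> 1 \<in> T \<and> (\<forall>s\<in>T. \<forall>t\<in>T. s * t \<in> T)"

lemma mult_closedD:
  assumes "mult_closed R T"
  shows "t \<in> T \<Longrightarrow> t \<in> R" "1 \<in> T" "s \<in> T \<Longrightarrow> t \<in> T \<Longrightarrow> s * t \<in> T"
  using assms by (auto simp: mult_closed_def)

text \<open>A finite family of statements, each true after multiplication by some \<open>t \<in> T\<close>, becomes true with
  one common multiplier. This replaces passing to fractions for vectors.\<close>

lemma common_multiplier:
  assumes "finite E" "mult_closed R T"
    and "\<And>e. e \<in> E \<Longrightarrow> \<exists>t\<in>T. Q e t" "\<And>e s t. e \<in> E \<Longrightarrow> s \<in> T \<Longrightarrow> t \<in> T \<Longrightarrow> Q e t \<Longrightarrow> Q e (s * t)"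
  shows "\<exists>t\<in>T. \<forall>e\<in>E. Q e t"
  using assms(1,3,4)
proof (induction E rule: finite_induct)
  case empty
  then show ?case using mult_closedD(2)[OF assms(2)] by blast
next
  case (insert x E)
  then obtain t where t: "t \<in> T" "\<forall>e\<in>E. Q e t" by auto
  obtain s where s: "s \<in> T" "Q x s" using insert.prems(1) by blast
  have "Q x (t * s)" "\<forall>e\<in>E. Q e (s * t)" using insert.prems t s by auto
  then show ?case using mult_closedD(3)[OF assms(2) s(1) t(1)] by (auto simp: mult.commute)
qed

text \<open>The contraction to \<open>R\<close> of the ideal generated by \<open>a 0, \<dots>, a (k - 1)\<close> in the ring of fractions
  with denominators in \<open>T\<close>.\<close>

definition local_ideal :: "'r::comm_ring_1 set \<Rightarrow> 'r set \<Rightarrow> (nat \<Rightarrow> 'r) \<Rightarrow> nat \<Rightarrow> 'r set" where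
  "local_ideal R T a k =
     {s \<in> R. \<exists>t\<in>T. \<exists>h. (\<forall>i<k. h i \<in> R) \<and> t * s = (\<Sum>i<k. h i * a i)}"

lemma local_idealI:
  assumes "s \<in> R" "t \<in> T" "\<forall>i<k. h i \<in> R" "t * s = (\<Sum>i<k. h i * a i)"
  shows "s \<in> local_ideal R T a k"
  using assms by (auto simp: local_ideal_def)

lemma ring_ideal_local_ideal:
  assumes R: "unital_subring R" and T: "mult_closed R T"
  shows "ring_ideal R (local_ideal R T a k)"
  unfolding ring_ideal_def
proof (intro conjI ballI)
  note [simp] = unital_subringD[OF R] mult_closedD[OF T]
  show "local_ideal R T a k \<subseteq> R" by (auto simp: local_ideal_def)
  show "0 \<in> local_ideal R T a k"
    unfolding local_ideal_def by (intro CollectI conjI bexI[of _ 1] exI[of _ "\<lambda>_. 0"]) auto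
  fix x assume "x \<in> local_ideal R T a k"
  then obtain s g where x: "x \<in> R" "s \<in> T" "\<forall>i<k. g i \<in> R" "s * x = (\<Sum>i<k. g i * a i)"
    by (auto simp: local_ideal_def)
  { fix y assume "y \<in> local_ideal R T a k"
    then obtain t h where y: "y \<in> R" "t \<in> T" "\<forall>i<k. h i \<in> R" "t * y = (\<Sum>i<k. h i * a i)"
      by (auto simp: local_ideal_def)
    have "(s * t) * (x + y) = t * (s * x) + s * (t * y)" by (simp add: algebra_simps)
    also have "\<dots> = (\<Sum>i<k. (t * g i + s * h i) * a i)"
      unfolding x(4) y(4) by (simp add: sum_distrib_left sum.distrib algebra_simps)
    finally have "(s * t) * (x + y) = (\<Sum>i<k. (t * g i + s * h i) * a i)" .
    moreover have "\<forall>i<k. t * g i + s * h i \<in> R" using x y by auto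
    ultimately show "x + y \<in> local_ideal R T a k"
      using x(1,2) y(1,2) by (intro local_idealI[of _ _ "s * t"]) auto }
  { fix r assume r: "r \<in> R"
    have "s * (r * x) = (\<Sum>i<k. (r * g i) * a i)"
      using x(4) by (metis (no_types, lifting) mult.assoc mult.left_commute sum.cong sum_distrib_left)
    moreover have "\<forall>i<k. r * g i \<in> R" using x r by auto
    ultimately show "r * x \<in> local_ideal R T a k"
      using x(1,2) r by (intro local_idealI[of _ _ s]) auto }
qed

lemma local_ideal_saturated:
  assumes "mult_closed R T" "t \<in> T" "s \<in> R" "t * s \<in> local_ideal R T a k"
  shows "s \<in> local_ideal R T a k"
proof -
  obtain u h where "u \<in> T" "\<forall>i<k. h i \<in> R" "u * (t * s) = (\<Sum>i<k. h i * a i)"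
    using assms(4) by (auto simp: local_ideal_def)
  then show ?thesis unfolding local_ideal_def using assms(1-3) mult_closedD(3)[OF assms(1)]
    by (auto simp: mult.assoc intro!: bexI[of _ "u * t"])
qed

lemma local_ideal_SucD:
  assumes R: "unital_subring R" and T: "mult_closed R T"
    and a: "\<And>i. i < k \<Longrightarrow> a i \<in> R" and s: "s \<in> local_ideal R T a (Suc k)"
  shows "\<exists>t\<in>T. \<exists>r\<in>R. t * s - a k * r \<in> local_ideal R T a k"
proof -
  note [simp] = unital_subringD[OF R] mult_closedD[OF T]
  obtain t h where t: "t \<in> T" "\<forall>i<Suc k. h i \<in> R" "t * s = (\<Sum>i<Suc k. h i * a i)" "s \<in> R"
    using s by (auto simp: local_ideal_def)
  have eq: "t * s - a k * h k = (\<Sum>i<k. h i * a i)" using t(3) by (simp add: algebra_simps)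
  have "(\<Sum>i<k. h i * a i) \<in> R" using t a by (intro unital_subring_sum[OF R]) auto
  then have "t * s - a k * h k \<in> local_ideal R T a k"
    unfolding local_ideal_def using t(2)
    by (intro CollectI conjI bexI[of _ 1] exI[of _ h]) (auto simp: eq)
  then show ?thesis using t by (intro bexI[of _ t] bexI[of _ "h k"]) auto
qed

lemma local_ideal_SucI:
  assumes R: "unital_subring R" and T: "mult_closed R T"
    and "t \<in> T" "r \<in> R" "s \<in> R" and l: "t * s - a k * r \<in> local_ideal R T a k"
  shows "s \<in> local_ideal R T a (Suc k)"
proof -
  note [simp] = unital_subringD[OF R] mult_closedD[OF T]
  obtain u h where u: "u \<in> T" "\<forall>i<k. h i \<in> R" "u * (t * s - a k * r) = (\<Sum>i<k. h i * a i)"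
    using l by (auto simp: local_ideal_def)
  have "(u * t) * s = (\<Sum>i<Suc k. (if i < k then h i else u * r) * a i)"
    using u(3) by (simp add: algebra_simps)
  moreover have "\<forall>i<Suc k. (if i < k then h i else u * r) \<in> R" using u assms by auto
  moreover have "u * t \<in> T" using u assms by auto
  ultimately show ?thesis unfolding local_ideal_def using assms(5)
    by (intro CollectI conjI bexI[of _ "u * t"] exI[of _ "\<lambda>i. if i < k then h i else u * r"]) auto
qed

section \<open>Regular sequences and complexes of free modules\<close>

text \<open>A sequence of free modules with bases \<open>E i\<close> and matrices \<open>A i\<close>, where \<open>A i e e'\<close> is the coordinate
  at \<open>e'\<close> of the image of the basis element \<open>e\<close>.\<close>

locale matrix_complex =
  fixes R :: "'r::comm_ring_1 set" and T :: "'r set"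
    and E :: "nat \<Rightarrow> 'b set" and A :: "nat \<Rightarrow> 'b \<Rightarrow> 'b \<Rightarrow> 'r"
  assumes R: "unital_subring R" and T: "mult_closed R T"
    and fin: "\<And>i. finite (E i)"
    and A: "\<And>i e e'. e \<in> E (Suc i) \<Longrightarrow> e' \<in> E i \<Longrightarrow> A i e e' \<in> R"
begin

definition vectors :: "'r set \<Rightarrow> nat \<Rightarrow> ('b \<Rightarrow> 'r) set" where
  "vectors J i = {v. (\<forall>e\<in>E i. v e \<in> J) \<and> (\<forall>e. e \<notin> E i \<longrightarrow> v e = 0)}"

definition d :: "nat \<Rightarrow> ('b \<Rightarrow> 'r) \<Rightarrow> 'b \<Rightarrow> 'r" where
  "d i v e' = (if e' \<in> E i then \<Sum>e\<in>E (Suc i). v e * A i e e' else 0)"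

definition local_boundary :: "'r set \<Rightarrow> nat \<Rightarrow> ('b \<Rightarrow> 'r) \<Rightarrow> bool" where
  "local_boundary J i z \<longleftrightarrow> (\<exists>t\<in>T. \<exists>u\<in>vectors R (Suc i). \<forall>e. t * z e - d i u e \<in> J)"

lemma local_boundaryE:
  assumes "local_boundary J i z"
  obtains t u where "t \<in> T" "u \<in> vectors R (Suc i)" "\<forall>e. t * z e - d i u e \<in> J"
  using assms unfolding local_boundary_def by blast

lemma local_boundaryI:
  assumes "t \<in> T" "u \<in> vectors R (Suc i)" "\<forall>e. t * z e - d i u e \<in> J"
  shows "local_boundary J i z"
  using assms unfolding local_boundary_def by blast

lemmas subring = unital_subringD[OF R]

lemma d_linear: "d i (\<lambda>e. a * v e - b * w e) e' = a * d i v e' - b * d i w e'"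
  by (simp add: d_def sum_subtractf sum_distrib_left algebra_simps)

lemma vectors_linear:
  assumes "ring_ideal R J" "v \<in> vectors J i" "w \<in> vectors J i" "a \<in> R" "b \<in> R"
  shows "(\<lambda>e. a * v e - b * w e) \<in> vectors J i"
  using assms(2-) ring_idealD[OF R assms(1)] by (auto simp: vectors_def)

lemma vectors_in: "ring_ideal R J \<Longrightarrow> v \<in> vectors J i \<Longrightarrow> v e \<in> J"
  using ring_idealD(2)[OF R] by (cases "e \<in> E i") (auto simp: vectors_def)

lemma d_vectors:
  assumes J: "ring_ideal R J" and v: "v \<in> vectors J (Suc i)"
  shows "d i v \<in> vectors J i"
proof -
  have "d i v e' \<in> J" if "e' \<in> E i" for e'
  proof -
    have "v e * A i e e' \<in> J" if "e \<in> E (Suc i)" for e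
      using v A[OF that \<open>e' \<in> E i\<close>] ring_idealD(4)[OF R J] that
      by (auto simp: vectors_def mult.commute[of "v e"])
    then show ?thesis using that by (auto simp: d_def intro: ring_ideal_sum[OF R J])
  qed
  then show ?thesis by (auto simp: vectors_def d_def)
qed

lemma ring_ideal_self: "ring_ideal R R"
  using R by (auto simp: ring_ideal_def unital_subring_def)

lemma d_zero: "d i (\<lambda>_. 0) e = 0"
  by (simp add: d_def)

lemma d_outside: "e \<notin> E i \<Longrightarrow> d i v e = 0"
  by (simp add: d_def)

end

text \<open>Once the elements of \<open>T\<close> are inverted, the complex becomes exact in positive degrees, and each of
  \<open>a 0, \<dots>, a (m - 1)\<close> becomes a nonzerodivisor modulo the preceding ones.\<close>

locale regular_on_exact_complex = matrix_complex R T E A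
  for R :: "'r::comm_ring_1 set" and T and E :: "nat \<Rightarrow> 'b set" and A +
  fixes a :: "nat \<Rightarrow> 'r" and m :: nat
  assumes complex: "\<And>i v e. v \<in> vectors R (Suc (Suc i)) \<Longrightarrow> d i (d (Suc i) v) e = 0"
    and exact: "\<And>i v. v \<in> vectors R (Suc i) \<Longrightarrow> \<forall>e. d i v e = 0 \<Longrightarrow> local_boundary {0} (Suc i) v"
    and a: "\<And>k. k < m \<Longrightarrow> a k \<in> R"
    and regular: "\<And>k u. k < m \<Longrightarrow> u \<in> R \<Longrightarrow> a k * u \<in> local_ideal R T a k \<Longrightarrow> u \<in> local_ideal R T a k"
begin

abbreviation "J \<equiv> local_ideal R T a"

lemma J: "ring_ideal R (J k)"
  by (rule ring_ideal_local_ideal[OF R T])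

lemmas J_simps = ring_idealD[OF R J]

lemma vectors_J_SucD:
  assumes "k < m" "v \<in> vectors (J (Suc k)) i"
  shows "\<exists>t\<in>T. \<exists>r\<in>vectors R i. \<forall>e. t * v e - a k * r e \<in> J k"
proof -
  have "\<exists>t\<in>T. \<forall>e\<in>E i. \<exists>r\<in>R. t * v e - a k * r \<in> J k"
  proof (rule common_multiplier[OF fin T])
    fix e assume "e \<in> E i"
    then show "\<exists>t\<in>T. \<exists>r\<in>R. t * v e - a k * r \<in> J k"
      using assms a by (intro local_ideal_SucD[OF R T]) (auto simp: vectors_def)
  next
    fix e s t assume st: "s \<in> T" "t \<in> T" and "\<exists>r\<in>R. t * v e - a k * r \<in> J k"
    then obtain r where r: "r \<in> R" "t * v e - a k * r \<in> J k" by auto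
    have "s * (t * v e - a k * r) \<in> J k" using J_simps(4) r st mult_closedD[OF T] by blast
    then show "\<exists>r\<in>R. s * t * v e - a k * r \<in> J k"
      using r st mult_closedD[OF T] subring by (auto simp: algebra_simps intro!: bexI[of _ "s * r"])
  qed
  then obtain t r where t: "t \<in> T" "\<forall>e\<in>E i. r e \<in> R \<and> t * v e - a k * r e \<in> J k" by metis
  have "(\<lambda>e. if e \<in> E i then r e else 0) \<in> vectors R i" using t by (auto simp: vectors_def)
  moreover have "\<forall>e. t * v e - a k * (if e \<in> E i then r e else 0) \<in> J k"
    using t assms(2) J_simps(2) by (auto simp: vectors_def)
  ultimately show ?thesis using t(1) by (intro bexI[of _ t] bexI[of _ "\<lambda>e. if e \<in> E i then r e else 0"])
qed

text \<open>The vanishing of the Tor groups of index above \<open>k\<close> against the quotient by \<open>a 0, \<dots>, a (k - 1)\<close>.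
  A cycle \<open>v\<close> modulo \<open>k + 1\<close> elements has \<open>d v = a k * r\<close> modulo the first \<open>k\<close>. By regularity \<open>r\<close> is a
  cycle modulo the first \<open>k\<close>, hence a boundary \<open>d u\<close> there, and \<open>v - a k * u\<close> is again a cycle
  modulo the first \<open>k\<close>.\<close>

lemma exact_mod_regular:
  assumes "k \<le> m" "k \<le> i" "v \<in> vectors R (Suc i)" "\<forall>e. d i v e \<in> J k"
  shows "local_boundary (J k) (Suc i) v"
  using assms
proof (induction k arbitrary: i v)
  case 0
  have "\<exists>t\<in>T. \<forall>e\<in>E i. t * d i v e = 0"
  proof (rule common_multiplier[OF fin T])
    show "\<exists>t\<in>T. t * d i v e = 0" for e using 0(4)[rule_format, of e] by (simp add: local_ideal_def)
  qed (simp add: mult.assoc)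
  then obtain t where t: "t \<in> T" "\<forall>e\<in>E i. t * d i v e = 0" by auto
  let ?w = "\<lambda>e. t * v e - 0 * v e"
  have "?w \<in> vectors R (Suc i)"
    using 0(3) t(1) by (intro vectors_linear ring_ideal_self) (auto intro: subring mult_closedD[OF T])
  moreover have "\<forall>e. d i ?w e = 0" unfolding d_linear using t(2) by (auto simp: d_def)
  ultimately have "local_boundary {0} (Suc i) ?w" by (rule exact)
  then obtain s u where "s \<in> T" "u \<in> vectors R (Suc (Suc i))" "\<forall>e. s * (t * v e) - d (Suc i) u e = 0"
    by (auto simp: local_boundary_def)
  then show ?case unfolding local_boundary_def using t(1) J_simps(2) mult_closedD(3)[OF T]
    by (intro bexI[of _ "s * t"] bexI[of _ u]) (auto simp: mult.assoc)
next
  case (Suc k)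
  obtain j where i: "i = Suc j" using Suc.prems(2) by (cases i) auto
  have k: "k < m" "k \<le> j" using Suc.prems(1,2) i by auto
  note [simp] = subring mult_closedD[OF T] ring_ideal_self a[OF k(1)]
  have "d i v \<in> vectors (J (Suc k)) i" using Suc.prems(4) d_outside by (simp add: vectors_def)
  from vectors_J_SucD[OF k(1) this] obtain t r where
    t: "t \<in> T" "r \<in> vectors R i" "\<forall>e. t * d i v e - a k * r e \<in> J k" by auto
  have "(\<lambda>e. t * d i v e - a k * r e) \<in> vectors (J k) (Suc j)"
    using t(2,3) by (simp add: vectors_def d_outside i)
  from vectors_in[OF J d_vectors[OF J this]]
  have "\<forall>e. t * d j (d i v) e - a k * d j r e \<in> J k"
    unfolding d_linear by blast
  then have ad: "\<forall>e. - (a k * d j r e) \<in> J k" using complex[of v j] Suc.prems(3) i by auto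
  have "\<forall>e. d j r e \<in> J k"
  proof
    fix e
    have "d j r e \<in> R" using d_vectors[OF ring_ideal_self, of r j] t(2) subring
      by (cases "e \<in> E j") (auto simp: vectors_def d_def i)
    moreover have "a k * d j r e \<in> J k" using ad J_simps(5)[of "- (a k * d j r e)"] by auto
    ultimately show "d j r e \<in> J k" using regular[OF k(1)] by blast
  qed
  then have "local_boundary (J k) (Suc j) r" using Suc.IH[of j r] k t(2) i by auto
  then obtain s u where s: "s \<in> T" "u \<in> vectors R (Suc i)" "\<forall>e. s * r e - d i u e \<in> J k"
    unfolding i by (rule local_boundaryE)
  let ?w = "\<lambda>e. (s * t) * v e - a k * u e"
  have w: "?w \<in> vectors R (Suc i)"
    using s t Suc.prems(3) by (intro vectors_linear) auto
  have "\<forall>e. d i ?w e \<in> J k"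
  proof
    fix e
    have "d i ?w e = s * (t * d i v e - a k * r e) + a k * (s * r e - d i u e)"
      unfolding d_linear by (simp add: algebra_simps)
    also have "\<dots> \<in> J k" using s t by (intro J_simps(3) J_simps(4)) auto
    finally show "d i ?w e \<in> J k" .
  qed
  then have "local_boundary (J k) (Suc i) ?w" using Suc.IH[of i ?w] w Suc.prems by auto
  then obtain p q where p: "p \<in> T" "q \<in> vectors R (Suc (Suc i))" "\<forall>e. p * ?w e - d (Suc i) q e \<in> J k"
    by (rule local_boundaryE)
  have "\<forall>e. (p * s * t) * v e - d (Suc i) q e \<in> J (Suc k)"
  proof
    fix e
    have 1: "1 * ((p * s * t) * v e - d (Suc i) q e) - a k * (p * u e) \<in> J k"
      using p(3)[rule_format, of e] by (simp add: algebra_simps)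
    have vals: "v e \<in> R" "u e \<in> R" "d (Suc i) q e \<in> R"
      using Suc.prems(3) s(2) d_vectors[OF ring_ideal_self p(2)] subring(1)
      by (auto simp: vectors_def)
    show "(p * s * t) * v e - d (Suc i) q e \<in> J (Suc k)"
      by (rule local_ideal_SucI[OF R T _ _ _ 1]) (use vals p s t in auto)
  qed
  moreover have "p * s * t \<in> T" using p s t mult_closedD(3)[OF T] by simp
  ultimately show ?case using p(2) by (intro local_boundaryI)
qed

text \<open>One step of dimension shifting. Let \<open>z\<close> be a class in degree \<open>k\<close>, modulo the first \<open>k\<close> elements, that
  is not a boundary but is killed by the whole sequence. Writing \<open>a k * z = d w\<close> produces a class \<open>w\<close> in
  degree \<open>k + 1\<close>, modulo one more element, with the same two properties.\<close>

lemma descend: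
  assumes k: "k < m" and z: "z \<in> vectors R k" "\<not> local_boundary (J k) k z"
    and az: "\<And>j. j < m \<Longrightarrow> local_boundary (J k) k (\<lambda>e. a j * z e)"
  shows "\<exists>w\<in>vectors R (Suc k). \<not> local_boundary (J (Suc k)) (Suc k) w \<and>
           (\<forall>j<m. local_boundary (J (Suc k)) (Suc k) (\<lambda>e. a j * w e))"
proof -
  note [simp] = subring mult_closedD[OF T] ring_ideal_self a
  obtain t w where t: "t \<in> T" "w \<in> vectors R (Suc k)" "\<forall>e. t * (a k * z e) - d k w e \<in> J k"
    using az[OF k] by (rule local_boundaryE)
  have inR: "u e \<in> R" if "u \<in> vectors R i" for u i e using that subring(1) by (auto simp: vectors_def)
  have "local_boundary (J (Suc k)) (Suc k) (\<lambda>e. a j * w e)" if j: "j < m" for j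
  proof -
    obtain s v where s: "s \<in> T" "v \<in> vectors R (Suc k)" "\<forall>e. s * (a j * z e) - d k v e \<in> J k"
      using az[OF j] by (rule local_boundaryE)
    let ?x = "\<lambda>e. (s * a j) * w e - (t * a k) * v e"
    have x: "?x \<in> vectors R (Suc k)" using s t k j by (intro vectors_linear) auto
    have "\<forall>e. d k ?x e \<in> J k"
    proof
      fix e
      have "d k ?x e = (t * a k) * (s * (a j * z e) - d k v e) - (s * a j) * (t * (a k * z e) - d k w e)"
        unfolding d_linear by (simp add: algebra_simps)
      also have "\<dots> \<in> J k" using s t k j by (intro J_simps(6)[OF J_simps(4) J_simps(4)]) auto
      finally show "d k ?x e \<in> J k" .
    qed
    then have "local_boundary (J k) (Suc k) ?x" using exact_mod_regular[of k k ?x] x k by auto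
    then obtain p q where p: "p \<in> T" "q \<in> vectors R (Suc (Suc k))" "\<forall>e. p * ?x e - d (Suc k) q e \<in> J k"
      by (rule local_boundaryE)
    have "\<forall>e. (p * s) * (a j * w e) - d (Suc k) q e \<in> J (Suc k)"
    proof
      fix e
      have 1: "1 * ((p * s) * (a j * w e) - d (Suc k) q e) - a k * (p * t * v e) \<in> J k"
        using p(3)[rule_format, of e] by (simp add: algebra_simps)
      show "(p * s) * (a j * w e) - d (Suc k) q e \<in> J (Suc k)"
        by (rule local_ideal_SucI[OF R T _ _ _ 1])
          (use p s t j inR[OF t(2)] inR[OF s(2)] inR[OF d_vectors[OF ring_ideal_self p(2)]] in auto)
    qed
    moreover have "p * s \<in> T" using p s mult_closedD(3)[OF T] by simp
    ultimately show ?thesis using p(2) by (intro local_boundaryI)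
  qed
  moreover have "\<not> local_boundary (J (Suc k)) (Suc k) w"
  proof
    assume "local_boundary (J (Suc k)) (Suc k) w"
    then obtain s v where s: "s \<in> T" "v \<in> vectors R (Suc (Suc k))"
        "\<forall>e. s * w e - d (Suc k) v e \<in> J (Suc k)"
      by (rule local_boundaryE)
    let ?x = "\<lambda>e. s * w e - 1 * d (Suc k) v e"
    have "?x \<in> vectors (J (Suc k)) (Suc k)" using s t(2) by (simp add: vectors_def d_outside)
    from vectors_J_SucD[OF k this] obtain p r where
      p: "p \<in> T" "r \<in> vectors R (Suc k)" "\<forall>e. p * ?x e - a k * r e \<in> J k" by auto
    have "?x \<in> vectors R (Suc k)"
      using s t(2) by (intro vectors_linear d_vectors) auto
    then have "(\<lambda>e. p * ?x e - a k * r e) \<in> vectors (J k) (Suc k)"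
      using p(2,3) by (auto simp: vectors_def)
    from vectors_in[OF J d_vectors[OF J this]]
    have "\<forall>e. d k (\<lambda>e. p * ?x e - a k * r e) e \<in> J k"
      by blast
    moreover have "d k (\<lambda>e. p * ?x e - a k * r e) e = p * (s * d k w e) - a k * d k r e" for e
      unfolding d_linear using complex[OF s(2)] by simp
    ultimately have 1: "\<forall>e. p * (s * d k w e) - a k * d k r e \<in> J k" by simp
    have "\<forall>e. (p * s * t) * z e - d k r e \<in> J k"
    proof
      fix e
      have "a k * ((p * s * t) * z e - d k r e) =
          (p * (s * d k w e) - a k * d k r e) + (p * s) * (t * (a k * z e) - d k w e)"
        by (simp add: algebra_simps)
      also have "\<dots> \<in> J k" using 1 s p t by (intro J_simps(3) J_simps(4)) auto
      finally have "a k * ((p * s * t) * z e - d k r e) \<in> J k" .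
      moreover have "(p * s * t) * z e - d k r e \<in> R"
        using p s t inR[OF z(1)] inR[OF d_vectors[OF ring_ideal_self p(2)]] by auto
      ultimately show "(p * s * t) * z e - d k r e \<in> J k" using regular[OF k] by blast
    qed
    moreover have "p * s * t \<in> T" using p s t mult_closedD(3)[OF T] by simp
    ultimately have "local_boundary (J k) k z" using p(2) by (intro local_boundaryI)
    then show False using z(2) by blast
  qed
  ultimately show ?thesis using t(2) by blast
qed

text \<open>An element of the cokernel of \<open>d 0\<close> that is killed by a regular sequence of length \<open>m\<close> and does not
  vanish shifts up to a nonzero vector in degree \<open>m\<close>. In other words, the depth of the ring is at most
  the length of a free resolution of a module of depth zero.\<close>

theorem resolution_reaches_length_of_regular_sequence:
  assumes z: "z \<in> vectors R 0" "\<not> local_boundary {0} 0 z"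
    and az: "\<And>j. j < m \<Longrightarrow> local_boundary {0} 0 (\<lambda>e. a j * z e)"
  shows "\<exists>w\<in>vectors R m. \<exists>e. w e \<noteq> 0"
proof -
  have J0: "local_boundary (J 0) 0 z \<longleftrightarrow> local_boundary {0} 0 z"
    if zout: "\<And>e. e \<notin> E 0 \<Longrightarrow> z e = 0" for z :: "'b \<Rightarrow> 'r"
  proof
    assume "local_boundary {0} 0 z"
    then show "local_boundary (J 0) 0 z" using J_simps(2)[of 0] unfolding local_boundary_def by (metis singletonD)
  next
    assume "local_boundary (J 0) 0 z"
    then obtain s v where s: "s \<in> T" "v \<in> vectors R (Suc 0)" "\<forall>e. s * z e - d 0 v e \<in> J 0"
      by (rule local_boundaryE)
    have "\<exists>t\<in>T. \<forall>e\<in>E 0. t * (s * z e - d 0 v e) = 0"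
    proof (rule common_multiplier[OF fin T])
      show "\<exists>t\<in>T. t * (s * z e - d 0 v e) = 0" for e using s(3)[rule_format, of e] by (simp add: local_ideal_def)
    qed (simp add: mult.assoc)
    then obtain t where t: "t \<in> T" "\<forall>e\<in>E 0. t * (s * z e - d 0 v e) = 0" by auto
    have "\<forall>e. (t * s) * z e - d 0 (\<lambda>e. t * v e - 0 * v e) e = 0"
    proof
      fix e show "(t * s) * z e - d 0 (\<lambda>e. t * v e - 0 * v e) e = 0"
        unfolding d_linear using t zout by (cases "e \<in> E 0") (auto simp: d_outside algebra_simps)
    qed
    moreover have "(\<lambda>e. t * v e - 0 * v e) \<in> vectors R (Suc 0)"
      using s t by (intro vectors_linear ring_ideal_self) (auto intro: subring mult_closedD[OF T])
    ultimately show "local_boundary {0} 0 z"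
      using s t mult_closedD(3)[OF T] by (intro local_boundaryI) auto
  qed
  have "\<exists>w\<in>vectors R k. \<not> local_boundary (J k) k w \<and>
           (\<forall>j<m. local_boundary (J k) k (\<lambda>e. a j * w e))" if "k \<le> m" for k
    using that
  proof (induction k)
    case 0
    have "z e = 0" if "e \<notin> E 0" for e using z(1) that by (simp add: vectors_def)
    then have "\<not> local_boundary (J 0) 0 z" "\<forall>j<m. local_boundary (J 0) 0 (\<lambda>e. a j * z e)"
      using z(2) az J0[of z] J0[of "\<lambda>e. a j * z e" for j] by simp_all
    then show ?case using z(1) by blast
  next
    case (Suc k)
    then show ?case using descend by auto
  qed
  then obtain w where w: "w \<in> vectors R m" "\<not> local_boundary (J m) m w" by auto
  have "\<exists>e. w e \<noteq> 0"
  proof (rule ccontr)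
    assume "\<nexists>e. w e \<noteq> 0"
    then have "local_boundary (J m) m w"
      using mult_closedD(2)[OF T] subring(1) J_simps(2) unfolding local_boundary_def
      by (intro bexI[of _ 1] bexI[of _ "\<lambda>_. 0"]) (auto simp: d_zero vectors_def)
    then show False using w(2) by blast
  qed
  then show ?thesis using w(1) by blast
qed

end

section \<open>Pseudo-division and algebraic dependence\<close>

definition coeffs_in :: "'r::comm_ring_1 set \<Rightarrow> 'r poly \<Rightarrow> bool" where
  "coeffs_in R p \<longleftrightarrow> (\<forall>i. coeff p i \<in> R)"

lemma coeffs_in_simps:
  assumes "unital_subring R"
  shows "coeffs_in R 0" "c \<in> R \<Longrightarrow> coeffs_in R (monom c k)"
    "coeffs_in R p \<Longrightarrow> coeffs_in R q \<Longrightarrow> coeffs_in R (p + q)"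
    "coeffs_in R p \<Longrightarrow> coeffs_in R q \<Longrightarrow> coeffs_in R (p - q)"
    "coeffs_in R p \<Longrightarrow> coeffs_in R q \<Longrightarrow> coeffs_in R (p * q)"
    "c \<in> R \<Longrightarrow> coeffs_in R p \<Longrightarrow> coeffs_in R (smult c p)"
    "coeffs_in R p \<Longrightarrow> coeff p i \<in> R"
  using unital_subringD[OF assms]
  by (auto simp: coeffs_in_def coeff_mult intro!: unital_subring_sum[OF assms])

lemma unital_subring_power: "unital_subring R \<Longrightarrow> x \<in> R \<Longrightarrow> x ^ k \<in> R"
  by (induction k) (auto intro: unital_subringD)

lemma coeffs_in_poly:
  assumes R: "unital_subring R" and "coeffs_in R p" "y \<in> R"
  shows "poly p y \<in> R"
  unfolding poly_altdef using assms unital_subring_power[OF R]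
  by (intro unital_subring_sum[OF R] unital_subringD[OF R]) (auto simp: coeffs_in_def)

lemma degree_cancel_lead:
  fixes H G :: "'r::comm_ring_1 poly"
  assumes "degree G = e" "0 < e" "degree H = e + l"
  shows "degree (smult (lead_coeff G) H - monom (lead_coeff H) l * G) < e + l" (is "degree ?P < _")
proof -
  have "degree ?P \<le> e + l"
    using assms degree_monom_le[of "lead_coeff H" l] degree_mult_le[of "monom (lead_coeff H) l" G]
    by (intro degree_diff_le) (auto intro: order_trans[OF degree_smult_le])
  moreover have "coeff ?P (e + l) = 0"
    using assms by (simp add: coeff_monom_mult mult.commute[of "coeff G e"])
  ultimately show ?thesis using assms(2)
    by (metis add_gr_0 le_degree leading_coeff_0_iff le_neq_implies_less degree_0)
qed

text \<open>The coefficients of quotient and remainder stay in the subring \<open>R\<close>; the bound on the quotient lets its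
  leading coefficient be controlled when this is applied after one explicit division step.\<close>

lemma pseudo_division:
  fixes G H :: "'r::comm_ring_1 poly"
  assumes R: "unital_subring R" and G: "coeffs_in R G" "degree G = e" "0 < e"
  shows "coeffs_in R H \<Longrightarrow> degree H < e + l \<Longrightarrow>
    \<exists>s Q P. coeffs_in R Q \<and> coeffs_in R P \<and> degree P < e \<and> (\<forall>i\<ge>l. coeff Q i = 0) \<and>
      smult (lead_coeff G ^ s) H = Q * G + P"
proof (induction l arbitrary: H)
  case 0
  then show ?case using coeffs_in_simps(1)[OF R]
    by (intro exI[of _ 0] exI[of _ H]) auto
next
  case (Suc l)
  note cl = coeffs_in_simps[OF R]
  show ?case
  proof (cases "degree H < e + l")
    case True
    from Suc.IH[OF Suc.prems(1) this] show ?thesis using Suc_leD by blast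
  next
    case False
    then have deg: "degree H = e + l" using Suc.prems(2) by simp
    let ?c = "lead_coeff G"
    let ?H = "smult ?c H - monom (lead_coeff H) l * G"
    have "coeffs_in R ?H" using Suc.prems(1) G(1) by (intro cl) (auto simp: cl)
    from Suc.IH[OF this degree_cancel_lead[OF G(2,3) deg]] obtain s Q P where
      QP: "coeffs_in R Q" "coeffs_in R P" "degree P < e" "\<forall>i\<ge>l. coeff Q i = 0"
        "smult (?c ^ s) ?H = Q * G + P" by auto
    let ?Q = "Q + smult (?c ^ s) (monom (lead_coeff H) l)"
    have "smult (?c ^ Suc s) H = ?Q * G + P"
      using QP(5) by (simp add: smult_diff_right algebra_simps)
    moreover have "coeffs_in R ?Q"
      using Suc.prems(1) G(1) QP(1) by (intro cl unital_subring_power[OF R]) (auto simp: cl)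
    moreover have "\<forall>i\<ge>Suc l. coeff ?Q i = 0" using QP(4) by auto
    ultimately show ?thesis using QP(2,3) by blast
  qed
qed

definition prime_in :: "'r::comm_ring_1 set \<Rightarrow> 'r set \<Rightarrow> bool" where
  "prime_in R p \<longleftrightarrow> ring_ideal R p \<and> 1 \<notin> p \<and> (\<forall>a\<in>R. \<forall>b\<in>R. a * b \<in> p \<longrightarrow> a \<in> p \<or> b \<in> p)"

lemma prime_in_power:
  assumes "unital_subring R" "prime_in R p" "a \<in> R" "a ^ k \<in> p"
  shows "a \<in> p"
  using assms(4)
proof (induction k)
  case (Suc k)
  then show ?case
    using assms unital_subring_power[OF assms(1,3)] by (auto simp: prime_in_def)
qed (use assms(2) in \<open>simp add: prime_in_def\<close>)

text \<open>If \<open>y\<close> is algebraic over \<open>R\<close> modulo the prime \<open>p\<close>, then an ideal \<open>q\<close> containing \<open>p\<close> that has no new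
  elements in \<open>R\<close> has none in \<open>R[y]\<close> either. Take \<open>g\<close> of least degree with \<open>g(y)\<close> in \<open>q\<close> but not in
  \<open>p\<close>, and \<open>h\<close> of least degree with \<open>h(y) \<in> p\<close> and leading coefficient outside \<open>p\<close>: so \<open>h\<close> is a
  minimal polynomial of \<open>y\<close>. Division shows that \<open>g\<close> is a proper factor of it modulo \<open>p\<close>, and then
  the cofactor contradicts the choice of \<open>h\<close>.\<close>

lemma incomparable_algebraic:
  fixes S R :: "'r::comm_ring_1 set"
  assumes S: "unital_subring S" and R: "unital_subring R" and RS: "R \<subseteq> S" and y: "y \<in> S"
    and p: "prime_in S p" and q: "ring_ideal S q" and pq: "p \<subseteq> q"
    and contr: "q \<inter> R \<subseteq> p"
    and h0: "coeffs_in R h0" "poly h0 y \<in> p" "lead_coeff h0 \<notin> p"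
    and g0: "coeffs_in R g0" "poly g0 y \<in> q"
  shows "poly g0 y \<in> p"
proof (rule ccontr)
  assume g0p: "poly g0 y \<notin> p"
  have pi: "ring_ideal S p" and p1: "1 \<notin> p"
    and prime: "\<And>a b. a \<in> S \<Longrightarrow> b \<in> S \<Longrightarrow> a * b \<in> p \<Longrightarrow> a \<in> p \<or> b \<in> p"
    using p by (auto simp: prime_in_def)
  note pI = ring_idealD[OF S pi] and qI = ring_idealD[OF S q] and SI = unital_subringD[OF S]
  note cl = coeffs_in_simps[OF R]
  have inS: "poly f y \<in> S" if "coeffs_in R f" for f
    using that RS y by (intro coeffs_in_poly[OF S]) (auto simp: coeffs_in_def)
  have coS: "coeff f i \<in> S" if "coeffs_in R f" for f i using that RS by (auto simp: coeffs_in_def)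
  define bad where "bad g \<longleftrightarrow> coeffs_in R g \<and> poly g y \<in> q \<and> poly g y \<notin> p" for g
  define good where "good h \<longleftrightarrow> coeffs_in R h \<and> poly h y \<in> p \<and> lead_coeff h \<notin> p" for h
  obtain g where g: "bad g" and gmin: "\<And>g'. degree g' < degree g \<Longrightarrow> \<not> bad g'"
    using ex_has_least_nat[of bad g0 degree] g0 g0p by (auto simp: bad_def not_le[symmetric])
  obtain h where h: "good h" and hmin: "\<And>h'. degree h' < degree h \<Longrightarrow> \<not> good h'"
    using ex_has_least_nat[of good h0 degree] h0 by (auto simp: good_def not_le[symmetric])
  define c where "c = lead_coeff g"
  define e where "e = degree g"
  define m where "m = degree h"
  note gD = g[unfolded bad_def] and hD = h[unfolded good_def]
  have e: "0 < e"
  proof (rule ccontr)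
    assume "\<not> 0 < e"
    then obtain a where "g = [:a:]" using degree_eq_zeroE[of g] by (auto simp: e_def)
    then have "coeff g 0 \<in> q" "poly g y = coeff g 0" using gD by auto
    moreover have "coeff g 0 \<in> R" using gD by (auto simp: cl)
    ultimately show False using gD contr by auto
  qed
  have c: "c \<notin> p"
  proof
    assume "c \<in> p"
    let ?g = "g - monom c e"
    have "coeffs_in R ?g" using gD by (intro cl) (auto simp: cl c_def)
    moreover have "c * y ^ e \<in> p"
      using pI(4)[OF _ \<open>c \<in> p\<close>, of "y ^ e"] unital_subring_power[OF S y] by (simp add: mult.commute)
    then have "poly ?g y \<in> q" "poly ?g y \<notin> p"
      using gD pq qI(6)[of "poly g y" "c * y ^ e"] pI(3)[of "poly ?g y" "c * y ^ e"]
      by (auto simp: poly_monom)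
    ultimately have "bad ?g" by (simp add: bad_def)
    moreover have "degree ?g < degree g"
    proof -
      have "degree ?g \<le> e" using degree_monom_le[of c e] by (intro degree_diff_le) (auto simp: e_def)
      moreover have "coeff ?g e = 0" by (simp add: c_def e_def)
      ultimately show ?thesis using e unfolding e_def
        by (metis le_neq_implies_less leading_coeff_0_iff degree_0)
    qed
    ultimately show False using gmin by blast
  qed
  have cS: "c \<in> S" "c \<in> R" using gD coS by (auto simp: c_def cl)
  have hS: "lead_coeff h \<in> S" using hD coS by auto
  \<comment> \<open>If the degree of \<open>g\<close> were at least that of \<open>h\<close>, one division step by \<open>h\<close> would lower it.\<close>
  have em: "e < m"
  proof (rule ccontr)
    assume "\<not> e < m"
    then have deg: "degree g = m + (e - m)" by (simp add: e_def)
    let ?g = "smult (lead_coeff h) g - monom c (e - m) * h"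
    have lt: "degree ?g < degree g"
    proof (cases "m = 0")
      case True
      then obtain a where a: "h = [:a:]" using degree_eq_zeroE[of h] by (auto simp: m_def)
      then have "a \<in> p" "a \<notin> p" using hD by auto
      then show ?thesis by blast
    next
      case False
      then show ?thesis using degree_cancel_lead[of h m g "e - m"] deg by (simp add: m_def c_def)
    qed
    have "poly (monom c (e - m) * h) y \<in> p"
      using hD inS[OF cl(2)[OF cS(2)]] by (simp only: poly_mult) (auto intro: pI)
    moreover have "lead_coeff h * poly g y \<in> q" "lead_coeff h * poly g y \<notin> p"
      using hS gD qI(4) prime[OF hS inS[of g]] hD by auto
    ultimately have "poly ?g y \<in> q" "poly ?g y \<notin> p"
      using pq qI(6)[of "lead_coeff h * poly g y" "poly (monom c (e - m) * h) y"]
        pI(3)[of "poly ?g y" "poly (monom c (e - m) * h) y"] by auto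
    moreover have "coeffs_in R ?g" using gD hD cS by (intro cl) (auto simp: cl)
    ultimately have "bad ?g" by (simp add: bad_def)
    then show False using gmin lt by blast
  qed
  \<comment> \<open>Dividing \<open>h\<close> by \<open>g\<close> leaves a remainder that has to lie in \<open>p\<close>, so the quotient competes with \<open>h\<close>.\<close>
  let ?H = "smult c h - monom (lead_coeff h) (m - e) * g"
  have "degree ?H < e + (m - e)"
    using degree_cancel_lead[of g e h "m - e"] e em by (simp add: e_def m_def c_def)
  moreover have "coeffs_in R ?H" using gD hD cS by (intro cl) (auto simp: cl)
  ultimately obtain s Q P where QP: "coeffs_in R Q" "coeffs_in R P" "degree P < e"
      "\<forall>i\<ge>m - e. coeff Q i = 0" "smult (c ^ s) ?H = Q * g + P"
    using pseudo_division[OF R, of g e ?H "m - e"] gD e by (auto simp: e_def c_def)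
  let ?Q = "Q + smult (c ^ s) (monom (lead_coeff h) (m - e))"
  have eq: "smult (c ^ Suc s) h = ?Q * g + P"
    using QP(5) by (simp add: smult_diff_right algebra_simps)
  have Qc: "coeffs_in R ?Q"
    using hD QP(1) cS by (intro cl unital_subring_power[OF R]) (auto simp: cl)
  have ph: "c ^ Suc s * poly h y \<in> p"
    using hD cS by (intro pI(4) unital_subring_power[OF S]) auto
  have eqy: "c ^ Suc s * poly h y = poly ?Q y * poly g y + poly P y"
    using arg_cong[OF eq, of "\<lambda>f. poly f y"] by simp
  have "poly ?Q y * poly g y \<in> q" using inS[OF Qc] gD qI(4) by blast
  then have "poly P y \<in> q" using ph pq eqy qI(6)
    by (metis add_diff_cancel_left' subsetD)
  then have "poly P y \<in> p" using gmin[of P] QP(2,3) by (auto simp: bad_def e_def)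
  then have "poly ?Q y * poly g y \<in> p" using ph eqy pI(6) by (metis add_diff_cancel_right')
  then have "poly ?Q y \<in> p" using prime[OF inS[OF Qc] inS] gD by auto
  moreover have top: "coeff ?Q (m - e) = c ^ s * lead_coeff h" using QP(4) by simp
  have ntop: "c ^ s * lead_coeff h \<notin> p"
    using prime[OF unital_subring_power[OF S cS(1)] hS] prime_in_power[OF S p cS(1)] c hD by blast
  have degQ: "degree ?Q = m - e"
  proof (rule antisym)
    show "degree ?Q \<le> m - e" using QP(4) by (intro degree_le) auto
    show "m - e \<le> degree ?Q" using top ntop pI(2) by (intro le_degree) metis
  qed
  moreover have "lead_coeff ?Q \<notin> p" using top ntop degQ by simp
  ultimately have "good ?Q" using Qc by (simp add: good_def)
  moreover have "degree ?Q < degree h" using degQ e em by (simp add: m_def)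
  ultimately show False using hmin by blast
qed

text \<open>If the leading coefficient of \<open>G\<close> is a nonzerodivisor modulo \<open>J\<close>, then so is \<open>G\<close> itself modulo the
  polynomials with coefficients in \<open>J\<close>: the coefficients of \<open>U\<close> fall into \<open>J\<close> one after another,
  from the top.\<close>

lemma coeffs_of_product_in_ideal:
  fixes G U :: "'r::comm_ring_1 poly"
  assumes R: "unital_subring R" and J: "ring_ideal R J" and G: "coeffs_in R G"
    and lead: "\<And>x. x \<in> R \<Longrightarrow> lead_coeff G * x \<in> J \<Longrightarrow> x \<in> J"
  shows "coeffs_in R U \<Longrightarrow> coeffs_in J (G * U) \<Longrightarrow> coeffs_in J U"
proof (induction "if U = 0 then 0 else Suc (degree U)" arbitrary: U rule: less_induct)
  case less
  note JI = ring_idealD[OF R J] and cl = coeffs_in_simps[OF R]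
  show ?case
  proof (cases "U = 0")
    case True
    then show ?thesis using JI(2) by (simp add: coeffs_in_def)
  next
    case False
    define x where "x = lead_coeff U"
    have xR: "x \<in> R" using less.prems by (auto simp: x_def cl)
    have "lead_coeff G * x = coeff (G * U) (degree G + degree U)"
      by (simp add: x_def coeff_mult_degree_sum)
    then have x: "x \<in> J" using less.prems(2) lead[OF xR] by (simp add: coeffs_in_def)
    define V where "V = U - monom x (degree U)"
    have VR: "coeffs_in R V" unfolding V_def using less.prems(1) xR by (intro cl)
    have GM: "coeff (G * monom x (degree U)) i \<in> J" for i
      using G x JI by (auto simp: mult.commute[of G] coeff_monom_mult coeffs_in_def mult.commute[of x])
    have "coeffs_in J (G * V)"
      using less.prems(2) GM JI(6) by (simp add: V_def right_diff_distrib coeffs_in_def)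
    moreover have "V = 0 \<or> degree V < degree U"
    proof -
      have "degree V \<le> degree U"
        unfolding V_def using degree_monom_le[of x "degree U"] by (intro degree_diff_le) auto
      moreover have "coeff V (degree U) = 0" by (simp add: V_def x_def)
      ultimately show ?thesis by (metis le_neq_implies_less leading_coeff_0_iff)
    qed
    ultimately have "coeffs_in J V" using less.hyps[OF _ VR] False by auto
    moreover have "coeff U i = coeff V i + coeff (monom x (degree U)) i" for i by (simp add: V_def)
    ultimately show ?thesis using x JI(2,3) by (simp add: coeffs_in_def)
  qed
qed

section \<open>Heights and regular sequences in polynomial rings\<close>

abbreviation "lookup \<equiv> Poly_Mapping.lookup"
abbreviation "single \<equiv> Poly_Mapping.single"
abbreviation "keys \<equiv> Poly_Mapping.keys"

definition polys_in :: "(nat \<times> nat) set \<Rightarrow> 'k::field mpoly set" where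
  "polys_in V = {p. \<forall>m\<in>keys p. keys m \<subseteq> V}"

lemma polys_in_mono: "V \<subseteq> W \<Longrightarrow> polys_in V \<subseteq> polys_in W"
  unfolding polys_in_def by blast

lemma keys_add_nat: "keys (m + m' :: 'a \<Rightarrow>\<^sub>0 nat) = keys m \<union> keys m'"
  by (auto simp: in_keys_iff lookup_add)

lemma unital_subring_polys_in: "unital_subring (polys_in V :: 'k::field mpoly set)"
  unfolding unital_subring_def
proof (intro conjI ballI)
  fix p q :: "'k mpoly"
  assume p: "p \<in> polys_in V"
  then show "- p \<in> polys_in V" by (simp add: polys_in_def in_keys_iff)
  assume q: "q \<in> polys_in V"
  show "p + q \<in> polys_in V" using p q keys_add[of p q] by (auto simp: polys_in_def)
  show "p * q \<in> polys_in V"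
    unfolding polys_in_def
  proof (intro CollectI ballI)
    fix m assume "m \<in> keys (p * q)"
    then obtain a b where "m = a + b" "a \<in> keys p" "b \<in> keys q" using keys_mult by blast
    then show "keys m \<subseteq> V" using p q by (auto simp: polys_in_def keys_add_nat)
  qed
qed (auto simp: polys_in_def)

lemma var_in: "v \<in> V \<Longrightarrow> var v \<in> polys_in V"
  by (auto simp: polys_in_def var_def)

lemma monomial_expansion: "p = (\<Sum>m\<in>keys p. single m (lookup p m))"
  for p :: "'a \<Rightarrow>\<^sub>0 'b::comm_monoid_add"
  by (intro poly_mapping_eqI) (simp add: lookup_sum lookup_single when_def in_keys_iff)

lemma var_power: "var v ^ k = single (single v k) 1"
  by (induction k) (simp_all add: var_def mult_single single_add[symmetric] flip: single_one)

lemma in_polys_in_insert: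
  fixes p :: "'k::field mpoly"
  assumes "p \<in> polys_in (insert v V)"
  shows "\<exists>Q. coeffs_in (polys_in V) Q \<and> p = poly Q (var v)"
proof -
  define r where "r m = Poly_Mapping.update v 0 m" for m :: "(nat \<times> nat) \<Rightarrow>\<^sub>0 nat"
  define Q where "Q = (\<Sum>m\<in>keys p. monom (single (r m) (lookup p m)) (lookup m v))"
  have split: "m = r m + single v (lookup m v)" for m
    by (rule poly_mapping_eqI) (auto simp: r_def lookup_add lookup_update lookup_single when_def)
  have "p = (\<Sum>m\<in>keys p. single m (lookup p m))" by (rule monomial_expansion)
  also have "\<dots> = (\<Sum>m\<in>keys p. single (r m) (lookup p m) * var v ^ lookup m v)"
    by (intro sum.cong refl) (simp add: var_power mult_single flip: split)
  also have "\<dots> = poly Q (var v)"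
    by (simp add: Q_def poly_sum poly_monom)
  finally have "p = poly Q (var v)" .
  moreover have "coeffs_in (polys_in V) Q"
    unfolding coeffs_in_def
  proof
    fix i
    have "single (r m) (lookup p m) \<in> polys_in V" if "m \<in> keys p" for m
    proof -
      have "keys m \<subseteq> insert v V" using assms that by (auto simp: polys_in_def)
      then have "keys (r m) \<subseteq> V" by (auto simp: r_def keys_update)
      then show ?thesis by (auto simp: polys_in_def)
    qed
    then show "coeff Q i \<in> polys_in V"
      unfolding Q_def coeff_sum coeff_monom
      by (intro unital_subring_sum[OF unital_subring_polys_in])
        (auto intro: unital_subringD(1)[OF unital_subring_polys_in])
  qed
  ultimately show ?thesis by blast
qed

lemma lookup_mult_single_one:
  fixes c :: "'a::cancel_comm_monoid_add \<Rightarrow>\<^sub>0 'k::comm_semiring_1"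
  shows "lookup (c * single s 1) x = (\<Sum>m\<in>keys c. lookup c m when m + s = x)"
proof -
  have "c * single s 1 = (\<Sum>m\<in>keys c. single m (lookup c m)) * single s 1"
    using monomial_expansion[of c] by simp
  also have "\<dots> = (\<Sum>m\<in>keys c. single (m + s) (lookup c m))"
    by (simp add: sum_distrib_right mult_single)
  finally show ?thesis by (simp add: lookup_sum lookup_single)
qed

text \<open>Together with \<open>in_polys_in_insert\<close> this identifies the polynomials in the variables \<open>V\<close> and \<open>v\<close> with
  univariate polynomials in \<open>v\<close> over the polynomials in \<open>V\<close>.\<close>

lemma poly_var_eq_0:
  fixes Q :: "'k::field mpoly poly"
  assumes v: "v \<notin> V" and Q: "coeffs_in (polys_in V) Q" and "poly Q (var v) = 0"
  shows "Q = 0"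
proof (rule poly_eqI, rule poly_mapping_eqI)
  fix k m
  show "lookup (coeff Q k) m = lookup (coeff 0 k) m"
  proof (cases "m \<in> keys (coeff Q k)")
    case False
    then show ?thesis by (simp add: in_keys_iff)
  next
    case True
    have free: "lookup m' v = 0" if "m' \<in> keys (coeff Q i)" for m' i
      using that Q v by (force simp: coeffs_in_def polys_in_def in_keys_iff)
    have k: "k \<le> degree Q" using True by (intro le_degree) auto
    have eq: "m' + single v i = m + single v k \<longleftrightarrow> m' = m \<and> i = k" if "m' \<in> keys (coeff Q i)" for m' i
    proof
      assume *: "m' + single v i = m + single v k"
      have "lookup (m' + single v i) v = lookup (m + single v k) v" by (simp add: *)
      then have "i = k" using free[OF that] free[OF True] by (simp add: lookup_add)
      then show "m' = m \<and> i = k" using * by simp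
    qed simp
    have "lookup (coeff Q i * var v ^ i) (m + single v k) = (if i = k then lookup (coeff Q k) m else 0)" for i
    proof -
      have "lookup (coeff Q i * var v ^ i) (m + single v k) =
          (\<Sum>m'\<in>keys (coeff Q i). lookup (coeff Q i) m' when (m' = m \<and> i = k))"
        unfolding var_power lookup_mult_single_one using eq by (intro sum.cong) (auto simp: when_def)
      then show ?thesis using True by (simp add: when_def)
    qed
    then have "lookup (poly Q (var v)) (m + single v k) = lookup (coeff Q k) m"
      using k unfolding poly_altdef by (simp add: lookup_sum)
    then show ?thesis using assms(3) by simp
  qed
qed

lemma prime_inD:
  assumes "prime_in R p"
  shows "ring_ideal R p" "1 \<notin> p" "a \<in> R \<Longrightarrow> b \<in> R \<Longrightarrow> a * b \<in> p \<Longrightarrow> a \<in> p \<or> b \<in> p"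
  using assms by (auto simp: prime_in_def)

text \<open>The transcendence degree of the quotient drops along a strict inclusion of primes. It is measured by
  sets \<open>Y\<close> of variables that are algebraically independent modulo the prime. If \<open>Y\<close>, independent modulo
  \<open>q\<close>, could not be enlarged modulo \<open>p\<close>, then every variable would be algebraic over \<open>Y\<close> modulo \<open>p\<close>,
  and adding the variables one at a time would give \<open>q \<subseteq> p\<close>.\<close>

lemma extend_independent:
  fixes p q :: "'k::field mpoly set"
  assumes X: "finite X" and Y: "Y \<subseteq> X" and p: "prime_in (polys_in X) p" and q: "prime_in (polys_in X) q"
    and pq: "p \<subset> q" and indep: "q \<inter> polys_in Y = {0}"
  shows "\<exists>y\<in>X - Y. p \<inter> polys_in (insert y Y) = {0}"
proof (rule ccontr)
  note sub = unital_subring_polys_in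
  assume none: "\<not> ?thesis"
  have p0: "0 \<in> p" using prime_inD(1)[OF p] by (auto simp: ring_ideal_def)
  have alg: "\<exists>h\<in>p. h \<in> polys_in (insert y Y) \<and> h \<noteq> 0" if "y \<in> X - Y" for y
    using none that p0 unital_subringD(1)[OF sub] by blast
  \<comment> \<open>The variables in \<open>V\<close> are adjoined one after another; \<open>V = X - Y\<close> is the contradiction.\<close>
  have claim: "q \<inter> polys_in (Y \<union> V) \<subseteq> p" if "V \<subseteq> X - Y" for V
    using finite_subset[OF that finite_Diff[OF X]] that
  proof (induction V rule: finite_induct)
    case empty
    then show ?case using indep p0 by simp
  next
    case (insert v V)
    have IH: "q \<inter> polys_in (Y \<union> V) \<subseteq> p" using insert by auto
    show ?case
    proof
      fix g assume g: "g \<in> q \<inter> polys_in (Y \<union> insert v V)"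
      then obtain G where G: "coeffs_in (polys_in (Y \<union> V)) G" "g = poly G (var v)"
        using in_polys_in_insert[of g v "Y \<union> V"] by auto
      obtain h where h: "h \<in> p" "h \<in> polys_in (insert v Y)" "h \<noteq> 0" using alg[of v] insert.prems by auto
      then obtain H where H: "coeffs_in (polys_in Y) H" "h = poly H (var v)"
        using in_polys_in_insert[of h v Y] by auto
      have "lead_coeff H \<noteq> 0" using h(3) H(2) by auto
      moreover have "lead_coeff H \<in> polys_in Y" using H by (simp add: coeffs_in_def)
      ultimately have "lead_coeff H \<notin> p" using indep pq by blast
      moreover have "coeffs_in (polys_in (Y \<union> V)) H"
        using H(1) polys_in_mono[of Y "Y \<union> V"] by (auto simp: coeffs_in_def)
      ultimately show "g \<in> p"
        using incomparable_algebraic[OF sub[of X] sub[of "Y \<union> V"] _ _ p prime_inD(1)[OF q] _ IH, of "var v" H G]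
          G H h(1) g pq polys_in_mono[of "Y \<union> V" X] insert.prems Y var_in[of v X] by auto
    qed
  qed
  from claim[of "X - Y"] have "q \<inter> polys_in X \<subseteq> p" using Y by (simp add: Un_absorb1)
  then show False using pq prime_inD(1)[OF q] by (auto simp: ring_ideal_def)
qed

lemma chain_bound:
  fixes C :: "nat \<Rightarrow> 'k::field mpoly set"
  assumes X: "finite X"
  shows "Y \<subseteq> X \<Longrightarrow> \<forall>i\<le>k. prime_in (polys_in X) (C i) \<Longrightarrow> \<forall>i<k. C i \<subset> C (Suc i) \<Longrightarrow>
    C k \<inter> polys_in Y = {0} \<Longrightarrow> card Y + k \<le> card X"
proof (induction k arbitrary: Y)
  case 0
  then show ?case using card_mono[OF X] by simp
next
  case (Suc k)
  then obtain y where y: "y \<in> X - Y" "C k \<inter> polys_in (insert y Y) = {0}"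
    using extend_independent[OF X, of Y "C k" "C (Suc k)"] by auto
  have "card (insert y Y) + k \<le> card X"
    using Suc.prems y by (intro Suc.IH) auto
  moreover have "card (insert y Y) = Suc (card Y)"
    using y Suc.prems(1) finite_subset[OF _ X] by (intro card_insert_disjoint) auto
  ultimately show ?case by simp
qed

lemma mult_closed_complement:
  assumes R: "unital_subring R" and P: "prime_in R P"
  shows "mult_closed R (R - P)"
  using unital_subringD(2,6)[OF R] prime_inD(2,3)[OF P] by (auto simp: mult_closed_def)

lemma local_ideal_gen:
  assumes R: "unital_subring R" and T: "mult_closed R T" and "\<And>j. j < i \<Longrightarrow> h j \<in> R"
    and "\<And>j. j < i \<Longrightarrow> a j \<in> R"
  shows "(\<Sum>j<i. h j * a j) \<in> local_ideal R T a i"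
  using assms(3,4) mult_closedD(2)[OF T]
  by (intro local_idealI[of _ _ 1 _ _ h] unital_subring_sum[OF R] unital_subringD[OF R]) auto

lemma local_ideal_mono:
  assumes "R \<subseteq> R'" "T \<subseteq> T'"
  shows "local_ideal R T a i \<subseteq> local_ideal R' T' a i"
  using assms unfolding local_ideal_def by blast

text \<open>Let \<open>y = y i\<close>. The polynomials \<open>g j\<close> with \<open>j < i\<close> do not involve \<open>y\<close>, so an element lies in the ideal
  that they generate iff its coefficients as a polynomial in \<open>y\<close> do. The leading coefficient of \<open>g i\<close> in
  \<open>y\<close> is a nonzero polynomial in \<open>Y\<close>, and these have been inverted. So \<open>g i\<close> is a nonzerodivisor by
  \<open>coeffs_of_product_in_ideal\<close>.\<close>

lemma triangular_regular:
  fixes g :: "nat \<Rightarrow> 'k::field mpoly"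
  assumes Y: "Y \<subseteq> X" and P: "prime_in (polys_in X) P" and indep: "P \<inter> polys_in Y = {0}"
    and y: "\<And>j. j \<le> i \<Longrightarrow> y j \<in> X - Y" and inj: "inj_on y {..i}"
    and g: "\<And>j. j \<le> i \<Longrightarrow> g j \<in> polys_in (insert (y j) Y)" "g i \<noteq> 0"
    and u: "u \<in> polys_in X"
    and gu: "g i * u \<in> local_ideal (polys_in X) (polys_in X - P) g i"
  shows "u \<in> local_ideal (polys_in X) (polys_in X - P) g i"
proof -
  let ?S = "polys_in X :: 'k mpoly set"
  let ?T = "?S - P"
  define V where "V = X - {y i}"
  let ?R = "polys_in V :: 'k mpoly set"
  \<comment> \<open>Only \<open>W\<close> is compatible with taking coefficients in \<open>y i\<close>; the complement \<open>T\<close> of \<open>P\<close> enters at the end.\<close>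
  let ?W = "polys_in Y - {0 :: 'k mpoly}"
  note sub = unital_subring_polys_in
  note SI = unital_subringD[OF sub[of X]] and RI = unital_subringD[OF sub[of V]]
  have T: "mult_closed ?S ?T" by (rule mult_closed_complement[OF sub P])
  have YV: "polys_in Y \<subseteq> ?R" using Y y[of i] by (intro polys_in_mono) (auto simp: V_def)
  have RS: "?R \<subseteq> ?S" by (intro polys_in_mono) (auto simp: V_def)
  have X: "X = insert (y i) V" using y[of i] by (auto simp: V_def)
  have W: "mult_closed ?R ?W"
    using YV unital_subringD(2,6)[OF sub[of Y]] by (auto simp: mult_closed_def)
  have WT: "?W \<subseteq> ?T" using indep YV RS by blast
  have gR: "g j \<in> ?R" if "j < i" for j
  proof -
    have "insert (y j) Y \<subseteq> V"
      using Y y[of j] y[of i] inj_onD[OF inj, of j i] that by (auto simp: V_def)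
    then show ?thesis using g(1)[of j] polys_in_mono that by (metis less_imp_le subsetD)
  qed
  have rep: "\<exists>Q. coeffs_in ?R Q \<and> f = poly Q (var (y i))" if "f \<in> ?S" for f
    using that in_polys_in_insert[of f "y i" V] X by simp
  let ?JW = "local_ideal ?R ?W g i" and ?JT = "local_ideal ?S ?T g i"
  have JW: "ring_ideal ?R ?JW" by (rule ring_ideal_local_ideal[OF sub W])
  have JT: "ring_ideal ?S ?JT" by (rule ring_ideal_local_ideal[OF sub T])
  obtain t h where t: "t \<in> ?T" "\<forall>j<i. h j \<in> ?S" "t * (g i * u) = (\<Sum>j<i. h j * g j)"
    using gu by (auto simp: local_ideal_def)
  have tu: "t * u \<in> ?S" using t u SI by auto
  obtain U where U: "coeffs_in ?R U" "t * u = poly U (var (y i))" using rep[OF tu] by auto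
  have "\<forall>j. \<exists>Q. j < i \<longrightarrow> coeffs_in ?R Q \<and> h j = poly Q (var (y i))" using rep t(2) by blast
  then obtain H where H: "\<And>j. j < i \<Longrightarrow> coeffs_in ?R (H j)" "\<And>j. j < i \<Longrightarrow> h j = poly (H j) (var (y i))"
    by metis
  obtain G where G: "coeffs_in (polys_in Y) G" "g i = poly G (var (y i))"
    using in_polys_in_insert g(1)[of i] by blast
  then have GR: "coeffs_in ?R G" using YV by (auto simp: coeffs_in_def)
  let ?D = "G * U - (\<Sum>j<i. smult (g j) (H j))"
  have "coeffs_in ?R (\<Sum>j<i. smult (g j) (H j))"
    using gR H(1) RI(6) unfolding coeffs_in_def coeff_sum
    by (auto intro!: unital_subring_sum[OF sub] RI(6))
  then have "coeffs_in ?R ?D" using coeffs_in_simps[OF sub] GR U(1) by blast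
  moreover have "poly ?D (var (y i)) = 0"
  proof -
    have "(\<Sum>j<i. g j * poly (H j) (var (y i))) = (\<Sum>j<i. h j * g j)"
      using H(2) by (intro sum.cong) (auto simp: mult.commute)
    then have "poly ?D (var (y i)) = g i * (t * u) - (\<Sum>j<i. h j * g j)"
      unfolding U(2) G(2) by (simp add: poly_sum)
    then show ?thesis using t(3) by (simp add: mult.left_commute)
  qed
  ultimately have "?D = 0" using poly_var_eq_0[of "y i" V ?D] by (simp add: V_def)
  then have GU: "coeff (G * U) l = (\<Sum>j<i. coeff (H j) l * g j)" for l
    by (simp add: coeff_sum mult.commute)
  have "coeffs_in ?JW (G * U)"
    unfolding coeffs_in_def GU using H(1) gR
    by (auto intro!: local_ideal_gen[OF sub W] simp: coeffs_in_def)
  moreover have "x \<in> ?JW" if "x \<in> ?R" "lead_coeff G * x \<in> ?JW" for x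
  proof (rule local_ideal_saturated[OF W _ that])
    have "lead_coeff G \<noteq> 0" using g(2) G(2) by auto
    then show "lead_coeff G \<in> ?W" using G(1) by (simp add: coeffs_in_def)
  qed
  ultimately have "coeffs_in ?JW U" using coeffs_of_product_in_ideal[OF sub JW GR _ U(1)] by blast
  then have UT: "coeff U l \<in> ?JT" for l
    using local_ideal_mono[OF RS WT] by (auto simp: coeffs_in_def)
  have "t * u \<in> ?JT"
    unfolding U(2) poly_altdef
  proof (intro ring_ideal_sum[OF sub JT])
    fix l
    have "var (y i) ^ l \<in> ?S" using y by (intro unital_subring_power[OF sub] var_in) auto
    then show "coeff U l * var (y i) ^ l \<in> ?JT"
      using ring_idealD(4)[OF sub JT _ UT, of "var (y i) ^ l" l] by (simp add: mult.commute)
  qed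
  then show ?thesis using local_ideal_saturated[OF T t(1) u] by blast
qed

text \<open>A prime of height at least \<open>k\<close> contains \<open>k\<close> elements that form a regular sequence in the local ring
  at that prime. The variables outside a maximal independent set \<open>Y\<close> provide them.\<close>

lemma regular_sequence_of_chain:
  fixes C :: "nat \<Rightarrow> 'k::field mpoly set"
  assumes X: "finite X" and C: "\<forall>i\<le>k. prime_in (polys_in X) (C i)" "\<forall>i<k. C i \<subset> C (Suc i)"
  shows "\<exists>a. (\<forall>i<k. a i \<in> C k) \<and> (\<forall>i<k. \<forall>u\<in>polys_in X.
    a i * u \<in> local_ideal (polys_in X) (polys_in X - C k) a i \<longrightarrow>
    u \<in> local_ideal (polys_in X) (polys_in X - C k) a i)"
proof -
  define P where "P = C k"
  have P: "prime_in (polys_in X) P" using C by (auto simp: P_def)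
  note sub = unital_subring_polys_in
  have P0: "0 \<in> P" using prime_inD(1)[OF P] by (auto simp: ring_ideal_def)
  define indep where "indep Y \<longleftrightarrow> Y \<subseteq> X \<and> P \<inter> polys_in Y = {0}" for Y
  \<comment> \<open>A nonzero constant is a unit, so it is not in the proper ideal \<open>P\<close>.\<close>
  have "indep {}"
  proof -
    have "p = 0" if p: "p \<in> P" "p \<in> polys_in {}" for p
    proof (rule ccontr)
      assume "p \<noteq> 0"
      have ks: "keys p \<subseteq> {0}" using p(2) by (auto simp: polys_in_def)
      have peq: "p = single 0 (lookup p 0)"
        using ks by (intro poly_mapping_eqI) (auto simp: lookup_single when_def in_keys_iff)
      have "lookup p 0 \<noteq> 0" using peq \<open>p \<noteq> 0\<close> by (metis single_zero)
      then have "single 0 (inverse (lookup p 0)) * p = 1"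
        by (subst peq) (simp add: mult_single)
      moreover have "single 0 (inverse (lookup p 0)) \<in> polys_in X" by (auto simp: polys_in_def)
      ultimately have "1 \<in> P" using ring_idealD(4)[OF sub prime_inD(1)[OF P] _ p(1)] by metis
      then show False using prime_inD(2)[OF P] by blast
    qed
    then show ?thesis using P0 unital_subringD(1)[OF sub] by (auto simp: indep_def)
  qed
  moreover have "card Y < Suc (card X)" if "indep Y" for Y
    using that card_mono[OF X] by (auto simp: indep_def less_Suc_eq_le)
  ultimately obtain Y where Y: "indep Y" and max: "\<And>Y'. indep Y' \<Longrightarrow> card Y' \<le> card Y"
    using ex_has_greatest_nat[of indep "{}" card "Suc (card X)"] by auto
  have YX: "Y \<subseteq> X" "P \<inter> polys_in Y = {0}" using Y by (auto simp: indep_def)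
  have finY: "finite Y" using finite_subset[OF YX(1) X] .
  have "card Y + k \<le> card X" using chain_bound[OF X YX(1) C] YX(2) by (simp add: P_def)
  then have "k \<le> card (X - Y)" using card_Diff_subset[OF finY YX(1)] by simp
  then obtain y where y: "inj_on y {..<k}" "y ` {..<k} \<subseteq> X - Y"
    using X by (metis card_le_inj card_lessThan finite_Diff finite_lessThan)
  have yX: "y j \<in> X - Y" if "j < k" for j using y(2) that by auto
  have "\<exists>g\<in>P. g \<in> polys_in (insert z Y) \<and> g \<noteq> 0" if "z \<in> X - Y" for z
  proof (rule ccontr)
    assume "\<not> ?thesis"
    then have "indep (insert z Y)" using that YX P0 unital_subringD(1)[OF sub]
      by (auto simp: indep_def)
    then show False using max[of "insert z Y"] that finY by simp
  qed
  then have "\<forall>i. \<exists>g. i < k \<longrightarrow> g \<in> P \<and> g \<in> polys_in (insert (y i) Y) \<and> g \<noteq> 0"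
    using yX by blast
  then obtain g where g: "\<And>i. i < k \<Longrightarrow> g i \<in> P \<and> g i \<in> polys_in (insert (y i) Y) \<and> g i \<noteq> 0"
    by metis
  have "u \<in> local_ideal (polys_in X) (polys_in X - P) g i"
    if "i < k" "u \<in> polys_in X" "g i * u \<in> local_ideal (polys_in X) (polys_in X - P) g i" for i u
    by (rule triangular_regular[OF YX(1) P YX(2), of i y])
      (use that yX y(1) g in \<open>auto intro: inj_on_subset\<close>)
  then show ?thesis using g by (auto simp: P_def)
qed

section \<open>Homogeneous components and homogeneous primes\<close>

abbreviation cox_set :: "nat list \<Rightarrow> 'k::field mpoly set" where
  "cox_set n \<equiv> polys_in (variables n)"

lemma cox_carrier_eq: "cox_carrier n = cox_set n"
  by (simp add: cox_carrier_def polys_in_def)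

lemma cox_simps [simp]:
  "carrier (cox n) = cox_set n" "x \<otimes>\<^bsub>cox n\<^esub> y = x * y" "x \<oplus>\<^bsub>cox n\<^esub> y = x + y"
  "\<one>\<^bsub>cox n\<^esub> = 1" "\<zero>\<^bsub>cox n\<^esub> = 0" "a \<odot>\<^bsub>cox n\<^esub> x = a * x"
  by (simp_all add: cox_def cox_carrier_eq)

lemma finite_variables: "finite (variables n)"
proof -
  have "variables n \<subseteq> (\<Union>i<length n. {i} \<times> {..n ! i})" by (auto simp: variables_def)
  then show ?thesis by (rule finite_subset) simp
qed

lemmas cox_subring = unital_subring_polys_in[of "variables n" for n]
lemmas cox_closed = unital_subringD[OF cox_subring]

lemma cring_cox: "cring (cox n :: ('k::field mpoly, 'k mpoly) gmodule)"
proof (rule cringI)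
  show "abelian_group (cox n :: ('k mpoly, 'k mpoly) gmodule)"
  proof (rule abelian_groupI)
    fix x :: "'k mpoly" assume "x \<in> carrier (cox n)"
    then show "\<exists>y\<in>carrier (cox n). y \<oplus>\<^bsub>cox n\<^esub> x = \<zero>\<^bsub>cox n\<^esub>"
      by (intro bexI[of _ "- x"]) (auto intro: cox_closed)
  qed (auto intro: cox_closed simp: add_ac)
  show "comm_monoid (cox n :: ('k mpoly, 'k mpoly) gmodule)"
    by (rule comm_monoidI) (auto intro: cox_closed simp: mult_ac)
qed (auto simp: algebra_simps)

lemma cox_a_inv: "x \<in> cox_set n \<Longrightarrow> \<ominus>\<^bsub>cox n\<^esub> x = - (x :: 'k::field mpoly)"
proof -
  assume "x \<in> cox_set n"
  interpret cring "cox n :: ('k mpoly, 'k mpoly) gmodule" by (rule cring_cox)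
  show ?thesis using \<open>x \<in> cox_set n\<close> by (intro minus_equality) (auto intro: cox_closed)
qed

lemma cox_pow [simp]: "f [^]\<^bsub>cox n\<^esub> (k::nat) = f ^ k"
  by (induction k) (simp_all add: nat_pow_def mult.commute)

lemma ideal_cox_iff: "ideal J (cox n) \<longleftrightarrow> ring_ideal (cox_set n) (J :: 'k::field mpoly set)"
proof
  assume "ideal J (cox n)"
  then interpret ideal J "cox n :: ('k mpoly, 'k mpoly) gmodule" .
  show "ring_ideal (cox_set n) J"
    unfolding ring_ideal_def using a_subset I_l_closed
      additive_subgroup.zero_closed[OF is_additive_subgroup]
      additive_subgroup.a_closed[OF is_additive_subgroup] by auto
next
  assume J: "ring_ideal (cox_set n) J"
  note JI = ring_idealD[OF cox_subring J]
  interpret cring "cox n :: ('k mpoly, 'k mpoly) gmodule" by (rule cring_cox)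
  show "ideal J (cox n)"
  proof (rule idealI)
    show "subgroup J (add_monoid (cox n))"
    proof (rule add.subgroupI)
      show "J \<subseteq> carrier (cox n)" using JI(1) by simp
      show "J \<noteq> {}" using JI(2) by blast
      show "\<ominus>\<^bsub>cox n\<^esub> a \<in> J" if "a \<in> J" for a
        using that JI(1,5) cox_a_inv[of a n] by (metis subsetD)
      show "a \<oplus>\<^bsub>cox n\<^esub> b \<in> J" if "a \<in> J" "b \<in> J" for a b using that JI(3) by simp
    qed
    show "x \<otimes>\<^bsub>cox n\<^esub> a \<in> J" "a \<otimes>\<^bsub>cox n\<^esub> x \<in> J"
      if "a \<in> J" "x \<in> carrier (cox n)" for a x
      using that JI(4)[of x a] by (simp_all add: mult.commute)
  qed (rule ring_axioms)
qed

lemma primeideal_cox_iff: "primeideal P (cox n) \<longleftrightarrow> prime_in (cox_set n) (P :: 'k::field mpoly set)"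
proof
  assume "primeideal P (cox n)"
  then interpret primeideal P "cox n :: ('k mpoly, 'k mpoly) gmodule" .
  have "1 \<notin> P" using one_imp_carrier I_notcarr by auto
  moreover have "ring_ideal (cox_set n) P" using is_ideal by (simp add: ideal_cox_iff)
  ultimately show "prime_in (cox_set n) P" unfolding prime_in_def using I_prime by auto
next
  assume P: "prime_in (cox_set n) P"
  show "primeideal P (cox n)"
  proof (rule primeidealI)
    show "ideal P (cox n)" using prime_inD(1)[OF P] by (simp add: ideal_cox_iff)
    show "carrier (cox n) \<noteq> P" using prime_inD(2)[OF P] cox_closed(2)[of n] by auto
  qed (use prime_inD(3)[OF P] cring_cox in auto)
qed

abbreviation hp :: "nat list \<Rightarrow> mdegree \<Rightarrow> 'k::field mpoly set" where
  "hp n d \<equiv> hpart (cox n) d"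

lemma hp_eq: "hp n d = {p \<in> cox_set n. \<forall>m\<in>keys p. monom_degree m = d}"
  by (simp add: cox_def cox_carrier_eq)

definition hcomp :: "mdegree \<Rightarrow> 'k::field mpoly \<Rightarrow> 'k mpoly" where
  "hcomp d p = (\<Sum>m\<in>{m\<in>keys p. monom_degree m = d}. single m (lookup p m))"

lemma lookup_hcomp: "lookup (hcomp d p) m = (if monom_degree m = d then lookup p m else 0)"
proof -
  have "lookup (hcomp d p) m = (\<Sum>m'\<in>{m\<in>keys p. monom_degree m = d}. if m' = m then lookup p m' else 0)"
    by (simp add: hcomp_def lookup_sum lookup_single when_def)
  also have "\<dots> = (if monom_degree m = d then lookup p m else 0)"
    by (simp add: sum.delta in_keys_iff)
  finally show ?thesis .
qed

lemma hcomp_add: "hcomp d (p + q) = hcomp d p + hcomp d q"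
  by (rule poly_mapping_eqI) (simp add: lookup_hcomp lookup_add)

lemma hcomp_0 [simp]: "hcomp d 0 = 0"
  by (rule poly_mapping_eqI) (simp add: lookup_hcomp)

lemma hcomp_sum: "hcomp d (sum f X) = (\<Sum>x\<in>X. hcomp d (f x))"
  by (induction X rule: infinite_finite_induct) (simp_all add: hcomp_add)

lemma hcomp_in: "p \<in> cox_set n \<Longrightarrow> hcomp d p \<in> hp n d"
  by (auto simp: hp_eq polys_in_def in_keys_iff lookup_hcomp split: if_splits)

lemma hp_cox: "p \<in> hp n d \<Longrightarrow> p \<in> cox_set n"
  by (simp add: hp_eq)

lemma hcomp_hp: "p \<in> hp n e \<Longrightarrow> hcomp d p = (if d = e then p else 0)"
  by (auto intro!: poly_mapping_eqI simp: lookup_hcomp hp_eq in_keys_iff)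

definition degs :: "'k::field mpoly \<Rightarrow> mdegree set" where
  "degs p = monom_degree ` keys p"

lemma finite_degs [simp]: "finite (degs p)"
  by (simp add: degs_def)

lemma hcomp_notin_degs: "d \<notin> degs p \<Longrightarrow> hcomp d p = 0"
  by (rule poly_mapping_eqI) (auto simp: lookup_hcomp degs_def in_keys_iff)

lemma sum_hcomp: "p = (\<Sum>d\<in>degs p. hcomp d p)"
proof (rule poly_mapping_eqI)
  fix m
  have "(\<Sum>d\<in>degs p. lookup (hcomp d p) m) = (\<Sum>d\<in>degs p. if d = monom_degree m then lookup p m else 0)"
    by (intro sum.cong) (auto simp: lookup_hcomp)
  also have "\<dots> = lookup p m" by (auto simp: degs_def in_keys_iff)
  finally show "lookup p m = lookup (\<Sum>d\<in>degs p. hcomp d p) m" by (simp add: lookup_sum)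
qed

lemma monom_degree_add: "monom_degree (m + m') = monom_degree m + monom_degree m'"
proof -
  have ext: "monom_degree m = (\<Sum>v\<in>V. single (fst v) (int (lookup m v)))"
    if "keys m \<subseteq> V" "finite V" for m V
    unfolding monom_degree_def using that by (intro sum.mono_neutral_left) (auto simp: in_keys_iff)
  let ?V = "keys m \<union> keys m'"
  show ?thesis
    by (subst (1 2 3) ext[of _ ?V])
      (auto simp: keys_add_nat lookup_add single_add sum.distrib)
qed

lemma hp_mult: "p \<in> hp n d \<Longrightarrow> q \<in> hp n e \<Longrightarrow> p * q \<in> hp n (d + e)"
  unfolding hp_eq using keys_mult[of p q] by (auto intro: cox_closed simp: monom_degree_add)

lemma hp_add: "p \<in> hp n d \<Longrightarrow> q \<in> hp n d \<Longrightarrow> p + q \<in> hp n d"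
  unfolding hp_eq using keys_add[of p q] by (auto intro: cox_closed)

lemma hp_uminus: "p \<in> hp n d \<Longrightarrow> - p \<in> hp n d"
  by (auto simp: hp_eq in_keys_iff intro: cox_closed)

lemma hp_0: "0 \<in> hp n d"
  by (auto simp: hp_eq intro: cox_closed)

lemma hp_1: "1 \<in> hp n 0"
  by (auto simp: hp_eq monom_degree_def intro: cox_closed)

lemma hcomp_mult_hp:
  assumes "p \<in> cox_set n" "q \<in> hp n e"
  shows "hcomp d (p * q) = hcomp (d - e) p * q"
proof -
  have "hcomp d (p * q) = (\<Sum>d'\<in>degs p. hcomp d (hcomp d' p * q))"
    by (subst sum_hcomp[of p]) (simp add: sum_distrib_right hcomp_sum)
  also have "\<dots> = (\<Sum>d'\<in>degs p. if d' = d - e then hcomp d' p * q else 0)"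
    using hcomp_hp[OF hp_mult[OF hcomp_in[OF assms(1)] assms(2)]]
    by (intro sum.cong) (auto simp: algebra_simps)
  also have "\<dots> = hcomp (d - e) p * q" by (auto simp: hcomp_notin_degs)
  finally show ?thesis .
qed

lemma hcomp_mult:
  assumes "p \<in> cox_set n" "q \<in> cox_set n"
  shows "hcomp d (p * q) = (\<Sum>e\<in>degs p. hcomp e p * hcomp (d - e) q)"
proof -
  have "hcomp d (p * q) = (\<Sum>e\<in>degs p. hcomp d (q * hcomp e p))"
    by (subst sum_hcomp[of p]) (simp add: sum_distrib_right sum_distrib_left hcomp_sum mult.commute)
  then show ?thesis
    using hcomp_mult_hp[OF assms(2) hcomp_in[OF assms(1)]] by (simp add: mult.commute)
qed

lemma homogeneous_ideal_hcomp:
  fixes I :: "'k::field mpoly set"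
  assumes "homogeneous_ideal n I" "p \<in> I"
  shows "hcomp d p \<in> I"
proof -
  have I: "ring_ideal (cox_set n) I"
    and gen: "I = Idl\<^bsub>cox n\<^esub> (I \<inter> (\<Union>d\<in>multidegrees n. hp n d))"
    using assms(1) unfolding homogeneous_ideal_def ideal_cox_iff by auto
  note II = ring_idealD[OF cox_subring I]
  let ?J = "{p \<in> cox_set n. \<forall>d. hcomp d p \<in> I}"
  have "ring_ideal (cox_set n) ?J"
    unfolding ring_ideal_def
  proof (intro conjI ballI)
    fix r p :: "'k mpoly" assume r: "r \<in> cox_set n" and p: "p \<in> ?J"
    have "hcomp d (r * p) \<in> I" for d
      using hcomp_mult[OF r, of p d] p r hp_cox[OF hcomp_in]
      by (auto intro!: ring_ideal_sum[OF cox_subring I] II(4))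
    then show "r * p \<in> ?J" using r p by (auto intro: cox_closed)
  qed (use II in \<open>auto simp: hcomp_add intro: cox_closed\<close>)
  then have "ideal ?J (cox n)" by (simp add: ideal_cox_iff)
  moreover have "I \<inter> (\<Union>d\<in>multidegrees n. hp n d) \<subseteq> ?J"
    using hp_cox hcomp_hp II(2) by fastforce
  ultimately have "Idl\<^bsub>cox n\<^esub> (I \<inter> (\<Union>d\<in>multidegrees n. hp n d)) \<subseteq> ?J"
    unfolding genideal_def by blast
  then show ?thesis using assms(2) gen by auto
qed

text \<open>Among the multiples \<open>z\<close> of \<open>x\<close> outside \<open>I\<close>, all of which have the same annihilator \<open>P\<close> modulo \<open>I\<close>, take
  one with the fewest components outside \<open>I\<close>. A homogeneous \<open>a\<close> that kills one of these components makes
  \<open>a * z\<close> smaller, so \<open>a\<close> kills \<open>z\<close> and lies in \<open>P\<close>. Comparing top degrees in \<open>a * z \<in> I\<close> then shows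
  that \<open>P\<close> contains the components of its elements, and each component of \<open>z\<close> outside \<open>I\<close> has
  annihilator \<open>P\<close>.\<close>

lemma associated_prime_homogeneous:
  fixes I P :: "'k::field mpoly set"
  assumes I: "ring_ideal (cox_set n) I" and hom: "\<And>p d. p \<in> I \<Longrightarrow> hcomp d p \<in> I"
    and P: "prime_in (cox_set n) P" and x: "x \<in> cox_set n" and ann: "P = {a \<in> cox_set n. a * x \<in> I}"
  shows "(\<forall>a\<in>P. \<forall>e. hcomp e a \<in> P) \<and> (\<exists>d. \<exists>z\<in>hp n d. P = {a \<in> cox_set n. a * z \<in> I})"
proof -
  note II = ring_idealD[OF cox_subring I] and PI = ring_idealD[OF cox_subring prime_inD(1)[OF P]]
  define Dz where "Dz z = {d. hcomp d z \<notin> I}" for z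
  have fin: "finite (Dz z)" for z
    by (rule finite_subset[OF _ finite_degs[of z]])
      (use II(2) hcomp_notin_degs[of _ z] in \<open>force simp: Dz_def\<close>)
  define Q where "Q z \<longleftrightarrow> z \<notin> I \<and> (\<exists>b\<in>cox_set n. z = b * x)" for z
  have "x \<notin> I" using ann prime_inD(2)[OF P] cox_closed(2)[of n] by auto
  then have "Q x" using cox_closed(2)[of n] by (auto simp: Q_def intro!: bexI[of _ 1])
  then obtain z where z: "Q z" and zmin: "\<And>z'. card (Dz z') < card (Dz z) \<Longrightarrow> \<not> Q z'"
    using ex_has_least_nat[of Q x "\<lambda>z. card (Dz z)"] by (auto simp: not_le[symmetric])
  obtain b where b: "b \<in> cox_set n" "z = b * x" and zI: "z \<notin> I" using z by (auto simp: Q_def)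
  have zS: "z \<in> cox_set n" using b x by (auto intro: cox_closed)
  have bP: "b \<notin> P" using zI b ann by auto
  have annz: "a \<in> P \<longleftrightarrow> a * z \<in> I" if "a \<in> cox_set n" for a
  proof -
    have "a * z \<in> I \<longleftrightarrow> a * b \<in> P" using ann b that by (auto simp: mult.assoc intro: cox_closed)
    also have "\<dots> \<longleftrightarrow> a \<in> P" using prime_inD(3)[OF P that b(1)] bP PI(4)[OF b(1), of a]
      by (auto simp: mult.commute)
    finally show ?thesis by simp
  qed
  have sumI: "p \<in> J" if "ring_ideal (cox_set n) J" "\<And>d. hcomp d p \<in> J" for p and J :: "'k mpoly set"
    by (subst sum_hcomp) (use that in \<open>auto intro: ring_ideal_sum[OF cox_subring]\<close>)
  have ne: "Dz z \<noteq> {}" using sumI[OF I, of z] zI by (auto simp: Dz_def)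
  have kill: "a \<in> P" if a: "a \<in> hp n e" and d: "d \<in> Dz z" and ad: "a * hcomp d z \<in> I" for a e d
  proof (rule ccontr)
    assume "a \<notin> P"
    then have "a * z \<notin> I" using annz hp_cox[OF a] by blast
    then have "Q (a * z)" using b hp_cox[OF a] by (auto simp: Q_def mult.assoc intro!: bexI[of _ "a * b"] cox_closed)
    moreover have "Dz (a * z) \<subseteq> (\<lambda>d'. e + d') ` (Dz z - {d})"
    proof
      fix d' assume "d' \<in> Dz (a * z)"
      then have n: "hcomp (d' - e) z * a \<notin> I"
        using hcomp_mult_hp[OF zS a, of d'] by (simp add: Dz_def mult.commute)
      then have "hcomp (d' - e) z \<notin> I" using II(4)[OF hp_cox[OF a]] by (metis mult.commute)
      moreover have "d' - e \<noteq> d" using n ad by (auto simp: mult.commute)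
      ultimately show "d' \<in> (\<lambda>d'. e + d') ` (Dz z - {d})"
        by (intro image_eqI[of _ _ "d' - e"]) (auto simp: Dz_def)
    qed
    then have "card (Dz (a * z)) \<le> card (Dz z - {d})"
      using fin by (meson card_image_le card_mono finite_Diff finite_imageI order_trans)
    then have "card (Dz (a * z)) < card (Dz z)"
      using d fin card_Diff1_less[OF fin d] by linarith
    ultimately show False using zmin by blast
  qed
  have homP: "hcomp e a \<in> P" if a: "a \<in> P" for a e
  proof (rule ccontr)
    \<comment> \<open>The part \<open>a'\<close> of \<open>a\<close> made of the components outside \<open>P\<close> again lies in \<open>P\<close>; consider its top degree.\<close>
    assume ne': "hcomp e a \<notin> P"
    have aS: "a \<in> cox_set n" using a PI(1) by blast
    define X where "X = {e \<in> degs a. hcomp e a \<notin> P}"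
    define a' where "a' = (\<Sum>e\<in>X. hcomp e a)"
    have "X \<noteq> {}" using ne' PI(2) by (auto simp: X_def) (metis hcomp_notin_degs)
    have finX: "finite X" by (simp add: X_def)
    define e0 where "e0 = Max X"
    define d0 where "d0 = Max (Dz z)"
    have e0: "e0 \<in> X" "\<And>e. e \<in> X \<Longrightarrow> e \<le> e0" using finX \<open>X \<noteq> {}\<close> by (auto simp: e0_def)
    have d0: "d0 \<in> Dz z" "\<And>d. d \<in> Dz z \<Longrightarrow> d \<le> d0" using fin ne by (auto simp: d0_def)
    have "(\<Sum>e\<in>degs a. hcomp e a) = (\<Sum>e\<in>degs a - X. hcomp e a) + a'"
      unfolding a'_def by (intro sum.subset_diff) (auto simp: X_def)
    then have "a = a' + (\<Sum>e\<in>degs a - X. hcomp e a)"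
      using sum_hcomp[of a] by (simp add: add.commute)
    moreover have "(\<Sum>e\<in>degs a - X. hcomp e a) \<in> P"
      by (intro ring_ideal_sum[OF cox_subring prime_inD(1)[OF P]]) (auto simp: X_def)
    ultimately have "a' \<in> P" using PI(6)[OF a] by (metis add_diff_cancel_right')
    then have "a' * z \<in> I" using annz PI(1) by blast
    then have "hcomp (e0 + d0) (a' * z) \<in> I" by (rule hom)
    define R where "R = (\<Sum>e\<in>X - {e0}. hcomp e a * hcomp (e0 + d0 - e) z)"
    have "hcomp (e0 + d0) (a' * z) = (\<Sum>e\<in>X. hcomp e a * hcomp (e0 + d0 - e) z)"
      unfolding a'_def sum_distrib_right hcomp_sum
      using hcomp_mult_hp[OF zS hcomp_in[OF aS]] by (simp add: mult.commute)
    also have "\<dots> = hcomp e0 a * hcomp d0 z + R"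
      using sum.remove[OF finX e0(1), of "\<lambda>e. hcomp e a * hcomp (e0 + d0 - e) z"]
      by (simp add: R_def)
    finally have eq: "hcomp (e0 + d0) (a' * z) - R = hcomp e0 a * hcomp d0 z" by simp
    have "R \<in> I"
      unfolding R_def
    proof (rule ring_ideal_sum[OF cox_subring I])
      fix e assume e: "e \<in> X - {e0}"
      then have "e < e0" using e0(2)[of e] by auto
      then have "\<not> e0 + d0 - e \<le> d0" by (simp add: algebra_simps)
      then have "e0 + d0 - e \<notin> Dz z" using d0(2)[of "e0 + d0 - e"] by blast
      then have "hcomp (e0 + d0 - e) z \<in> I" by (simp add: Dz_def)
      then show "hcomp e a * hcomp (e0 + d0 - e) z \<in> I"
        using II(4)[OF hp_cox[OF hcomp_in[OF aS]]] by blast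
    qed
    from II(6)[OF \<open>hcomp (e0 + d0) (a' * z) \<in> I\<close> this]
    have "hcomp e0 a * hcomp d0 z \<in> I" by (simp only: eq)
    then have "hcomp e0 a \<in> P" using kill[OF hcomp_in[OF aS] d0(1)] by blast
    then show False using e0(1) by (simp add: X_def)
  qed
  obtain d where d: "d \<in> Dz z" using ne by blast
  have zd: "hcomp d z \<in> hp n d" by (rule hcomp_in[OF zS])
  have "P = {a \<in> cox_set n. a * hcomp d z \<in> I}"
  proof (intro equalityI subsetI CollectI conjI)
    fix a assume a: "a \<in> P"
    then show aS: "a \<in> cox_set n" using PI(1) by blast
    show "a * hcomp d z \<in> I"
    proof (rule sumI[OF I])
      fix e
      have "hcomp (e - d) a * z \<in> I" using homP[OF a] annz PI(1) by blast
      then have "hcomp e (z * hcomp (e - d) a) \<in> I" by (simp add: mult.commute hom)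
      then show "hcomp e (a * hcomp d z) \<in> I"
        using hcomp_mult_hp[OF zS hcomp_in[OF aS]] hcomp_mult_hp[OF aS zd] by (simp add: mult.commute)
    qed
  next
    fix a assume a: "a \<in> {a \<in> cox_set n. a * hcomp d z \<in> I}"
    show "a \<in> P"
    proof (rule sumI[OF prime_inD(1)[OF P]])
      fix e
      have "hcomp (e + d) (a * hcomp d z) \<in> I" using a hom by blast
      then have "hcomp e a * hcomp d z \<in> I" using hcomp_mult_hp[OF _ zd, of a "e + d"] a by simp
      then show "hcomp e a \<in> P" using kill[OF hcomp_in d] a by blast
    qed
  qed
  then show ?thesis using homP zd by blast
qed

text \<open>For an ideal generated by homogeneous elements primality can be tested on homogeneous elements: in a
  product of two elements outside the ideal, consider the product of the highest components outside
  it. The multidegrees carry a linear order compatible with addition, so this makes sense although they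
  have several entries. The family \<open>H\<close> gives the homogeneous elements of the ideal degree by degree.\<close>

lemma graded_prime:
  fixes H :: "mdegree \<Rightarrow> 'k::field mpoly set"
  assumes zero: "\<And>d. 0 \<in> H d"
    and add: "\<And>d x y. x \<in> H d \<Longrightarrow> y \<in> H d \<Longrightarrow> x + y \<in> H d"
    and mult: "\<And>d e r x. r \<in> hp n e \<Longrightarrow> x \<in> H d \<Longrightarrow> r * x \<in> H (e + d)"
    and one: "1 \<notin> H 0"
    and prime: "\<And>d e x y. x \<in> hp n d \<Longrightarrow> y \<in> hp n e \<Longrightarrow> x * y \<in> H (d + e) \<Longrightarrow> x \<in> H d \<or> y \<in> H e"
  shows "prime_in (cox_set n) {s \<in> cox_set n. \<forall>d. hcomp d s \<in> H d}" (is "prime_in _ ?L")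
proof -
  have sumH: "sum f X \<in> H d" if "\<And>x. x \<in> X \<Longrightarrow> f x \<in> H d" for f :: "'c \<Rightarrow> 'k mpoly" and X d
    using that by (induction X rule: infinite_finite_induct) (auto intro: zero add)
  have ideal: "ring_ideal (cox_set n) ?L"
    unfolding ring_ideal_def
  proof (intro conjI ballI)
    fix r x :: "'k mpoly" assume r: "r \<in> cox_set n" and x: "x \<in> ?L"
    have "hcomp d (r * x) \<in> H d" for d
    proof -
      have "hcomp e r * hcomp (d - e) x \<in> H d" for e
        using mult[OF hcomp_in[OF r], of "hcomp (d - e) x" "d - e" e] x by simp
      then show ?thesis using hcomp_mult[OF r, of x d] x by (auto intro!: sumH)
    qed
    then show "r * x \<in> ?L" using r x by (auto intro: cox_closed)
  qed (auto simp: hcomp_add intro: zero add cox_closed)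
  have "hcomp 0 (1 :: 'k mpoly) = 1" by (simp add: hcomp_hp[OF hp_1])
  then have "1 \<notin> ?L" using one by (metis (mono_tags, lifting) mem_Collect_eq)
  moreover have "s \<in> ?L \<or> t \<in> ?L" if s: "s \<in> cox_set n" and t: "t \<in> cox_set n" and st: "s * t \<in> ?L" for s t
  proof (rule ccontr)
    assume neg: "\<not> (s \<in> ?L \<or> t \<in> ?L)"
    define B where "B u = {d. hcomp d u \<notin> H d}" for u
    have fin: "finite (B u)" for u
      by (rule finite_subset[OF _ finite_degs[of u]])
        (use zero hcomp_notin_degs[of _ u] in \<open>force simp: B_def\<close>)
    have ne: "B s \<noteq> {}" "B t \<noteq> {}" using neg s t by (auto simp: B_def)
    define a where "a = Max (B s)"
    define b where "b = Max (B t)"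
    have a: "a \<in> B s" "\<And>d. d \<in> B s \<Longrightarrow> d \<le> a" using fin ne by (auto simp: a_def)
    have b: "b \<in> B t" "\<And>d. d \<in> B t \<Longrightarrow> d \<le> b" using fin ne by (auto simp: b_def)
    have aD: "a \<in> degs s" using a(1) hcomp_notin_degs[of a s] zero by (force simp: B_def)
    define R where "R = (\<Sum>e\<in>degs s - {a}. hcomp e s * hcomp (a + b - e) t)"
    have "hcomp (a + b) (s * t) = hcomp a s * hcomp b t + R"
      unfolding hcomp_mult[OF s t]
      using sum.remove[OF finite_degs aD, of "\<lambda>e. hcomp e s * hcomp (a + b - e) t"]
      by (simp add: R_def)
    then have eq: "hcomp (a + b) (s * t) + - 1 * R = hcomp a s * hcomp b t" by simp
    have "R \<in> H (a + b)"
      unfolding R_def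
    proof (rule sumH)
      fix e assume e: "e \<in> degs s - {a}"
      show "hcomp e s * hcomp (a + b - e) t \<in> H (a + b)"
      proof (cases "e \<in> B s")
        case True
        then have "e < a" using a(2)[of e] e by auto
        then have "\<not> a + b - e \<le> b" by (simp add: algebra_simps)
        then have "a + b - e \<notin> B t" using b(2)[of "a + b - e"] by blast
        then have "hcomp (a + b - e) t \<in> H (a + b - e)" by (simp add: B_def)
        from mult[OF hcomp_in[OF s] this, of e] show ?thesis by simp
      next
        case False
        then have "hcomp e s \<in> H e" by (simp add: B_def)
        from mult[OF hcomp_in[OF t] this, of "a + b - e"] show ?thesis by (simp add: mult.commute)
      qed
    qed
    then have "- 1 * R \<in> H (a + b)" using mult[OF hp_uminus[OF hp_1], of R "a + b"] by simp
    moreover have "hcomp (a + b) (s * t) \<in> H (a + b)" using st by simp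
    ultimately have "hcomp (a + b) (s * t) + - 1 * R \<in> H (a + b)" by (intro add)
    then have "hcomp a s * hcomp b t \<in> H (a + b)" by (simp only: eq)
    then show False using prime[OF hcomp_in[OF s] hcomp_in[OF t]] a(1) b(1) by (auto simp: B_def)
  qed
  ultimately show ?thesis using ideal by (simp add: prime_in_def)
qed

section \<open>Localization at a monomial\<close>

lemma module_cox: "module (cox n) (cox n :: ('k::field mpoly, 'k mpoly) gmodule)"
  using cring_cox[of n] by (intro moduleI) (auto intro: cox_closed cring.axioms simp: algebra_simps
      cring.is_cring ring.is_abelian_group[OF cring.axioms(1)])

context
  fixes n :: "nat list" and M :: "('k::field mpoly, 'b) gmodule" and f :: "'k mpoly"
  assumes module: "module (cox n) M" and f: "f \<in> cox_set n"
begin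

interpretation module "cox n" M by (rule module)

lemma fpow: "f ^ k \<in> cox_set n"
  using unital_subring_power[OF cox_subring f] .

lemma fpow_fpow: "x \<in> carrier M \<Longrightarrow> f ^ k \<odot>\<^bsub>M\<^esub> (f ^ l \<odot>\<^bsub>M\<^esub> x) = f ^ (k + l) \<odot>\<^bsub>M\<^esub> x"
  using smult_assoc1[of "f ^ k" "f ^ l" x] fpow by (simp add: power_add)

lemma fpow_smult_comm:
  "x \<in> carrier M \<Longrightarrow> a \<in> cox_set n \<Longrightarrow> f ^ k \<odot>\<^bsub>M\<^esub> (a \<odot>\<^bsub>M\<^esub> x) = a \<odot>\<^bsub>M\<^esub> (f ^ k \<odot>\<^bsub>M\<^esub> x)"
  using smult_assoc1[of "f ^ k" a x] smult_assoc1[of a "f ^ k" x] fpow by (simp add: mult.commute)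

lemma fpow_closed: "x \<in> carrier M \<Longrightarrow> f ^ k \<odot>\<^bsub>M\<^esub> x \<in> carrier M"
  using smult_closed[of "f ^ k" x] fpow by simp

lemma loc_mem: "(y, l) \<in> loc_frac n M f x k \<longleftrightarrow>
    y \<in> carrier M \<and> (\<exists>q. f ^ (q + l) \<odot>\<^bsub>M\<^esub> x = f ^ (q + k) \<odot>\<^bsub>M\<^esub> y)"
  by (simp add: loc_frac_def)

lemma loc_refl: "x \<in> carrier M \<Longrightarrow> (x, k) \<in> loc_frac n M f x k"
  by (simp add: loc_mem)

lemma loc_trans:
  assumes "x \<in> carrier M" "y \<in> carrier M" "z \<in> carrier M"
    and "f ^ (q + l) \<odot>\<^bsub>M\<^esub> x = f ^ (q + k) \<odot>\<^bsub>M\<^esub> y" "f ^ (p + m) \<odot>\<^bsub>M\<^esub> y = f ^ (p + l) \<odot>\<^bsub>M\<^esub> z"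
  shows "f ^ (q + p + l + m) \<odot>\<^bsub>M\<^esub> x = f ^ (q + p + l + k) \<odot>\<^bsub>M\<^esub> z"
proof -
  have "f ^ (q + p + l + m) \<odot>\<^bsub>M\<^esub> x = f ^ (p + m) \<odot>\<^bsub>M\<^esub> (f ^ (q + l) \<odot>\<^bsub>M\<^esub> x)"
    using assms(1) by (simp add: fpow_fpow add_ac)
  also have "\<dots> = f ^ (q + k) \<odot>\<^bsub>M\<^esub> (f ^ (p + m) \<odot>\<^bsub>M\<^esub> y)"
    using assms(2,4) by (simp add: fpow_fpow add_ac)
  also have "\<dots> = f ^ (q + p + l + k) \<odot>\<^bsub>M\<^esub> z"
    using assms(3,5) by (simp add: fpow_fpow add_ac)
  finally show ?thesis .
qed

lemma loc_eq_iff: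
  assumes x: "x \<in> carrier M" and y: "y \<in> carrier M"
  shows "loc_frac n M f x k = loc_frac n M f y l \<longleftrightarrow>
    (\<exists>q. f ^ (q + l) \<odot>\<^bsub>M\<^esub> x = f ^ (q + k) \<odot>\<^bsub>M\<^esub> y)"
proof
  assume "loc_frac n M f x k = loc_frac n M f y l"
  then show "\<exists>q. f ^ (q + l) \<odot>\<^bsub>M\<^esub> x = f ^ (q + k) \<odot>\<^bsub>M\<^esub> y" using loc_refl[OF y] loc_mem by blast
next
  assume "\<exists>q. f ^ (q + l) \<odot>\<^bsub>M\<^esub> x = f ^ (q + k) \<odot>\<^bsub>M\<^esub> y"
  then obtain q where q: "f ^ (q + l) \<odot>\<^bsub>M\<^esub> x = f ^ (q + k) \<odot>\<^bsub>M\<^esub> y" by blast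
  show "loc_frac n M f x k = loc_frac n M f y l"
  proof (intro equalityI subsetI)
    fix s assume "s \<in> loc_frac n M f x k"
    then obtain z m p where s: "s = (z, m)" "z \<in> carrier M" "f ^ (p + m) \<odot>\<^bsub>M\<^esub> x = f ^ (p + k) \<odot>\<^bsub>M\<^esub> z"
      using loc_mem by (cases s) auto
    from loc_trans[OF y x s(2) q[symmetric] s(3)] show "s \<in> loc_frac n M f y l"
      using s by (auto simp: loc_mem)
  next
    fix s assume "s \<in> loc_frac n M f y l"
    then obtain z m p where s: "s = (z, m)" "z \<in> carrier M" "f ^ (p + m) \<odot>\<^bsub>M\<^esub> y = f ^ (p + l) \<odot>\<^bsub>M\<^esub> z"
      using loc_mem by (cases s) auto
    from loc_trans[OF x y s(2) q s(3)] show "s \<in> loc_frac n M f x k"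
      using s by (auto simp: loc_mem)
  qed
qed

lemma loc_eqI:
  assumes "x \<in> carrier M" "y \<in> carrier M" "f ^ (q + l) \<odot>\<^bsub>M\<^esub> x = f ^ (q + k) \<odot>\<^bsub>M\<^esub> y"
  shows "loc_frac n M f x k = loc_frac n M f y l"
  using loc_eq_iff[OF assms(1,2)] assms(3) by blast

lemma UN_const_loc:
  assumes "\<And>y l. (y, l) \<in> s \<Longrightarrow> h y l = C" "(y0, l0) \<in> s"
  shows "(\<Union>(y, l)\<in>s. h y l) = C"
  using assms by (auto 4 3)

text \<open>Addition of sections is a union over all representatives; it is a single fraction because the fraction
  does not depend on them.\<close>

lemma sections_add:
  assumes x: "x \<in> carrier M" and y: "y \<in> carrier M"
  shows "loc_frac n M f x k \<oplus>\<^bsub>sections n M f\<^esub> loc_frac n M f y l =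
    loc_frac n M f ((f ^ l \<odot>\<^bsub>M\<^esub> x) \<oplus>\<^bsub>M\<^esub> (f ^ k \<odot>\<^bsub>M\<^esub> y)) (k + l)"
proof -
  have "loc_frac n M f ((f ^ l' \<odot>\<^bsub>M\<^esub> x') \<oplus>\<^bsub>M\<^esub> (f ^ k' \<odot>\<^bsub>M\<^esub> y')) (k' + l') =
      loc_frac n M f ((f ^ l \<odot>\<^bsub>M\<^esub> x) \<oplus>\<^bsub>M\<^esub> (f ^ k \<odot>\<^bsub>M\<^esub> y)) (k + l)" (is "?L = ?R")
    if mem: "(x', k') \<in> loc_frac n M f x k" "(y', l') \<in> loc_frac n M f y l" for x' k' y' l'
  proof -
    obtain q p where x': "x' \<in> carrier M" "f ^ (q + k') \<odot>\<^bsub>M\<^esub> x = f ^ (q + k) \<odot>\<^bsub>M\<^esub> x'"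
      and y': "y' \<in> carrier M" "f ^ (p + l') \<odot>\<^bsub>M\<^esub> y = f ^ (p + l) \<odot>\<^bsub>M\<^esub> y'"
      using mem unfolding loc_mem by blast
    have 1: "f ^ (q + p + (k + l) + l') \<odot>\<^bsub>M\<^esub> x' = f ^ (q + p + (k' + l') + l) \<odot>\<^bsub>M\<^esub> x"
      using arg_cong[OF x'(2), of "\<lambda>z. f ^ (p + l + l') \<odot>\<^bsub>M\<^esub> z"] x x' by (simp add: fpow_fpow add_ac)
    have 2: "f ^ (q + p + (k + l) + k') \<odot>\<^bsub>M\<^esub> y' = f ^ (q + p + (k' + l') + k) \<odot>\<^bsub>M\<^esub> y"
      using arg_cong[OF y'(2), of "\<lambda>z. f ^ (q + k + k') \<odot>\<^bsub>M\<^esub> z"] y y' by (simp add: fpow_fpow add_ac)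
    show ?thesis
    proof (rule loc_eqI[where q = "q + p"])
      show "f ^ (q + p + (k + l)) \<odot>\<^bsub>M\<^esub> ((f ^ l' \<odot>\<^bsub>M\<^esub> x') \<oplus>\<^bsub>M\<^esub> (f ^ k' \<odot>\<^bsub>M\<^esub> y')) =
          f ^ (q + p + (k' + l')) \<odot>\<^bsub>M\<^esub> ((f ^ l \<odot>\<^bsub>M\<^esub> x) \<oplus>\<^bsub>M\<^esub> (f ^ k \<odot>\<^bsub>M\<^esub> y))"
        using x y x' y' 1 2 fpow fpow_closed by (simp add: smult_r_distr fpow_fpow)
    qed (use x y x' y' fpow_closed in auto)
  qed
  then have "(\<Union>(y', l')\<in>loc_frac n M f y l.
        loc_frac n M f ((f ^ l' \<odot>\<^bsub>M\<^esub> x') \<oplus>\<^bsub>M\<^esub> (f ^ k' \<odot>\<^bsub>M\<^esub> y')) (k' + l')) =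
      loc_frac n M f ((f ^ l \<odot>\<^bsub>M\<^esub> x) \<oplus>\<^bsub>M\<^esub> (f ^ k \<odot>\<^bsub>M\<^esub> y)) (k + l)"
    if "(x', k') \<in> loc_frac n M f x k" for x' k'
    using that by (intro UN_const_loc[OF _ loc_refl[OF y, of l]]) auto
  then show ?thesis
    unfolding sections_def by (simp, intro UN_const_loc[OF _ loc_refl[OF x, of k]]) auto
qed

lemma sections_smult:
  assumes a: "a \<in> cox_set n" and y: "y \<in> carrier M"
  shows "loc_frac n (cox n) f a k \<odot>\<^bsub>sections n M f\<^esub> loc_frac n M f y l =
    loc_frac n M f (a \<odot>\<^bsub>M\<^esub> y) (k + l)"
proof -
  have locS: "(b, k') \<in> loc_frac n (cox n) f a k \<longleftrightarrow>
      b \<in> cox_set n \<and> (\<exists>q. f ^ (q + k') * a = f ^ (q + k) * b)" for b k'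
    by (simp add: loc_frac_def)
  have "loc_frac n M f (b \<odot>\<^bsub>M\<^esub> y') (k' + l') = loc_frac n M f (a \<odot>\<^bsub>M\<^esub> y) (k + l)"
    if b: "(b, k') \<in> loc_frac n (cox n) f a k" and y': "(y', l') \<in> loc_frac n M f y l" for b k' y' l'
  proof -
    obtain q p where b: "b \<in> cox_set n" "f ^ (q + k') * a = f ^ (q + k) * b"
      and y': "y' \<in> carrier M" "f ^ (p + l') \<odot>\<^bsub>M\<^esub> y = f ^ (p + l) \<odot>\<^bsub>M\<^esub> y'"
      using b y' by (auto simp: loc_mem locS)
    have sm: "f ^ (i + j) \<odot>\<^bsub>M\<^esub> (c \<odot>\<^bsub>M\<^esub> z) = (f ^ i * c) \<odot>\<^bsub>M\<^esub> (f ^ j \<odot>\<^bsub>M\<^esub> z)"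
      if "c \<in> cox_set n" "z \<in> carrier M" for i j c z
      using that smult_assoc1[of "f ^ i" c "f ^ j \<odot>\<^bsub>M\<^esub> z"] fpow fpow_closed
        fpow_fpow[of "c \<odot>\<^bsub>M\<^esub> z" i j] smult_closed[of c z] fpow_smult_comm[of z c j] by simp
    show ?thesis
    proof (rule loc_eqI[where q = "q + p"])
      have "f ^ (q + p + (k + l)) \<odot>\<^bsub>M\<^esub> (b \<odot>\<^bsub>M\<^esub> y') = f ^ ((q + k) + (p + l)) \<odot>\<^bsub>M\<^esub> (b \<odot>\<^bsub>M\<^esub> y')"
        by (simp add: add_ac)
      also have "\<dots> = (f ^ (q + k') * a) \<odot>\<^bsub>M\<^esub> (f ^ (p + l') \<odot>\<^bsub>M\<^esub> y)"
        unfolding sm[OF b(1) y'(1)] b(2) y'(2) ..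
      also have "\<dots> = f ^ (q + p + (k' + l')) \<odot>\<^bsub>M\<^esub> (a \<odot>\<^bsub>M\<^esub> y)"
        unfolding sm[OF a y, symmetric] by (simp add: add_ac)
      finally show "f ^ (q + p + (k + l)) \<odot>\<^bsub>M\<^esub> (b \<odot>\<^bsub>M\<^esub> y') = f ^ (q + p + (k' + l')) \<odot>\<^bsub>M\<^esub> (a \<odot>\<^bsub>M\<^esub> y)" .
    qed (use a b y y' smult_closed in auto)
  qed
  then have "(\<Union>(y', l')\<in>loc_frac n M f y l. loc_frac n M f (b \<odot>\<^bsub>M\<^esub> y') (k' + l')) =
      loc_frac n M f (a \<odot>\<^bsub>M\<^esub> y) (k + l)"
    if "(b, k') \<in> loc_frac n (cox n) f a k" for b k'
    using that by (intro UN_const_loc[OF _ loc_refl[OF y, of l]]) auto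
  moreover have "(a, k) \<in> loc_frac n (cox n) f a k" using a locS by auto
  ultimately have "(\<Union>(b, k')\<in>loc_frac n (cox n) f a k. \<Union>(y', l')\<in>loc_frac n M f y l.
      loc_frac n M f (b \<odot>\<^bsub>M\<^esub> y') (k' + l')) = loc_frac n M f (a \<odot>\<^bsub>M\<^esub> y) (k + l)"
    by (rule UN_const_loc)
  then show ?thesis by (simp add: sections_def)
qed

end

lemma induced_map_loc:
  assumes M: "module (cox n) M" and N: "module (cox n) N" and f: "f \<in> cox_set n"
    and h: "h \<in> linear_maps (cox n) M N" and x: "x \<in> carrier M"
  shows "induced_map n N h f (loc_frac n M f x k) = loc_frac n N f (h x) k"
proof -
  have hc: "h x \<in> carrier N" if "x \<in> carrier M" for x using h that by (auto simp: linear_maps_def)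
  have hs: "h (f ^ j \<odot>\<^bsub>M\<^esub> x) = f ^ j \<odot>\<^bsub>N\<^esub> h x" if "x \<in> carrier M" for x j
    using h that unital_subring_power[OF cox_subring f] by (auto simp: linear_maps_def)
  have "loc_frac n N f (h y) l = loc_frac n N f (h x) k" if mem: "(y, l) \<in> loc_frac n M f x k" for y l
  proof -
    obtain q where y: "y \<in> carrier M" "f ^ (q + l) \<odot>\<^bsub>M\<^esub> x = f ^ (q + k) \<odot>\<^bsub>M\<^esub> y"
      using mem unfolding loc_mem[OF M f] by blast
    show ?thesis
      using arg_cong[OF y(2), of h] x y(1) hs hc by (intro loc_eqI[OF N f, where q = q]) auto
  qed
  then show ?thesis
    unfolding induced_map_def by (intro UN_const_loc[OF M f _ loc_refl[OF M f x]]) auto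
qed

section \<open>Charts\<close>

text \<open>The multidegree of the \<open>k\<close>-th power of a chart monomial, which is the same for all charts.\<close>

definition chart_degree :: "nat list \<Rightarrow> nat \<Rightarrow> mdegree" where
  "chart_degree n k = (\<Sum>i<length n. single i (int k))"

lemma chart_degree_add: "chart_degree n (k + l) = chart_degree n k + chart_degree n l"
  by (simp add: chart_degree_def single_add sum.distrib)

lemma chart_degree_0 [simp]: "chart_degree n 0 = 0"
  by (simp add: chart_degree_def)

lemma var_hp: "v \<in> variables n \<Longrightarrow> var v ^ k \<in> hp n (single (fst v) (int k))"
  unfolding var_power by (auto simp: hp_eq polys_in_def monom_degree_def split: if_splits)

lemma hp_prod:
  assumes "\<And>i. i \<in> X \<Longrightarrow> g i \<in> hp n (d i)"
  shows "(\<Prod>i\<in>X. g i) \<in> hp n (\<Sum>i\<in>X. d i)"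
  using assms by (induction X rule: infinite_finite_induct) (auto intro: hp_1 hp_mult)

lemma hp_unique: "p \<in> hp n d \<Longrightarrow> p \<in> hp n e \<Longrightarrow> p \<noteq> 0 \<Longrightarrow> d = e"
  using hcomp_hp[of p n e d] hcomp_hp[of p n d d] by (auto split: if_splits)

lemma var_nonzero: "var v \<noteq> (0 :: 'k::field mpoly)"
  by (simp add: var_def) (metis lookup_single_eq lookup_zero one_neq_zero)

lemma chartE:
  assumes "f \<in> charts n"
  obtains j where "\<forall>i<length n. (i, j i) \<in> variables n" "f = (\<Prod>i<length n. var (i, j i))"
  using assms by (auto simp: charts_def variables_def)

lemma chart_pow_hp:
  assumes "f \<in> charts n"
  shows "f ^ k \<in> hp n (chart_degree n k)"
proof -
  obtain j where j: "\<forall>i<length n. (i, j i) \<in> variables n" "f = (\<Prod>i<length n. var (i, j i))"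
    using assms by (rule chartE)
  show ?thesis
    unfolding j(2) prod_power_distrib chart_degree_def
    using j(1) var_hp[of "(i, j i)" n k for i] by (intro hp_prod) auto
qed

lemma chart_in: "f \<in> charts n \<Longrightarrow> f \<in> cox_set n"
  using hp_cox[OF chart_pow_hp[of f n 1]] by simp

lemma chart_nonzero: "f \<in> charts n \<Longrightarrow> f \<noteq> 0"
  by (erule chartE) (simp add: var_nonzero)

lemma chart_pow_hp_iff: "f \<in> charts n \<Longrightarrow> f ^ k \<in> hp n d \<longleftrightarrow> d = chart_degree n k"
  using chart_pow_hp[of f n k] hp_unique[of "f ^ k" n d] chart_nonzero[of f n] by auto

text \<open>A chart monomial contains one variable of each factor. Powers of these variables fill up any degree
  \<open>d\<close> to a large multiple of the degree of \<open>f\<close>. The cofactor \<open>\<nu>\<close> records that \<open>\<mu>\<close> divides a power of \<open>f\<close>,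
  so that \<open>\<mu>\<close> avoids every prime that avoids \<open>f\<close>.\<close>

lemma chart_homogenize:
  assumes f: "f \<in> charts n" and d: "d \<in> multidegrees n"
  shows "\<exists>\<mu> e k \<nu> l. \<mu> \<in> hp n e \<and> e + d = chart_degree n k \<and> \<nu> \<in> cox_set n \<and> \<nu> * \<mu> = f ^ l"
proof -
  obtain j where j: "\<forall>i<length n. (i, j i) \<in> variables n" "f = (\<Prod>i<length n. var (i, j i))"
    using f by (rule chartE)
  \<comment> \<open>Any bound for the entries of \<open>d\<close> will do.\<close>
  define k where "k = (\<Sum>i<length n. nat \<bar>lookup d i\<bar>)"
  have k: "\<bar>lookup d i\<bar> \<le> int k" if "i < length n" for i
  proof -
    have "nat \<bar>lookup d i\<bar> \<le> k" unfolding k_def using that by (intro member_le_sum) auto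
    then show ?thesis by simp
  qed
  define a where "a i = nat (int k - lookup d i)" for i
  define b where "b i = nat (int k + lookup d i)" for i
  define \<mu> where "\<mu> = (\<Prod>i<length n. var (i, j i) ^ a i :: 'a mpoly)"
  define \<nu> where "\<nu> = (\<Prod>i<length n. var (i, j i) ^ b i :: 'a mpoly)"
  have "\<mu> \<in> hp n (\<Sum>i<length n. single i (int (a i)))"
    unfolding \<mu>_def using j(1) var_hp[of "(i, j i)" n "a i" for i] by (intro hp_prod) auto
  moreover have "\<nu> \<in> hp n (\<Sum>i<length n. single i (int (b i)))"
    unfolding \<nu>_def using j(1) var_hp[of "(i, j i)" n "b i" for i] by (intro hp_prod) auto
  moreover have "(\<Sum>i<length n. single i (int (a i))) + d = chart_degree n k"
  proof (rule poly_mapping_eqI)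
    fix i
    have "lookup d i = 0" if "\<not> i < length n"
      using d that by (auto simp: multidegrees_def in_keys_iff)
    then show "lookup ((\<Sum>i<length n. single i (int (a i))) + d) i = lookup (chart_degree n k) i"
      using k[of i] by (auto simp: chart_degree_def lookup_add lookup_sum lookup_single when_def a_def)
  qed
  moreover have "\<nu> * \<mu> = f ^ (2 * k)"
  proof -
    have "b i + a i = 2 * k" if "i < length n" for i using k[OF that] by (simp add: a_def b_def)
    then show ?thesis
      unfolding \<mu>_def \<nu>_def j(2) prod_power_distrib prod.distrib[symmetric] power_add[symmetric]
      by (intro prod.cong) auto
  qed
  ultimately show ?thesis using hp_cox by blast
qed

lemma hp_multidegree:
  assumes "p \<in> hp n d" "p \<noteq> 0"
  shows "d \<in> multidegrees n"
proof -
  obtain m where m: "m \<in> keys p" using assms(2) by (metis ex_in_conv keys_eq_empty)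
  have "keys m \<subseteq> variables n" "d = monom_degree m" using m assms(1) by (auto simp: hp_eq polys_in_def)
  moreover have "keys (monom_degree m) \<subseteq> (\<Union>v\<in>keys m. {fst v})"
    unfolding monom_degree_def by (rule order_trans[OF keys_sum]) auto
  ultimately show ?thesis by (fastforce simp: multidegrees_def variables_def)
qed

lemma prime_chart:
  assumes P: "prime_in (cox_set n) P" and f: "f \<in> cox_set n" "f \<notin> P"
  shows "f ^ k \<notin> P" "f ^ k * x \<in> P \<Longrightarrow> x \<in> cox_set n \<Longrightarrow> x \<in> P"
proof -
  show *: "f ^ k \<notin> P" for k using prime_in_power[OF cox_subring P f(1)] f(2) by blast
  show "f ^ k * x \<in> P \<Longrightarrow> x \<in> cox_set n \<Longrightarrow> x \<in> P"
    using prime_inD(3)[OF P unital_subring_power[OF cox_subring f(1)]] * by blast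
qed

lemma homogenize_outside_prime:
  assumes P: "prime_in (cox_set n) P" and f: "f \<in> charts n" "f \<notin> P" and d: "d \<in> multidegrees n"
  shows "\<exists>\<mu> e k. \<mu> \<in> hp n e \<and> e + d = chart_degree n k \<and> \<mu> \<notin> P"
proof -
  obtain \<mu> e k \<nu> l where *: "\<mu> \<in> hp n e" "e + d = chart_degree n k" "\<nu> \<in> cox_set n" "\<nu> * \<mu> = f ^ l"
    using chart_homogenize[OF f(1) d] by blast
  have "\<mu> \<notin> P"
    using *(3,4) ring_idealD(4)[OF cox_subring prime_inD(1)[OF P] *(3), of \<mu>]
      prime_chart(1)[OF P chart_in[OF f(1)] f(2), of l] by auto
  then show ?thesis using * by blast
qed

section \<open>Primes of a chart and homogeneous primes\<close>

context
  fixes n :: "nat list" and f :: "'k::field mpoly"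
  assumes f: "f \<in> charts n"
begin

abbreviation "\<O> \<equiv> structure_ring n f"
abbreviation "fr \<equiv> loc_frac n (cox n) f"

lemma frac_eq_iff:
  assumes "x \<in> cox_set n" "y \<in> cox_set n"
  shows "fr x k = fr y l \<longleftrightarrow> f ^ l * x = f ^ k * y"
proof -
  have "(\<exists>q. f ^ (q + l) * x = f ^ (q + k) * y) \<longleftrightarrow> f ^ l * x = f ^ k * y"
    using chart_nonzero[OF f] by (auto simp: power_add mult.assoc)
  then show ?thesis using loc_eq_iff[OF module_cox chart_in[OF f], of x y k l] assms by simp
qed

lemma frac_scale:
  assumes "x \<in> cox_set n"
  shows "fr (f ^ l * x) (l + k) = fr x k" "fr (f ^ l * x) (k + l) = fr x k"
  using assms unital_subring_power[OF cox_subring chart_in[OF f]]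
  by (auto simp: frac_eq_iff cox_closed power_add mult_ac)

lemma frac_ops:
  assumes "x \<in> cox_set n" "y \<in> cox_set n"
  shows "fr x k \<oplus>\<^bsub>\<O>\<^esub> fr y l = fr (f ^ l * x + f ^ k * y) (k + l)"
    "fr x k \<otimes>\<^bsub>\<O>\<^esub> fr y l = fr (x * y) (k + l)"
proof -
  show "fr x k \<oplus>\<^bsub>\<O>\<^esub> fr y l = fr (f ^ l * x + f ^ k * y) (k + l)"
    using sections_add[OF module_cox chart_in[OF f], of x y k l] assms by simp
  have "fr x k \<otimes>\<^bsub>\<O>\<^esub> fr y l = fr x k \<odot>\<^bsub>\<O>\<^esub> fr y l" by (simp add: sections_def)
  then show "fr x k \<otimes>\<^bsub>\<O>\<^esub> fr y l = fr (x * y) (k + l)"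
    using sections_smult[OF module_cox chart_in[OF f], of x y k l] assms by simp
qed

lemma frac_one: "\<one>\<^bsub>\<O>\<^esub> = fr 1 0" and frac_zero: "\<zero>\<^bsub>\<O>\<^esub> = fr 0 0"
  by (simp_all add: sections_def)

lemma frac_add_same:
  assumes "x \<in> cox_set n" "y \<in> cox_set n"
  shows "fr x k \<oplus>\<^bsub>\<O>\<^esub> fr y k = fr (x + y) k"
  using assms frac_scale(1)[of "x + y" k k] by (simp add: frac_ops cox_closed distrib_left)

lemma frac_0: "fr 0 k = \<zero>\<^bsub>\<O>\<^esub>"
  using frac_eq_iff[of 0 0 k 0] by (simp add: cox_closed frac_zero)

lemma structure_carrier: "carrier \<O> = {fr x k | x k. x \<in> hp n (chart_degree n k)}"
  by (auto simp: sections_def chart_pow_hp_iff[OF f])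

lemma frac_in_carrier: "x \<in> hp n (chart_degree n k) \<Longrightarrow> fr x k \<in> carrier \<O>"
  by (auto simp: structure_carrier)

lemma carrierE:
  assumes "s \<in> carrier \<O>"
  obtains x k where "s = fr x k" "x \<in> hp n (chart_degree n k)" "x \<in> cox_set n"
  using assms hp_cox unfolding structure_carrier by blast

definition prime_on_chart :: "'k mpoly set \<Rightarrow> ('k mpoly \<times> nat) set set" where
  "prime_on_chart P = {fr x k | x k. x \<in> P \<and> x \<in> hp n (chart_degree n k)}"

text \<open>The homogeneous \<open>x\<close> of degree \<open>d\<close> that lie in \<open>q\<close> after inverting \<open>f\<close>. As \<open>x\<close> itself need not have
  the degree of a power of \<open>f\<close>, all multiples by homogeneous \<open>b\<close> of complementary degree are tested.\<close>

definition fraction_part :: "('k mpoly \<times> nat) set set \<Rightarrow> mdegree \<Rightarrow> 'k mpoly set" where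
  "fraction_part q d = {x \<in> hp n d.
     \<forall>b e k. b \<in> hp n e \<longrightarrow> e + d = chart_degree n k \<longrightarrow> fr (b * x) k \<in> q}"

definition homogeneous_lift :: "('k mpoly \<times> nat) set set \<Rightarrow> 'k mpoly set" where
  "homogeneous_lift q = {s \<in> cox_set n. \<forall>d. hcomp d s \<in> fraction_part q d}"

lemma frac_in_prime_on_chart:
  assumes P: "prime_in (cox_set n) P" "f \<notin> P" and x: "x \<in> cox_set n" "fr x k \<in> prime_on_chart P"
  shows "x \<in> P"
proof -
  obtain y l where y: "fr x k = fr y l" "y \<in> P" "y \<in> cox_set n"
    using x(2) hp_cox unfolding prime_on_chart_def by blast
  then have "f ^ l * x = f ^ k * y" using frac_eq_iff[OF x(1) y(3)] by blast
  moreover have "f ^ k * y \<in> P"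
    using ring_idealD(4)[OF cox_subring prime_inD(1)[OF P(1)]] y(2)
      unital_subring_power[OF cox_subring chart_in[OF f]] by blast
  ultimately show ?thesis using prime_chart(2)[OF P(1) chart_in[OF f] P(2)] x(1) by metis
qed

lemma primeideal_prime_on_chart:
  assumes ring: "ring \<O>" and P: "prime_in (cox_set n) P" "f \<notin> P"
  shows "primeideal (prime_on_chart P) \<O>"
proof (rule primeidealI)
  interpret ring \<O> by (rule ring)
  note PI = ring_idealD[OF cox_subring prime_inD(1)[OF P(1)]]
  note fS = unital_subring_power[OF cox_subring chart_in[OF f]]
  have mc: "s \<otimes>\<^bsub>\<O>\<^esub> t = t \<otimes>\<^bsub>\<O>\<^esub> s" if st: "s \<in> carrier \<O>" "t \<in> carrier \<O>" for s t
  proof -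
    obtain x k where "s = fr x k" "x \<in> cox_set n" using carrierE[OF st(1)] .
    moreover obtain y l where "t = fr y l" "y \<in> cox_set n" using carrierE[OF st(2)] .
    ultimately show ?thesis by (simp add: frac_ops mult.commute add.commute)
  qed
  then show cr: "cring \<O>" by (intro cring.intro ring comm_monoid.intro comm_monoid_axioms.intro monoid_axioms) auto
  have zero: "fr 0 0 \<in> prime_on_chart P"
    using PI(2) hp_0 by (auto simp: prime_on_chart_def intro!: exI[of _ 0])
  show "ideal (prime_on_chart P) \<O>"
  proof (rule idealI[OF ring])
    show "subgroup (prime_on_chart P) (add_monoid \<O>)"
    proof (rule add.subgroupI)
      show "prime_on_chart P \<subseteq> carrier \<O>" using frac_in_carrier by (auto simp: prime_on_chart_def)
      show "prime_on_chart P \<noteq> {}" using zero by blast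
    next
      fix s assume "s \<in> prime_on_chart P"
      then obtain x k where s: "s = fr x k" "x \<in> P" "x \<in> hp n (chart_degree n k)"
        by (auto simp: prime_on_chart_def)
      have "fr (- x) k \<oplus>\<^bsub>\<O>\<^esub> s = \<zero>\<^bsub>\<O>\<^esub>"
        using frac_add_same[of "- x" x k] hp_cox[OF s(3)] by (simp add: s(1) cox_closed frac_0)
      then have "\<ominus>\<^bsub>\<O>\<^esub> s = fr (- x) k"
        using frac_in_carrier[OF s(3)] frac_in_carrier[OF hp_uminus[OF s(3)]] s(1)
        by (intro minus_equality) auto
      then show "\<ominus>\<^bsub>\<O>\<^esub> s \<in> prime_on_chart P"
        using PI(5)[OF s(2)] hp_uminus[OF s(3)] by (auto simp: prime_on_chart_def)
    next
      fix s t assume "s \<in> prime_on_chart P" "t \<in> prime_on_chart P"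
      then obtain x k y l where s: "s = fr x k" "x \<in> P" "x \<in> hp n (chart_degree n k)"
        and t: "t = fr y l" "y \<in> P" "y \<in> hp n (chart_degree n l)"
        by (auto simp: prime_on_chart_def)
      have "f ^ l * x + f ^ k * y \<in> P" using s t fS PI by auto
      moreover have "f ^ l * x + f ^ k * y \<in> hp n (chart_degree n (k + l))"
        using hp_mult[OF chart_pow_hp[OF f, of l] s(3)] hp_mult[OF chart_pow_hp[OF f, of k] t(3)]
        by (intro hp_add) (simp_all add: chart_degree_add add.commute)
      ultimately show "s \<oplus>\<^bsub>\<O>\<^esub> t \<in> prime_on_chart P"
        unfolding s(1) t(1) frac_ops(1)[OF hp_cox[OF s(3)] hp_cox[OF t(3)]] prime_on_chart_def by blast
    qed
    have l: "x \<otimes>\<^bsub>\<O>\<^esub> a \<in> prime_on_chart P" if a: "a \<in> prime_on_chart P" and x: "x \<in> carrier \<O>" for a x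
    proof -
      obtain y k where y: "a = fr y k" "y \<in> P" "y \<in> hp n (chart_degree n k)"
        using a by (auto simp: prime_on_chart_def)
      obtain z l where z: "x = fr z l" "z \<in> hp n (chart_degree n l)" using carrierE[OF x] .
      have "z * y \<in> P" using PI(4)[OF hp_cox[OF z(2)] y(2)] .
      moreover have "z * y \<in> hp n (chart_degree n (l + k))"
        using hp_mult[OF z(2) y(3)] by (simp add: chart_degree_add)
      ultimately show ?thesis
        using y z hp_cox[OF y(3)] hp_cox[OF z(2)] by (auto simp: frac_ops prime_on_chart_def)
    qed
    then show "x \<otimes>\<^bsub>\<O>\<^esub> a \<in> prime_on_chart P" "a \<otimes>\<^bsub>\<O>\<^esub> x \<in> prime_on_chart P"
      if "a \<in> prime_on_chart P" "x \<in> carrier \<O>" for a x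
    proof -
      show "x \<otimes>\<^bsub>\<O>\<^esub> a \<in> prime_on_chart P" using l that .
      moreover have "a \<in> carrier \<O>" using that(1) frac_in_carrier by (auto simp: prime_on_chart_def)
      ultimately show "a \<otimes>\<^bsub>\<O>\<^esub> x \<in> prime_on_chart P" using mc that(2) by metis
    qed
  qed
  show "carrier \<O> \<noteq> prime_on_chart P"
  proof
    assume "carrier \<O> = prime_on_chart P"
    moreover have "fr 1 0 \<in> carrier \<O>" by (intro frac_in_carrier) (simp add: hp_1)
    ultimately have "1 \<in> P" by (intro frac_in_prime_on_chart[OF P cox_closed(2)]) auto
    then show False using prime_inD(2)[OF P(1)] by blast
  qed
  fix s t assume st: "s \<in> carrier \<O>" "t \<in> carrier \<O>" "s \<otimes>\<^bsub>\<O>\<^esub> t \<in> prime_on_chart P"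
  obtain x k where s: "s = fr x k" "x \<in> hp n (chart_degree n k)" "x \<in> cox_set n"
    using carrierE[OF st(1)] .
  obtain y l where t: "t = fr y l" "y \<in> hp n (chart_degree n l)" "y \<in> cox_set n"
    using carrierE[OF st(2)] .
  have "x * y \<in> P"
    using st(3) s t by (intro frac_in_prime_on_chart[OF P]) (auto simp: frac_ops cox_closed)
  then have "x \<in> P \<or> y \<in> P" using prime_inD(3)[OF P(1)] s t by blast
  then show "s \<in> prime_on_chart P \<or> t \<in> prime_on_chart P"
    using s t by (auto simp: prime_on_chart_def)
qed

lemma prime_homogeneous_lift:
  assumes "primeideal q \<O>"
  shows "prime_in (cox_set n) (homogeneous_lift q)"
  unfolding homogeneous_lift_def
proof (rule graded_prime)
  interpret primeideal q \<O> by (rule assms)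
  have q0: "\<zero>\<^bsub>\<O>\<^esub> \<in> q" using additive_subgroup.zero_closed[OF is_additive_subgroup] .
  show "0 \<in> fraction_part q d" for d using q0 by (simp add: fraction_part_def hp_0 frac_0)
  show "x + y \<in> fraction_part q d" if xy: "x \<in> fraction_part q d" "y \<in> fraction_part q d" for d x y
  proof -
    have "fr (b * (x + y)) k \<in> q" if b: "b \<in> hp n e" "e + d = chart_degree n k" for b e k
    proof -
      have "fr (b * x) k \<in> q" "fr (b * y) k \<in> q" using xy b by (auto simp: fraction_part_def)
      then have "fr (b * x) k \<oplus>\<^bsub>\<O>\<^esub> fr (b * y) k \<in> q"
        using additive_subgroup.a_closed[OF is_additive_subgroup] by blast
      moreover have "b * x \<in> cox_set n" "b * y \<in> cox_set n"
        using b xy hp_cox by (auto simp: fraction_part_def intro!: cox_closed(6))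
      ultimately show ?thesis by (simp add: frac_add_same distrib_left)
    qed
    then show ?thesis using xy hp_add by (auto simp: fraction_part_def)
  qed
  show "r * x \<in> fraction_part q (e + d)" if r: "r \<in> hp n e" and x: "x \<in> fraction_part q d" for d e r x
  proof -
    have "fr (b * (r * x)) k \<in> q" if b: "b \<in> hp n e'" "e' + (e + d) = chart_degree n k" for b e' k
    proof -
      have "b * r \<in> hp n (e' + e)" using hp_mult[OF b(1) r] .
      then have "fr (b * r * x) k \<in> q" using x b(2) by (auto simp: fraction_part_def add.assoc)
      then show ?thesis by (simp add: mult.assoc)
    qed
    then show ?thesis using r x hp_mult by (auto simp: fraction_part_def)
  qed
  show "1 \<notin> fraction_part q 0"
  proof
    assume "1 \<in> fraction_part q 0"
    then have "fr (1 * 1) 0 \<in> q" using hp_1[of n] unfolding fraction_part_def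
      by (metis (mono_tags, lifting) add_0 chart_degree_0 mem_Collect_eq)
    then have "\<one>\<^bsub>\<O>\<^esub> \<in> q" by (simp add: frac_one)
    then show False using one_imp_carrier I_notcarr by auto
  qed
  show "x \<in> fraction_part q d \<or> y \<in> fraction_part q e"
    if x: "x \<in> hp n d" and y: "y \<in> hp n e" and xy: "x * y \<in> fraction_part q (d + e)" for d e x y
  proof (rule ccontr)
    assume neg: "\<not> ?thesis"
    obtain b b' k where b: "b \<in> hp n b'" "b' + d = chart_degree n k" "fr (b * x) k \<notin> q"
      using neg x by (auto simp: fraction_part_def)
    obtain c c' l where c: "c \<in> hp n c'" "c' + e = chart_degree n l" "fr (c * y) l \<notin> q"
      using neg y by (auto simp: fraction_part_def)
    have "b * c \<in> hp n (b' + c')" using hp_mult[OF b(1) c(1)] .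
    moreover have "(b' + c') + (d + e) = chart_degree n (k + l)"
      using b(2) c(2) by (simp add: chart_degree_add algebra_simps flip: b(2) c(2))
    ultimately have "fr (b * c * (x * y)) (k + l) \<in> q" using xy by (auto simp: fraction_part_def)
    moreover have h: "b * x \<in> hp n (chart_degree n k)" "c * y \<in> hp n (chart_degree n l)"
      using hp_mult[OF b(1) x] hp_mult[OF c(1) y] b c by simp_all
    have "fr (b * x) k \<otimes>\<^bsub>\<O>\<^esub> fr (c * y) l = fr (b * c * (x * y)) (k + l)"
      using hp_cox[OF h(1)] hp_cox[OF h(2)] by (simp add: frac_ops mult_ac)
    ultimately have "fr (b * x) k \<otimes>\<^bsub>\<O>\<^esub> fr (c * y) l \<in> q" by simp
    then show False using I_prime[OF frac_in_carrier[OF h(1)] frac_in_carrier[OF h(2)]] b c by blast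
  qed
qed

lemma homogeneous_lift_mono: "q \<subseteq> q' \<Longrightarrow> homogeneous_lift q \<subseteq> homogeneous_lift q'"
  unfolding homogeneous_lift_def fraction_part_def by blast

text \<open>This is what makes \<open>homogeneous_lift\<close> strictly monotone on primes: every element of the coordinate ring is a
  fraction \<open>x / f\<^sup>k\<close> with \<open>x\<close> of the degree of \<open>f\<^sup>k\<close>.\<close>

lemma hp_in_homogeneous_lift_iff:
  assumes q: "primeideal q \<O>" and x: "x \<in> hp n (chart_degree n k)"
  shows "x \<in> homogeneous_lift q \<longleftrightarrow> fr x k \<in> q"
proof -
  interpret primeideal q \<O> by (rule q)
  have q0: "\<zero>\<^bsub>\<O>\<^esub> \<in> q" using additive_subgroup.zero_closed[OF is_additive_subgroup] .
  have "x \<in> homogeneous_lift q \<longleftrightarrow> x \<in> fraction_part q (chart_degree n k)"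
    using hp_cox[OF x] q0 by (auto simp: homogeneous_lift_def hcomp_hp[OF x] fraction_part_def hp_0 frac_0)
  also have "\<dots> \<longleftrightarrow> fr x k \<in> q"
  proof
    assume "x \<in> fraction_part q (chart_degree n k)"
    then have "fr (1 * x) k \<in> q" using hp_1[of n] unfolding fraction_part_def
      by (metis (mono_tags, lifting) add_0 mem_Collect_eq)
    then show "fr x k \<in> q" by simp
  next
    assume fq: "fr x k \<in> q"
    have "fr (b * x) l \<in> q" if b: "b \<in> hp n e" "e + chart_degree n k = chart_degree n l" for b e l
    proof -
      have "f ^ k * b \<in> hp n (chart_degree n l)"
        using hp_mult[OF chart_pow_hp[OF f, of k] b(1)] b(2) by (simp add: add.commute)
      then have "fr (f ^ k * b) l \<otimes>\<^bsub>\<O>\<^esub> fr x k \<in> q"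
        using I_l_closed[OF fq] frac_in_carrier by blast
      moreover have "fr (f ^ k * b) l \<otimes>\<^bsub>\<O>\<^esub> fr x k = fr (f ^ k * (b * x)) (l + k)"
        using unital_subring_power[OF cox_subring chart_in[OF f]] hp_cox[OF b(1)] hp_cox[OF x]
        by (simp add: frac_ops cox_closed mult.assoc)
      moreover have "b * x \<in> cox_set n" using hp_cox[OF b(1)] hp_cox[OF x] by (rule cox_closed)
      ultimately show ?thesis using frac_scale(2)[of "b * x" k l] by simp
    qed
    then show "x \<in> fraction_part q (chart_degree n k)" using x by (simp add: fraction_part_def)
  qed
  finally show ?thesis .
qed

lemma homogeneous_lift_prime_on_chart:
  assumes P: "prime_in (cox_set n) P" "f \<notin> P"
  shows "homogeneous_lift (prime_on_chart P) \<subseteq> P"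
proof
  fix s assume s: "s \<in> homogeneous_lift (prime_on_chart P)"
  then have sS: "s \<in> cox_set n" by (simp add: homogeneous_lift_def)
  have "hcomp d s \<in> P" for d
  proof (cases "hcomp d s = 0")
    case True
    then show ?thesis using ring_idealD(2)[OF cox_subring prime_inD(1)[OF P(1)]] by simp
  next
    case False
    have h: "hcomp d s \<in> hp n d" by (rule hcomp_in[OF sS])
    obtain \<mu> e k where mu: "\<mu> \<in> hp n e" "e + d = chart_degree n k" "\<mu> \<notin> P"
      using homogenize_outside_prime[OF P(1) f P(2) hp_multidegree[OF h False]] by blast
    have "fr (\<mu> * hcomp d s) k \<in> prime_on_chart P"
      using s mu by (auto simp: homogeneous_lift_def fraction_part_def)
    then have "\<mu> * hcomp d s \<in> P"
      using hp_cox[OF mu(1)] hp_cox[OF h] by (intro frac_in_prime_on_chart[OF P] cox_closed)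
    then show ?thesis using prime_inD(3)[OF P(1) hp_cox[OF mu(1)] hp_cox[OF h]] mu(3) by blast
  qed
  then show "s \<in> P"
    by (subst sum_hcomp) (intro ring_ideal_sum[OF cox_subring prime_inD(1)[OF P(1)]])
qed

text \<open>All members of a chain below the prime on the chart are lifted except the last one, which is replaced by
  \<open>P\<close>; that keeps the chain strict because the lift of the last one is contained in \<open>P\<close>.\<close>

lemma height_prime_on_chart_le:
  assumes ring: "ring \<O>" and P: "prime_in (cox_set n) P" "f \<notin> P"
  shows "height \<O> (prime_on_chart P) \<le> height (cox n) P"
  unfolding height_def
proof (rule Sup_mono, clarify)
  fix k C
  assume C: "C k = prime_on_chart P" "\<forall>i\<le>k. primeideal (C i) \<O>" "\<forall>i<k. C i \<subset> C (Suc i)"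
  define C' where "C' i = (if i < k then homogeneous_lift (C i) else P)" for i
  have strict: "homogeneous_lift (C i) \<subset> homogeneous_lift (C (Suc i))" if i: "i < k" for i
  proof -
    obtain s where s: "s \<in> C (Suc i)" "s \<notin> C i" using C(3) i by blast
    have prime: "primeideal (C i) \<O>" "primeideal (C (Suc i)) \<O>" using C(2) i by auto
    then have "s \<in> carrier \<O>" using s(1) ideal.Icarr primeideal.axioms(1) by metis
    then obtain x l where x: "s = fr x l" "x \<in> hp n (chart_degree n l)" by (rule carrierE)
    then have "x \<in> homogeneous_lift (C (Suc i))" "x \<notin> homogeneous_lift (C i)"
      using s prime hp_in_homogeneous_lift_iff by auto
    then show ?thesis using homogeneous_lift_mono[of "C i" "C (Suc i)"] C(3) i by blast
  qed
  have "primeideal (C' i) (cox n)" if "i \<le> k" for i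
    using that P(1) C(2) prime_homogeneous_lift by (auto simp: C'_def primeideal_cox_iff)
  moreover have "C' i \<subset> C' (Suc i)" if i: "i < k" for i
  proof (cases "Suc i < k")
    case True
    then show ?thesis using strict[OF i] i by (simp add: C'_def)
  next
    case False
    then have "Suc i = k" using i by simp
    then show ?thesis
      using strict[OF i] i C(1) homogeneous_lift_prime_on_chart[OF P] by (auto simp: C'_def)
  qed
  moreover have "C' k = P" by (simp add: C'_def)
  ultimately show "\<exists>y\<in>{enat k |k. \<exists>C. C k = P \<and> (\<forall>i\<le>k. primeideal (C i) (cox n)) \<and>
      (\<forall>i<k. C i \<subset> C (Suc i))}. enat k \<le> y"
    by (intro bexI[of _ "enat k"]) auto
qed

end

lemmas [simp] = cox_closed(1,2)

section \<open>Coordinates in free modules\<close>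

definition cox_vectors :: "nat list \<Rightarrow> 'b set \<Rightarrow> ('b \<Rightarrow> 'k::field mpoly) set" where
  "cox_vectors n E = {v. (\<forall>e\<in>E. v e \<in> cox_set n) \<and> (\<forall>e. e \<notin> E \<longrightarrow> v e = 0)}"

definition combination ::
    "('k::field mpoly, 'b) gmodule \<Rightarrow> 'b set \<Rightarrow> ('b \<Rightarrow> 'k mpoly) \<Rightarrow> 'b" where
  "combination M E v = (\<Oplus>\<^bsub>M\<^esub>e\<in>E. v e \<odot>\<^bsub>M\<^esub> e)"

definition module_basis :: "nat list \<Rightarrow> ('k::field mpoly, 'b) gmodule \<Rightarrow> 'b set \<Rightarrow> bool" where
  "module_basis n M E \<longleftrightarrow> module (cox n) M \<and> finite E \<and> E \<subseteq> carrier M \<and>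
     (\<forall>x\<in>carrier M. \<exists>!a. a \<in> E \<rightarrow>\<^sub>E carrier (cox n) \<and> x = (\<Oplus>\<^bsub>M\<^esub>e\<in>E. a e \<odot>\<^bsub>M\<^esub> e))"

context
  fixes n :: "nat list" and M :: "('k::field mpoly, 'b) gmodule" and E :: "'b set"
  assumes basis: "module_basis n M E"
begin

interpretation module "cox n" M
  using basis by (simp add: module_basis_def)

lemma basis_in: "e \<in> E \<Longrightarrow> e \<in> carrier M"
  using basis by (auto simp: module_basis_def)

lemma finite_basis: "finite E"
  using basis by (simp add: module_basis_def)

lemma term_in: "v \<in> cox_vectors n E \<Longrightarrow> e \<in> E \<Longrightarrow> v e \<odot>\<^bsub>M\<^esub> e \<in> carrier M"
  using basis_in by (auto simp: cox_vectors_def)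

lemma combination_in: "v \<in> cox_vectors n E \<Longrightarrow> combination M E v \<in> carrier M"
  unfolding combination_def using term_in by (intro M.finsum_closed) auto

lemma combination_add:
  assumes "v \<in> cox_vectors n E" "w \<in> cox_vectors n E"
  shows "combination M E (\<lambda>e. v e + w e) = combination M E v \<oplus>\<^bsub>M\<^esub> combination M E w"
proof -
  have "combination M E (\<lambda>e. v e + w e) = (\<Oplus>\<^bsub>M\<^esub>e\<in>E. v e \<odot>\<^bsub>M\<^esub> e \<oplus>\<^bsub>M\<^esub> w e \<odot>\<^bsub>M\<^esub> e)"
    unfolding combination_def using assms basis_in smult_l_distr term_in
    by (intro M.finsum_cong') (auto simp: cox_vectors_def)
  then show ?thesis unfolding combination_def using assms term_in by (simp add: M.finsum_addf)
qed

lemma combination_smult: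
  assumes "v \<in> cox_vectors n E" "a \<in> cox_set n"
  shows "combination M E (\<lambda>e. a * v e) = a \<odot>\<^bsub>M\<^esub> combination M E v"
proof -
  have "a \<odot>\<^bsub>M\<^esub> combination M E v = (\<Oplus>\<^bsub>M\<^esub>e\<in>E. a \<odot>\<^bsub>M\<^esub> (v e \<odot>\<^bsub>M\<^esub> e))"
    unfolding combination_def using assms term_in finite_basis by (intro finsum_smult_ldistr) auto
  also have "\<dots> = combination M E (\<lambda>e. a * v e)"
    unfolding combination_def using assms basis_in smult_assoc1
    by (intro M.finsum_cong') (auto simp: cox_vectors_def intro: cox_closed)
  finally show ?thesis by simp
qed

lemma combination_zero: "combination M E (\<lambda>_. 0) = \<zero>\<^bsub>M\<^esub>"
proof -
  have "combination M E (\<lambda>_. 0) = (\<Oplus>\<^bsub>M\<^esub>e\<in>E. \<zero>\<^bsub>M\<^esub>)"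
    unfolding combination_def using basis_in smult_l_null by (intro M.finsum_cong') auto
  then show ?thesis by simp
qed

lemma combination_restrict:
  assumes "v \<in> cox_vectors n E"
  shows "combination M E v = (\<Oplus>\<^bsub>M\<^esub>e\<in>E. restrict v E e \<odot>\<^bsub>M\<^esub> e)"
  unfolding combination_def using assms term_in by (intro M.finsum_cong') auto

lemma combination_inj:
  assumes v: "v \<in> cox_vectors n E" and w: "w \<in> cox_vectors n E"
    and eq: "combination M E v = combination M E w"
  shows "v = w"
proof -
  have r: "restrict u E \<in> E \<rightarrow>\<^sub>E carrier (cox n)" if "u \<in> cox_vectors n E" for u
    using that by (auto simp: cox_vectors_def)
  have "\<exists>!a. a \<in> E \<rightarrow>\<^sub>E carrier (cox n) \<and> combination M E v = (\<Oplus>\<^bsub>M\<^esub>e\<in>E. a e \<odot>\<^bsub>M\<^esub> e)"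
    using basis combination_in[OF v] unfolding module_basis_def by blast
  then have "restrict v E = restrict w E"
  proof (rule Uniq_D[OF ex1_iff_ex_Uniq[THEN iffD1, THEN conjunct2]])
    show "restrict v E \<in> E \<rightarrow>\<^sub>E carrier (cox n) \<and>
        combination M E v = (\<Oplus>\<^bsub>M\<^esub>e\<in>E. restrict v E e \<odot>\<^bsub>M\<^esub> e)"
      using r[OF v] combination_restrict[OF v] by blast
    show "restrict w E \<in> E \<rightarrow>\<^sub>E carrier (cox n) \<and>
        combination M E v = (\<Oplus>\<^bsub>M\<^esub>e\<in>E. restrict w E e \<odot>\<^bsub>M\<^esub> e)"
      using r[OF w] combination_restrict[OF w] eq by simp
  qed
  then have "v e = w e" if "e \<in> E" for e using that by (metis restrict_apply')
  moreover have "v e = w e" if "e \<notin> E" for e using v w that by (simp add: cox_vectors_def)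
  ultimately show ?thesis by blast
qed

lemma combination_surj:
  assumes "x \<in> carrier M"
  shows "\<exists>v\<in>cox_vectors n E. x = combination M E v"
proof -
  obtain a where a: "a \<in> E \<rightarrow>\<^sub>E carrier (cox n)" "x = (\<Oplus>\<^bsub>M\<^esub>e\<in>E. a e \<odot>\<^bsub>M\<^esub> e)"
    using basis assms unfolding module_basis_def by blast
  let ?v = "\<lambda>e. if e \<in> E then a e else 0"
  have v: "?v \<in> cox_vectors n E" using a(1) by (auto simp: cox_vectors_def)
  moreover have "x = combination M E ?v"
    unfolding a(2) combination_def using term_in[OF v] by (intro M.finsum_cong') auto
  ultimately show ?thesis by blast
qed

end

lemma linear_map_combination:
  assumes M: "module_basis n M E" and N: "module_basis n N G"
    and h: "h \<in> linear_maps (cox n) M N"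
    and A: "\<And>e. e \<in> E \<Longrightarrow> A e \<in> cox_vectors n G \<and> h e = combination N G (A e)"
    and v: "v \<in> cox_vectors n E"
  shows "h (combination M E v) = combination N G (\<lambda>e'. \<Sum>e\<in>E. v e * A e e')"
proof -
  interpret M: module "cox n" M using M by (simp add: module_basis_def)
  interpret N: module "cox n" N using N by (simp add: module_basis_def)
  have hc: "h x \<in> carrier N" if "x \<in> carrier M" for x using h that by (auto simp: linear_maps_def)
  have ha: "h (x \<oplus>\<^bsub>M\<^esub> y) = h x \<oplus>\<^bsub>N\<^esub> h y" if "x \<in> carrier M" "y \<in> carrier M" for x y
    using h that by (auto simp: linear_maps_def)
  have hs: "h (a \<odot>\<^bsub>M\<^esub> x) = a \<odot>\<^bsub>N\<^esub> h x" if "a \<in> cox_set n" "x \<in> carrier M" for a x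
    using h that by (auto simp: linear_maps_def)
  have "h \<zero>\<^bsub>M\<^esub> = h (0 \<odot>\<^bsub>M\<^esub> \<zero>\<^bsub>M\<^esub>)" using M.smult_l_null[of "\<zero>\<^bsub>M\<^esub>"] by simp
  also have "\<dots> = \<zero>\<^bsub>N\<^esub>" using hs[of 0 "\<zero>\<^bsub>M\<^esub>"] N.smult_l_null[OF hc[of "\<zero>\<^bsub>M\<^esub>"]] by simp
  finally have h0: "h \<zero>\<^bsub>M\<^esub> = \<zero>\<^bsub>N\<^esub>" .
  have vS: "v e \<in> cox_set n" for e using v by (cases "e \<in> E") (auto simp: cox_vectors_def)
  have AS: "A e e' \<in> cox_set n" if "e \<in> E" for e e'
    using A[OF that] by (cases "e' \<in> G") (auto simp: cox_vectors_def)
  have inG: "(\<lambda>e'. \<Sum>e\<in>X. v e * A e e') \<in> cox_vectors n G" if "X \<subseteq> E" for X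
    unfolding cox_vectors_def
  proof (intro CollectI conjI ballI allI impI)
    fix e' show "(\<Sum>e\<in>X. v e * A e e') \<in> cox_set n"
      using that by (intro unital_subring_sum[OF cox_subring] cox_closed(6)[OF vS AS]) auto
  next
    fix e' assume "e' \<notin> G"
    then show "(\<Sum>e\<in>X. v e * A e e') = 0"
      using that A by (intro sum.neutral) (auto simp: cox_vectors_def)
  qed
  have "h (\<Oplus>\<^bsub>M\<^esub>e\<in>X. v e \<odot>\<^bsub>M\<^esub> e) = combination N G (\<lambda>e'. \<Sum>e\<in>X. v e * A e e')" if "X \<subseteq> E" for X
    using finite_subset[OF that finite_basis[OF M]] that
  proof (induction X rule: finite_induct)
    case empty
    then show ?case using h0 combination_zero[OF N] by simp
  next
    case (insert e X)
    have e: "e \<in> E" "X \<subseteq> E" using insert.prems by auto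
    have tc: "v e' \<odot>\<^bsub>M\<^esub> e' \<in> carrier M" if "e' \<in> E" for e' using term_in[OF M v that] .
    have vA: "(\<lambda>e'. v e * A e e') \<in> cox_vectors n G"
      using A[OF e(1)] cox_closed(6)[OF vS AS[OF e(1)]] by (auto simp: cox_vectors_def)
    have sX: "(\<Oplus>\<^bsub>M\<^esub>e\<in>X. v e \<odot>\<^bsub>M\<^esub> e) \<in> carrier M"
      using tc e by (intro M.M.finsum_closed) auto
    have "(\<Oplus>\<^bsub>M\<^esub>e\<in>insert e X. v e \<odot>\<^bsub>M\<^esub> e) = v e \<odot>\<^bsub>M\<^esub> e \<oplus>\<^bsub>M\<^esub> (\<Oplus>\<^bsub>M\<^esub>e\<in>X. v e \<odot>\<^bsub>M\<^esub> e)"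
      using insert.hyps tc e by (intro M.M.finsum_insert) auto
    then have "h (\<Oplus>\<^bsub>M\<^esub>e\<in>insert e X. v e \<odot>\<^bsub>M\<^esub> e) =
        v e \<odot>\<^bsub>N\<^esub> h e \<oplus>\<^bsub>N\<^esub> h (\<Oplus>\<^bsub>M\<^esub>e\<in>X. v e \<odot>\<^bsub>M\<^esub> e)"
      using ha[OF tc[OF e(1)] sX] hs[OF vS basis_in[OF M e(1)]] by simp
    also have "\<dots> = combination N G (\<lambda>e'. v e * A e e') \<oplus>\<^bsub>N\<^esub> combination N G (\<lambda>e'. \<Sum>e\<in>X. v e * A e e')"
      using insert.IH[OF e(2)] A[OF e(1)] combination_smult[OF N _ vS] by simp
    also have "\<dots> = combination N G (\<lambda>e'. v e * A e e' + (\<Sum>e\<in>X. v e * A e e'))"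
      using combination_add[OF N vA inG[OF e(2)]] by simp
    finally show ?case using insert.hyps by simp
  qed
  from this[of E] show ?thesis by (simp add: combination_def)
qed

text \<open>The coordinate-free form of \<open>resolution_reaches_length_of_regular_sequence\<close>: \<open>x\<close> represents a nonzero
  element of the localized cokernel of \<open>D 0\<close> that is killed by a regular sequence of length \<open>m\<close>.\<close>

theorem free_resolution_reaches_length_of_regular_sequence:
  fixes F :: "nat \<Rightarrow> ('k::field mpoly, 'b) gmodule"
  assumes E: "\<And>i. module_basis n (F i) (E i)"
    and D: "\<And>i. D i \<in> linear_maps (cox n) (F (Suc i)) (F i)"
    and complex: "\<And>i x. x \<in> carrier (F (Suc (Suc i))) \<Longrightarrow> D i (D (Suc i) x) = \<zero>\<^bsub>F i\<^esub>"
    and T: "mult_closed (cox_set n) T"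
    and exact: "\<And>i x. x \<in> carrier (F (Suc i)) \<Longrightarrow> D i x = \<zero>\<^bsub>F i\<^esub> \<Longrightarrow>
      \<exists>t\<in>T. \<exists>u\<in>carrier (F (Suc (Suc i))). t \<odot>\<^bsub>F (Suc i)\<^esub> x = D (Suc i) u"
    and a: "\<And>k. k < m \<Longrightarrow> a k \<in> cox_set n"
    and regular: "\<And>k u. k < m \<Longrightarrow> u \<in> cox_set n \<Longrightarrow> a k * u \<in> local_ideal (cox_set n) T a k \<Longrightarrow>
      u \<in> local_ideal (cox_set n) T a k"
    and x: "x \<in> carrier (F 0)"
    and nb: "\<And>t u. t \<in> T \<Longrightarrow> u \<in> carrier (F (Suc 0)) \<Longrightarrow> t \<odot>\<^bsub>F 0\<^esub> x \<noteq> D 0 u"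
    and ann: "\<And>j. j < m \<Longrightarrow> \<exists>t\<in>T. \<exists>u\<in>carrier (F (Suc 0)). (t * a j) \<odot>\<^bsub>F 0\<^esub> x = D 0 u"
  shows "carrier (F m) \<noteq> {\<zero>\<^bsub>F m\<^esub>}"
proof -
  have Dc: "D i y \<in> carrier (F i)" if "y \<in> carrier (F (Suc i))" for i y
    using D[of i] that by (auto simp: linear_maps_def)
  have "\<forall>i. \<forall>e\<in>E (Suc i). \<exists>v\<in>cox_vectors n (E i). D i e = combination (F i) (E i) v"
    using combination_surj[OF E] Dc basis_in[OF E] by blast
  then have "\<forall>i. \<exists>A. \<forall>e\<in>E (Suc i). A e \<in> cox_vectors n (E i) \<and> D i e = combination (F i) (E i) (A e)"
    by (metis (no_types, lifting))
  then obtain A where A: "\<And>i e. e \<in> E (Suc i) \<Longrightarrow>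
      A i e \<in> cox_vectors n (E i) \<and> D i e = combination (F i) (E i) (A i e)"
    by metis
  interpret C: matrix_complex "cox_set n" T E A
    by unfold_locales (use cox_subring T finite_basis[OF E] A in \<open>auto simp: cox_vectors_def\<close>)
  have vec: "C.vectors (cox_set n) i = cox_vectors n (E i)" for i
    by (simp add: C.vectors_def cox_vectors_def)
  have dv: "C.d i v \<in> cox_vectors n (E i)" if "v \<in> cox_vectors n (E (Suc i))" for i v
    using C.d_vectors[OF C.ring_ideal_self, of v i] that by (simp add: vec)
  have Dd: "D i (combination (F (Suc i)) (E (Suc i)) v) = combination (F i) (E i) (C.d i v)"
    if v: "v \<in> cox_vectors n (E (Suc i))" for i v
  proof -
    have "(\<lambda>e'. \<Sum>e\<in>E (Suc i). v e * A i e e') = C.d i v"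
      using A by (auto simp: C.d_def cox_vectors_def fun_eq_iff intro!: sum.neutral)
    then show ?thesis using linear_map_combination[OF E E D A v] by simp
  qed
  have zv: "(\<lambda>_. 0 :: 'k mpoly) \<in> cox_vectors n (E i)" for i by (auto simp: cox_vectors_def)
  have bd: "C.local_boundary {0} i z \<longleftrightarrow>
      (\<exists>t\<in>T. \<exists>u\<in>carrier (F (Suc i)). t \<odot>\<^bsub>F i\<^esub> combination (F i) (E i) z = D i u)"
    if z: "z \<in> cox_vectors n (E i)" for i z
  proof -
    have eq: "(\<forall>e. t * z e - C.d i v e \<in> {0}) \<longleftrightarrow>
        t \<odot>\<^bsub>F i\<^esub> combination (F i) (E i) z = D i (combination (F (Suc i)) (E (Suc i)) v)"
      if t: "t \<in> T" and v: "v \<in> cox_vectors n (E (Suc i))" for t v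
    proof -
      have tS: "t \<in> cox_set n" using mult_closedD(1)[OF T t] .
      have tz: "(\<lambda>e. t * z e) \<in> cox_vectors n (E i)" using z tS by (auto simp: cox_vectors_def intro: cox_closed)
      have "(\<forall>e. t * z e - C.d i v e \<in> {0}) \<longleftrightarrow> (\<lambda>e. t * z e) = C.d i v" by (auto simp: fun_eq_iff)
      also have "\<dots> \<longleftrightarrow> combination (F i) (E i) (\<lambda>e. t * z e) = combination (F i) (E i) (C.d i v)"
        using combination_inj[OF E tz dv[OF v]] by auto
      finally show ?thesis using combination_smult[OF E z tS] Dd[OF v] by simp
    qed
    have "(\<exists>t\<in>T. \<exists>u\<in>carrier (F (Suc i)). t \<odot>\<^bsub>F i\<^esub> combination (F i) (E i) z = D i u) \<longleftrightarrow>
      (\<exists>t\<in>T. \<exists>v\<in>cox_vectors n (E (Suc i)).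
         t \<odot>\<^bsub>F i\<^esub> combination (F i) (E i) z = D i (combination (F (Suc i)) (E (Suc i)) v))"
      using combination_surj[OF E] combination_in[OF E] by metis
    also have "\<dots> \<longleftrightarrow> C.local_boundary {0} i z"
      unfolding C.local_boundary_def vec by (intro bex_cong refl) (rule eq[symmetric])
    finally show ?thesis by (rule sym)
  qed
  interpret C: regular_on_exact_complex "cox_set n" T E A a m
  proof unfold_locales
    fix i v e assume v: "v \<in> C.vectors (cox_set n) (Suc (Suc i))"
    have "combination (F i) (E i) (C.d i (C.d (Suc i) v)) = combination (F i) (E i) (\<lambda>_. 0)"
      using v complex[OF combination_in[OF E]] Dd dv combination_zero[OF E] by (simp add: vec)
    then have "C.d i (C.d (Suc i) v) = (\<lambda>_. 0)"
      using combination_inj[OF E dv[OF dv] zv] v by (simp add: vec)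
    then show "C.d i (C.d (Suc i) v) e = 0" by simp
  next
    fix i v assume v: "v \<in> C.vectors (cox_set n) (Suc i)" "\<forall>e. C.d i v e = 0"
    then have "C.d i v = (\<lambda>_. 0)" by auto
    then have "D i (combination (F (Suc i)) (E (Suc i)) v) = \<zero>\<^bsub>F i\<^esub>"
      using Dd v(1) combination_zero[OF E] by (simp add: vec)
    then show "C.local_boundary {0} (Suc i) v"
      using v(1) exact[OF combination_in[OF E]] bd by (simp add: vec)
  qed (use a regular in auto)
  obtain z where z: "z \<in> cox_vectors n (E 0)" "x = combination (F 0) (E 0) z"
    using combination_surj[OF E x] by blast
  have nz: "\<not> C.local_boundary {0} 0 z" using bd[OF z(1)] nb z(2) by auto
  have bz: "C.local_boundary {0} 0 (\<lambda>e. a j * z e)" if j: "j < m" for j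
  proof -
    have az: "(\<lambda>e. a j * z e) \<in> cox_vectors n (E 0)"
      using z(1) a[OF j] by (auto simp: cox_vectors_def intro: cox_closed)
    interpret F0: module "cox n" "F 0" using E[of 0] by (simp add: module_basis_def)
    obtain t u where t: "t \<in> T" "u \<in> carrier (F (Suc 0))" "(t * a j) \<odot>\<^bsub>F 0\<^esub> x = D 0 u"
      using ann[OF j] by blast
    have "t \<odot>\<^bsub>F 0\<^esub> combination (F 0) (E 0) (\<lambda>e. a j * z e) = (t * a j) \<odot>\<^bsub>F 0\<^esub> x"
      using combination_smult[OF E z(1) a[OF j]] z(2) x F0.smult_assoc1[of t "a j" x]
        mult_closedD(1)[OF T t(1)] a[OF j] by simp
    then show ?thesis using bd[OF az] t by auto
  qed
  have "\<exists>w\<in>cox_vectors n (E m) :: ('b \<Rightarrow> 'k mpoly) set. \<exists>e. w e \<noteq> 0"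
    by (rule C.resolution_reaches_length_of_regular_sequence[unfolded vec, OF z(1) nz]) (rule bz)
  then obtain w e where w: "w \<in> cox_vectors n (E m)" "w e \<noteq> (0 :: 'k mpoly)" by blast
  show ?thesis
  proof
    assume "carrier (F m) = {\<zero>\<^bsub>F m\<^esub>}"
    then have "combination (F m) (E m) w = combination (F m) (E m) (\<lambda>_. 0)"
      using combination_in[OF E w(1)] combination_zero[OF E] by auto
    then show False using combination_inj[OF E w(1) zv] w(2) by auto
  qed
qed

section \<open>Graded modules and exactness away from a prime\<close>

context
  fixes n :: "nat list" and M :: "('k::field mpoly, 'b) gmodule"
  assumes graded: "graded_module n M"
begin

lemma graded_is_module: "module (cox n) M"
  using graded by (simp add: graded_module_def)

interpretation module "cox n" M
  by (rule graded_is_module)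

lemma hpart_trivial: "d \<notin> multidegrees n \<Longrightarrow> hpart M d = {\<zero>\<^bsub>M\<^esub>}"
  using graded by (simp add: graded_module_def)

lemma hpart_subgroup: "d \<in> multidegrees n \<Longrightarrow> additive_subgroup (hpart M d) M"
  using graded by (simp add: graded_module_def)

lemma hpart_in: "x \<in> hpart M d \<Longrightarrow> x \<in> carrier M"
  using hpart_trivial[of d] additive_subgroup.a_subset[OF hpart_subgroup, of d]
  by (cases "d \<in> multidegrees n") auto

lemma hpart_zero: "\<zero>\<^bsub>M\<^esub> \<in> hpart M d"
  using hpart_trivial[of d] additive_subgroup.zero_closed[OF hpart_subgroup, of d]
  by (cases "d \<in> multidegrees n") auto

lemma hpart_smult:
  assumes a: "a \<in> hp n d" and x: "x \<in> hpart M e"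
  shows "a \<odot>\<^bsub>M\<^esub> x \<in> hpart M (d + e)"
proof (cases "a = 0 \<or> x = \<zero>\<^bsub>M\<^esub>")
  case True
  then have "a \<odot>\<^bsub>M\<^esub> x = \<zero>\<^bsub>M\<^esub>" using smult_l_null hpart_in[OF x] smult_r_null hp_cox[OF a] by auto
  then show ?thesis by (simp add: hpart_zero)
next
  case False
  then have "d \<in> multidegrees n" "e \<in> multidegrees n"
    using hp_multidegree[OF a] hpart_trivial[of e] x by auto
  then show ?thesis using graded a x by (auto simp: graded_module_def)
qed

lemma hpart_ex1:
  "x \<in> carrier M \<Longrightarrow> \<exists>!h. (\<forall>d. h d \<in> hpart M d) \<and> finite {d. h d \<noteq> \<zero>\<^bsub>M\<^esub>} \<and>
        x = (\<Oplus>\<^bsub>M\<^esub>d\<in>{d. h d \<noteq> \<zero>\<^bsub>M\<^esub>}. h d)"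
  using graded unfolding graded_module_def by blast

lemma homogeneous_decomposition:
  assumes "x \<in> carrier M"
  obtains X h where "finite X" "\<forall>d. h d \<in> hpart M d" "x = (\<Oplus>\<^bsub>M\<^esub>d\<in>X. h d)"
  using hpart_ex1[OF assms] by blast

lemma finsum_support:
  assumes X: "finite X" and h: "\<And>d. h d \<in> hpart M d"
  shows "(\<Oplus>\<^bsub>M\<^esub>d\<in>X. h d) = (\<Oplus>\<^bsub>M\<^esub>d\<in>{d. (if d \<in> X then h d else \<zero>\<^bsub>M\<^esub>) \<noteq> \<zero>\<^bsub>M\<^esub>}. if d \<in> X then h d else \<zero>\<^bsub>M\<^esub>)"
  using X hpart_in[OF h] by (intro M.add.finprod_mono_neutral_cong_right) auto

lemma homogeneous_components_unique:
  assumes X: "finite X" and g: "\<And>d. g d \<in> hpart M d" and h: "\<And>d. h d \<in> hpart M d"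
    and eq: "(\<Oplus>\<^bsub>M\<^esub>d\<in>X. g d) = (\<Oplus>\<^bsub>M\<^esub>d\<in>X. h d)" and d: "d \<in> X"
  shows "g d = h d"
proof -
  let ?g = "\<lambda>d. if d \<in> X then g d else \<zero>\<^bsub>M\<^esub>" and ?h = "\<lambda>d. if d \<in> X then h d else \<zero>\<^bsub>M\<^esub>"
  have "(\<Oplus>\<^bsub>M\<^esub>d\<in>X. g d) \<in> carrier M" using hpart_in[OF g] by (intro M.finsum_closed) auto
  from hpart_ex1[OF this] have "?g = ?h"
  proof (rule Uniq_D[OF ex1_iff_ex_Uniq[THEN iffD1, THEN conjunct2]])
    have fin: "finite {d. (if d \<in> X then k d else \<zero>\<^bsub>M\<^esub>) \<noteq> \<zero>\<^bsub>M\<^esub>}" for k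
      by (rule finite_subset[OF _ X]) auto
    show "(\<forall>d. ?g d \<in> hpart M d) \<and> finite {d. ?g d \<noteq> \<zero>\<^bsub>M\<^esub>} \<and>
        (\<Oplus>\<^bsub>M\<^esub>d\<in>X. g d) = (\<Oplus>\<^bsub>M\<^esub>d\<in>{d. ?g d \<noteq> \<zero>\<^bsub>M\<^esub>}. ?g d)"
      using finsum_support[OF X g] g hpart_zero fin by auto
    show "(\<forall>d. ?h d \<in> hpart M d) \<and> finite {d. ?h d \<noteq> \<zero>\<^bsub>M\<^esub>} \<and>
        (\<Oplus>\<^bsub>M\<^esub>d\<in>X. g d) = (\<Oplus>\<^bsub>M\<^esub>d\<in>{d. ?h d \<noteq> \<zero>\<^bsub>M\<^esub>}. ?h d)"
      using finsum_support[OF X h] h hpart_zero fin eq by auto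
  qed
  from fun_cong[OF this, of d] show ?thesis using d by simp
qed

lemma sections_carrier:
  "f \<in> charts n \<Longrightarrow> carrier (sections n M f) = {loc_frac n M f x k | x k. x \<in> hpart M (chart_degree n k)}"
  by (auto simp: sections_def chart_pow_hp_iff)

lemma zero_fraction: "f \<in> charts n \<Longrightarrow> loc_frac n M f \<zero>\<^bsub>M\<^esub> k = \<zero>\<^bsub>sections n M f\<^esub>"
  using loc_eq_iff[OF graded_is_module chart_in, of f "\<zero>\<^bsub>M\<^esub>" "\<zero>\<^bsub>M\<^esub>" k 0]
    smult_r_null unital_subring_power[OF cox_subring chart_in[of f n]]
  by (simp add: sections_def)

end

lemma linear_mapsD:
  assumes "h \<in> linear_maps (cox n) M N"
  shows "x \<in> carrier M \<Longrightarrow> h x \<in> carrier N"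
    "x \<in> carrier M \<Longrightarrow> y \<in> carrier M \<Longrightarrow> h (x \<oplus>\<^bsub>M\<^esub> y) = h x \<oplus>\<^bsub>N\<^esub> h y"
    "a \<in> cox_set n \<Longrightarrow> x \<in> carrier M \<Longrightarrow> h (a \<odot>\<^bsub>M\<^esub> x) = a \<odot>\<^bsub>N\<^esub> h x"
  using assms by (auto simp: linear_maps_def)

lemma linear_map_zero:
  assumes "module (cox n) M" "module (cox n) N" "h \<in> linear_maps (cox n) M N"
  shows "h \<zero>\<^bsub>M\<^esub> = \<zero>\<^bsub>N\<^esub>"
proof -
  interpret M: module "cox n" M by fact
  interpret N: module "cox n" N by fact
  show ?thesis
    using linear_mapsD(3)[OF assms(3), of 0 "\<zero>\<^bsub>M\<^esub>"] M.smult_l_null[of "\<zero>\<^bsub>M\<^esub>"]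
      N.smult_l_null[OF linear_mapsD(1)[OF assms(3), of "\<zero>\<^bsub>M\<^esub>"]] by simp
qed

lemma linear_map_finsum:
  assumes "module (cox n) M" "module (cox n) N" "h \<in> linear_maps (cox n) M N"
    and g: "\<And>x. g x \<in> carrier M"
  shows "finite X \<Longrightarrow> h (\<Oplus>\<^bsub>M\<^esub>x\<in>X. g x) = (\<Oplus>\<^bsub>N\<^esub>x\<in>X. h (g x))"
proof (induction X rule: finite_induct)
  interpret M: module "cox n" M by fact
  interpret N: module "cox n" N by fact
  {
    case empty
    then show ?case using linear_map_zero[OF assms(1-3)] by simp
  next
    case (insert x X)
    then show ?case
      using g linear_mapsD(1,2)[OF assms(3)] M.M.finsum_closed[of g X]
      by (simp add: M.M.finsum_insert N.M.finsum_insert Pi_def)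
  }
qed

text \<open>The elements that enter the image of \<open>h\<close> when \<open>T\<close> is inverted.\<close>

definition almost_image :: "'k::field mpoly set \<Rightarrow> ('k mpoly, 'b) gmodule \<Rightarrow> ('k mpoly, 'c) gmodule \<Rightarrow>
    ('b \<Rightarrow> 'c) \<Rightarrow> 'c set" where
  "almost_image T M N h = {z \<in> carrier N. \<exists>t\<in>T. \<exists>u\<in>carrier M. t \<odot>\<^bsub>N\<^esub> z = h u}"

lemma almost_image_zero:
  assumes M: "module (cox n) M" and N: "module (cox n) N" and h: "h \<in> linear_maps (cox n) M N"
    and T: "mult_closed (cox_set n) T"
  shows "\<zero>\<^bsub>N\<^esub> \<in> almost_image T M N h"
proof -
  interpret M: module "cox n" M by fact
  interpret N: module "cox n" N by fact
  have "1 \<odot>\<^bsub>N\<^esub> \<zero>\<^bsub>N\<^esub> = h \<zero>\<^bsub>M\<^esub>" using N.smult_r_null[of 1] linear_map_zero[OF M N h] by simp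
  then show ?thesis
    unfolding almost_image_def using mult_closedD(2)[OF T] M.M.zero_closed N.M.zero_closed by blast
qed

lemma almost_image_finsum:
  assumes M: "module (cox n) M" and N: "module (cox n) N" and h: "h \<in> linear_maps (cox n) M N"
    and T: "mult_closed (cox_set n) T"
    and g: "\<And>x. g x \<in> almost_image T M N h" and X: "finite X"
  shows "(\<Oplus>\<^bsub>N\<^esub>x\<in>X. g x) \<in> almost_image T M N h"
  using X
proof (induction X rule: finite_induct)
  interpret M: module "cox n" M by fact
  interpret N: module "cox n" N by fact
  {
    case empty
    show ?case using almost_image_zero[OF M N h T] by simp
  next
    case (insert x X)
    let ?z = "\<Oplus>\<^bsub>N\<^esub>x\<in>X. g x"
    obtain t u where t: "t \<in> T" "u \<in> carrier M" "t \<odot>\<^bsub>N\<^esub> g x = h u"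
      using g[of x] unfolding almost_image_def by blast
    obtain s v where s: "s \<in> T" "v \<in> carrier M" "s \<odot>\<^bsub>N\<^esub> ?z = h v"
      using insert.IH unfolding almost_image_def by blast
    have c: "g x \<in> carrier N" "?z \<in> carrier N" for x
      using g insert.IH by (auto simp: almost_image_def)
    have S: "t \<in> cox_set n" "s \<in> cox_set n" using t(1) s(1) mult_closedD(1)[OF T] by auto
    have "(s * t) \<odot>\<^bsub>N\<^esub> (g x \<oplus>\<^bsub>N\<^esub> ?z) = (s * t) \<odot>\<^bsub>N\<^esub> g x \<oplus>\<^bsub>N\<^esub> (t * s) \<odot>\<^bsub>N\<^esub> ?z"
      using N.smult_r_distr[of "s * t" "g x" ?z] S c cox_closed(6)[of s n t] by (simp add: mult.commute)
    also have "\<dots> = s \<odot>\<^bsub>N\<^esub> h u \<oplus>\<^bsub>N\<^esub> t \<odot>\<^bsub>N\<^esub> h v"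
      using N.smult_assoc1[of s t "g x"] N.smult_assoc1[of t s ?z] S c t(3) s(3) by simp
    also have "\<dots> = h (s \<odot>\<^bsub>M\<^esub> u \<oplus>\<^bsub>M\<^esub> t \<odot>\<^bsub>M\<^esub> v)"
      using linear_mapsD[OF h] S t(2) s(2) M.smult_closed by simp
    finally have "(s * t) \<odot>\<^bsub>N\<^esub> (g x \<oplus>\<^bsub>N\<^esub> ?z) = h (s \<odot>\<^bsub>M\<^esub> u \<oplus>\<^bsub>M\<^esub> t \<odot>\<^bsub>M\<^esub> v)" .
    moreover have "s \<odot>\<^bsub>M\<^esub> u \<oplus>\<^bsub>M\<^esub> t \<odot>\<^bsub>M\<^esub> v \<in> carrier M" using S t(2) s(2) M.smult_closed by simp
    moreover have "s * t \<in> T" using mult_closedD(3)[OF T s(1) t(1)] .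
    ultimately have "g x \<oplus>\<^bsub>N\<^esub> ?z \<in> almost_image T M N h"
      using c N.M.a_closed unfolding almost_image_def by blast
    then show ?case using insert.hyps c by (simp add: N.M.finsum_insert Pi_def)
  }
qed

lemma graded_mapsD:
  assumes "h \<in> graded_maps n M N"
  shows "h \<in> linear_maps (cox n) M N" "x \<in> hpart M d \<Longrightarrow> h x \<in> hpart N d"
  using assms by (auto simp: graded_maps_def)

text \<open>Clearing denominators: an identity between fractions on the chart of \<open>f\<close> becomes an identity in the module
  after multiplication by a power of \<open>f\<close>, which lies outside \<open>P\<close>.\<close>

lemma image_fraction_almost_image:
  assumes M: "graded_module n M" and N: "graded_module n N" and h: "h \<in> graded_maps n M N"
    and P: "prime_in (cox_set n) P" and f: "f \<in> charts n" "f \<notin> P"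
    and z: "z \<in> carrier N" and b: "b \<in> cox_set n" "b \<notin> P"
    and im: "loc_frac n N f (b \<odot>\<^bsub>N\<^esub> z) k \<in> induced_map n N h f ` carrier (sections n M f)"
  shows "z \<in> almost_image (cox_set n - P) M N h"
proof -
  note Mm = graded_is_module[OF M] and Nm = graded_is_module[OF N] and fS = chart_in[OF f(1)]
  note hl = graded_mapsD(1)[OF h]
  interpret M: module "cox n" M by (rule Mm)
  interpret N: module "cox n" N by (rule Nm)
  note fp = unital_subring_power[OF cox_subring fS]
  obtain u l where u: "u \<in> hpart M (chart_degree n l)"
      "loc_frac n N f (b \<odot>\<^bsub>N\<^esub> z) k = induced_map n N h f (loc_frac n M f u l)"
    using im unfolding sections_carrier[OF M f(1)] by blast
  have uc: "u \<in> carrier M" using hpart_in[OF M u(1)] .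
  have bz: "b \<odot>\<^bsub>N\<^esub> z \<in> carrier N" using N.smult_closed z b(1) by simp
  have "loc_frac n N f (b \<odot>\<^bsub>N\<^esub> z) k = loc_frac n N f (h u) l"
    using u(2) induced_map_loc[OF Mm Nm fS hl uc] by simp
  then obtain q where q: "f ^ (q + l) \<odot>\<^bsub>N\<^esub> (b \<odot>\<^bsub>N\<^esub> z) = f ^ (q + k) \<odot>\<^bsub>N\<^esub> h u"
    using loc_eq_iff[OF Nm fS bz linear_mapsD(1)[OF hl uc]] by blast
  have "(f ^ (q + l) * b) \<odot>\<^bsub>N\<^esub> z = h (f ^ (q + k) \<odot>\<^bsub>M\<^esub> u)"
    using q N.smult_assoc1[of "f ^ (q + l)" b z] fp b(1) z linear_mapsD(3)[OF hl fp uc] by simp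
  moreover have "f ^ (q + l) * b \<in> cox_set n - P"
    using prime_chart[OF P fS f(2)] b fp cox_closed(6)[of "f ^ (q + l)" n b] by blast
  moreover have "f ^ (q + k) \<odot>\<^bsub>M\<^esub> u \<in> carrier M" using M.smult_closed uc fp by simp
  ultimately show ?thesis using z unfolding almost_image_def by blast
qed

text \<open>Exactness on one chart, in degree zero, implies exactness of modules at every prime avoiding \<open>f\<close>. The maps
  are graded, so the homogeneous components of a cycle are cycles, and each can be multiplied into the
  degree of a power of \<open>f\<close> by an element outside \<open>P\<close>.\<close>

lemma exact_outside_prime:
  assumes L: "graded_module n L" and M: "graded_module n M" and N: "graded_module n N"
    and g: "g \<in> graded_maps n L M" and h: "h \<in> graded_maps n M N"
    and P: "prime_in (cox_set n) P" and f: "f \<in> charts n" "f \<notin> P"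
    and ex: "a_kernel (sections n M f) (sections n N f) (induced_map n N h f) =
      induced_map n M g f ` carrier (sections n L f)"
    and z: "z \<in> carrier M" "h z = \<zero>\<^bsub>N\<^esub>"
  shows "z \<in> almost_image (cox_set n - P) L M g"
proof -
  note Mm = graded_is_module[OF M] and Nm = graded_is_module[OF N] and fS = chart_in[OF f(1)]
  note hl = graded_mapsD(1)[OF h]
  interpret M: module "cox n" M by (rule Mm)
  interpret N: module "cox n" N by (rule Nm)
  obtain X k where X: "finite X" "\<forall>d. k d \<in> hpart M d" "z = (\<Oplus>\<^bsub>M\<^esub>d\<in>X. k d)"
    using homogeneous_decomposition[OF M z(1)] by blast
  define k' where "k' d = (if d \<in> X then k d else \<zero>\<^bsub>M\<^esub>)" for d
  have k': "k' d \<in> hpart M d" for d using X(2) hpart_zero[OF M] by (simp add: k'_def)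
  have zk: "z = (\<Oplus>\<^bsub>M\<^esub>d\<in>X. k' d)"
    unfolding X(3) using hpart_in[OF M X(2)[rule_format]] by (intro M.M.finsum_cong') (auto simp: k'_def)
  have "(\<Oplus>\<^bsub>N\<^esub>d\<in>X. h (k' d)) = (\<Oplus>\<^bsub>N\<^esub>d\<in>X. \<zero>\<^bsub>N\<^esub>)"
    using linear_map_finsum[OF Mm Nm hl hpart_in[OF M k'] X(1)] z(2) zk by simp
  from homogeneous_components_unique[OF N X(1) _ _ this] graded_mapsD(2)[OF h k'] hpart_zero[OF N]
  have "h (k' d) = \<zero>\<^bsub>N\<^esub>" if "d \<in> X" for d using that by blast
  then have hk: "h (k' d) = \<zero>\<^bsub>N\<^esub>" for d
    using linear_map_zero[OF Mm Nm hl] by (cases "d \<in> X") (auto simp: k'_def)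
  have "k' d \<in> almost_image (cox_set n - P) L M g" for d
  proof (cases "k' d = \<zero>\<^bsub>M\<^esub>")
    case True
    then show ?thesis
      using almost_image_zero[OF graded_is_module[OF L] Mm graded_mapsD(1)[OF g]
          mult_closed_complement[OF cox_subring P]] by simp
  next
    case False
    then have "d \<in> multidegrees n" using hpart_trivial[OF M, of d] k'[of d] by auto
    from homogenize_outside_prime[OF P f this] obtain \<mu> e l where
      mu: "\<mu> \<in> hp n e" "e + d = chart_degree n l" "\<mu> \<notin> P" by blast
    have muS: "\<mu> \<in> cox_set n" using hp_cox[OF mu(1)] .
    have mk: "\<mu> \<odot>\<^bsub>M\<^esub> k' d \<in> hpart M (chart_degree n l)"
      using hpart_smult[OF M mu(1) k'[of d]] mu(2) by simp
    have mkc: "\<mu> \<odot>\<^bsub>M\<^esub> k' d \<in> carrier M" using hpart_in[OF M mk] .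
    have "h (\<mu> \<odot>\<^bsub>M\<^esub> k' d) = \<zero>\<^bsub>N\<^esub>"
      using linear_mapsD(3)[OF hl muS hpart_in[OF M k']] hk N.smult_r_null[of \<mu>] muS by simp
    then have "induced_map n N h f (loc_frac n M f (\<mu> \<odot>\<^bsub>M\<^esub> k' d) l) = \<zero>\<^bsub>sections n N f\<^esub>"
      using induced_map_loc[OF Mm Nm fS hl mkc] zero_fraction[OF N f(1)] by simp
    then have "loc_frac n M f (\<mu> \<odot>\<^bsub>M\<^esub> k' d) l \<in> a_kernel (sections n M f) (sections n N f) (induced_map n N h f)"
      using mk by (auto simp: a_kernel_def' sections_carrier[OF M f(1)])
    then show ?thesis
      using image_fraction_almost_image[OF L M g P f hpart_in[OF M k'] muS mu(3)] ex by simp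
  qed
  then show ?thesis unfolding zk
    by (intro almost_image_finsum[OF graded_is_module[OF L] Mm graded_mapsD(1)[OF g]
          mult_closed_complement[OF cox_subring P] _ X(1)])
qed

section \<open>Associated primes of the quotient by a saturated ideal\<close>

context
  fixes n :: "nat list" and I :: "'k::field mpoly set"
  assumes I: "ring_ideal (cox_set n) I"
begin

interpretation ideal I "cox n"
  using I by (simp add: ideal_cox_iff)

abbreviation "coset x \<equiv> I +>\<^bsub>cox n\<^esub> x"

lemma cox_mod_simps:
  "carrier (cox_mod n I) = coset ` cox_set n" "\<zero>\<^bsub>cox_mod n I\<^esub> = I"
  "x \<in> cox_set n \<Longrightarrow> y \<in> cox_set n \<Longrightarrow> coset x \<oplus>\<^bsub>cox_mod n I\<^esub> coset y = coset (x + y)"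
  "a \<in> cox_set n \<Longrightarrow> x \<in> cox_set n \<Longrightarrow> a \<odot>\<^bsub>cox_mod n I\<^esub> coset x = coset (a * x)"
  "hpart (cox_mod n I) d = coset ` hp n d"
  using rcoset_mult_add[of a x] a_rcos_sum[of x y]
  by (auto simp: cox_mod_def FactRing_def A_RCOSETS_def')

lemma coset_eq_iff:
  assumes "x \<in> cox_set n" "y \<in> cox_set n"
  shows "coset x = coset y \<longleftrightarrow> x - y \<in> I"
proof
  note II = ring_idealD[OF cox_subring I]
  assume "coset x = coset y"
  moreover have "x \<in> coset x" using II(2) by (force simp: a_r_coset_def')
  ultimately obtain i where "i \<in> I" "x = i + y" by (auto simp: a_r_coset_def')
  then show "x - y \<in> I" by simp
next
  note II = ring_idealD[OF cox_subring I]
  assume xy: "x - y \<in> I"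
  show "coset x = coset y"
  proof (intro equalityI subsetI)
    fix z assume "z \<in> coset x"
    then obtain i where i: "i \<in> I" "z = i + x" by (auto simp: a_r_coset_def')
    have "i + (x - y) \<in> I" "z = (i + (x - y)) + y" using II(3)[OF i(1) xy] i(2) by auto
    then show "z \<in> coset y" by (simp only: a_r_coset_def' cox_simps) blast
  next
    fix z assume "z \<in> coset y"
    then obtain i where i: "i \<in> I" "z = i + y" by (auto simp: a_r_coset_def')
    have "i - (x - y) \<in> I" "z = (i - (x - y)) + x" using II(6)[OF i(1) xy] i(2) by auto
    then show "z \<in> coset x" by (simp only: a_r_coset_def' cox_simps) blast
  qed
qed

lemma coset_0: "coset 0 = I"
  by (auto simp: a_r_coset_def')

lemma coset_eq_zero_iff: "x \<in> cox_set n \<Longrightarrow> coset x = I \<longleftrightarrow> x \<in> I"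
  using coset_eq_iff[of x 0] by (simp add: coset_0)

lemma module_cox_mod: "module (cox n) (cox_mod n I)"
proof (rule moduleI)
  show "abelian_group (cox_mod n I)"
  proof (rule abelian_groupI)
    show "\<zero>\<^bsub>cox_mod n I\<^esub> \<in> carrier (cox_mod n I)"
      using coset_0 by (auto simp: cox_mod_simps intro!: image_eqI[of _ _ 0])
    fix X assume "X \<in> carrier (cox_mod n I)"
    then obtain x where x: "X = coset x" "x \<in> cox_set n" by (auto simp: cox_mod_simps)
    then show "\<zero>\<^bsub>cox_mod n I\<^esub> \<oplus>\<^bsub>cox_mod n I\<^esub> X = X"
      using cox_mod_simps(3)[of 0 x] by (simp add: cox_mod_simps coset_0)
    show "\<exists>Y\<in>carrier (cox_mod n I). Y \<oplus>\<^bsub>cox_mod n I\<^esub> X = \<zero>\<^bsub>cox_mod n I\<^esub>"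
      using x cox_mod_simps(3)[of "- x" x] cox_closed(3)[OF x(2)]
      by (intro bexI[of _ "coset (- x)"]) (auto simp: cox_mod_simps coset_0)
  qed (auto simp: cox_mod_simps cox_closed add_ac)
qed (auto simp: cox_mod_simps cox_closed algebra_simps cring_cox)

lemma coset_smult_pow:
  "f \<in> cox_set n \<Longrightarrow> x \<in> cox_set n \<Longrightarrow> f ^ k \<odot>\<^bsub>cox_mod n I\<^esub> coset x = coset (f ^ k * x)"
  using cox_mod_simps(4) unital_subring_power[OF cox_subring] by blast

lemma coset_fraction_zero_iff:
  assumes f: "f \<in> cox_set n" and x: "x \<in> cox_set n"
  shows "loc_frac n (cox_mod n I) f (coset x) k = \<zero>\<^bsub>sections n (cox_mod n I) f\<^esub> \<longleftrightarrow> (\<exists>q. f ^ q * x \<in> I)"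
proof -
  note fS = unital_subring_power[OF cox_subring f]
  have z: "\<zero>\<^bsub>sections n (cox_mod n I) f\<^esub> = loc_frac n (cox_mod n I) f (coset 0) 0"
    by (simp add: sections_def cox_mod_simps coset_0)
  have "loc_frac n (cox_mod n I) f (coset x) k = loc_frac n (cox_mod n I) f (coset 0) 0 \<longleftrightarrow>
      (\<exists>q. f ^ (q + 0) \<odot>\<^bsub>cox_mod n I\<^esub> coset x = f ^ (q + k) \<odot>\<^bsub>cox_mod n I\<^esub> coset 0)"
    using x by (intro loc_eq_iff[OF module_cox_mod f]) (auto simp: cox_mod_simps)
  moreover have "f ^ j \<odot>\<^bsub>cox_mod n I\<^esub> I = I" for j
    using coset_smult_pow[OF f cox_closed(1), of j] by (simp add: coset_0)
  ultimately show ?thesis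
    unfolding z using f x fS by (simp add: coset_smult_pow coset_0 coset_eq_zero_iff cox_closed)
qed

lemma associated_prime_cox_modE:
  assumes "associated_prime (cox n) (cox_mod n I) P"
  obtains x where "prime_in (cox_set n) P" "x \<in> cox_set n" "P = {a \<in> cox_set n. a * x \<in> I}"
proof -
  obtain x where x: "x \<in> cox_set n"
      "P = {a \<in> carrier (cox n). a \<odot>\<^bsub>cox_mod n I\<^esub> coset x = \<zero>\<^bsub>cox_mod n I\<^esub>}"
    using assms unfolding associated_prime_def cox_mod_simps by blast
  have "P = {a \<in> cox_set n. a * x \<in> I}"
  proof -
    have "a \<odot>\<^bsub>cox_mod n I\<^esub> coset x = \<zero>\<^bsub>cox_mod n I\<^esub> \<longleftrightarrow> a * x \<in> I" if "a \<in> cox_set n" for a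
      using coset_eq_zero_iff[OF cox_closed(6)[OF that x(1)]] by (simp add: cox_mod_simps(2,4) that x(1))
    then show ?thesis unfolding x(2) cox_simps by blast
  qed
  moreover have "prime_in (cox_set n) P"
    using assms by (simp add: associated_prime_def primeideal_cox_iff)
  ultimately show thesis using that x(1) by blast
qed

end

text \<open>If \<open>P\<close> contained every chart monomial, it would contain all variables of one factor and hence the irrelevant
  ideal \<open>B\<close>. Then \<open>x * B \<subseteq> I\<close>, and saturation would give \<open>x \<in> I\<close>.\<close>

lemma irrelevant_not_in_associated_prime:
  fixes I P :: "'k::field mpoly set"
  assumes I: "ring_ideal (cox_set n) I" and sat: "B_saturation n I = I"
    and P: "prime_in (cox_set n) P" and x: "x \<in> cox_set n" and ann: "P = {a \<in> cox_set n. a * x \<in> I}"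
  shows "\<exists>f\<in>charts n. f \<notin> P"
proof (rule ccontr)
  assume none: "\<not> ?thesis"
  interpret cring "cox n :: ('k mpoly, 'k mpoly) gmodule" by (rule cring_cox)
  have idP: "ideal P (cox n)" using prime_inD(1)[OF P] by (simp add: ideal_cox_iff)
  have ex: "\<exists>i<length n. \<forall>j\<le>n ! i. var (i, j) \<in> P"
  proof (rule ccontr)
    assume "\<not> ?thesis"
    then obtain j where j: "\<forall>i<length n. j i \<le> n ! i \<and> var (i, j i) \<notin> P" by metis
    have "(\<Prod>i\<in>X. var (i, j i)) \<in> cox_set n - P" if "finite X" "X \<subseteq> {..<length n}" for X
      using that
    proof (induction X rule: finite_induct)
      case empty
      then show ?case using prime_inD(2)[OF P] by simp
    next
      case (insert i X)
      have "var (i, j i) \<in> cox_set n" "var (i, j i) \<notin> P"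
        using insert.prems j by (auto intro!: var_in simp: variables_def)
      then show ?case
        using mult_closedD(3)[OF mult_closed_complement[OF cox_subring P], of "var (i, j i)"] insert by auto
    qed
    then have "(\<Prod>i<length n. var (i, j i)) \<notin> P" by blast
    moreover have "(\<Prod>i<length n. var (i, j i)) \<in> charts n" using j by (auto simp: charts_def)
    ultimately show False using none by blast
  qed
  let ?B = "irrelevant_ideal n :: 'k mpoly set"
  have vS: "{var (i, j) | j. j \<le> n ! i} \<subseteq> carrier (cox n)" if "i < length n" for i
    using that by (auto intro!: var_in simp: variables_def)
  have "?B \<subseteq> P"
  proof -
    obtain i where i: "i < length n" "\<forall>j\<le>n ! i. var (i, j) \<in> P" using ex by blast
    have "Idl\<^bsub>cox n\<^esub> {var (i, j) | j. j \<le> n ! i} \<subseteq> P"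
      unfolding genideal_def using idP i(2) by auto
    then show ?thesis using i(1) unfolding irrelevant_ideal_def by blast
  qed
  moreover have B: "ideal ?B (cox n)"
  proof (cases "length n = 0")
    case True
    then show ?thesis using oneideal by (simp add: irrelevant_ideal_def)
  next
    case False
    have "?B = \<Inter>((\<lambda>i. Idl\<^bsub>cox n\<^esub> {var (i, j) | j. j \<le> n ! i}) ` {..<length n})"
      unfolding irrelevant_ideal_def using False genideal_ideal[OF vS] ideal.Icarr by fastforce
    also have "ideal \<dots> (cox n)"
      using False genideal_ideal[OF vS] by (intro i_Intersect) auto
    finally show ?thesis .
  qed
  have "?B [^]\<^bsub>ideals_set (cox n)\<^esub> (1::nat) \<subseteq> ?B"
    using ideal_prod_inter[OF oneideal B] by (simp add: nat_pow_def ideals_set_def)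
  ultimately have "x \<in> B_saturation n I"
    unfolding B_saturation_def using x ann by (auto simp: mult.commute intro!: exI[of _ 1])
  then have "x \<in> I" using sat by simp
  then have "1 \<in> P" using ann by simp
  then show False using prime_inD(2)[OF P] by blast
qed

lemma finsum_smult_const:
  assumes "module (cox n) M" and m: "m \<in> carrier M" and X: "finite X" and a: "\<And>x. a x \<in> cox_set n"
  shows "(\<Oplus>\<^bsub>M\<^esub>x\<in>X. a x \<odot>\<^bsub>M\<^esub> m) = (\<Sum>x\<in>X. a x) \<odot>\<^bsub>M\<^esub> m"
  using X
proof (induction X rule: finite_induct)
  interpret module "cox n" M by fact
  {
    case empty
    then show ?case using smult_l_null[OF m] by simp
  next
    case (insert x X)
    have "(\<Sum>x\<in>X. a x) \<in> cox_set n" using a by (intro unital_subring_sum[OF cox_subring])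
    then show ?case using insert m a smult_l_distr[of "a x" "\<Sum>x\<in>X. a x" m] smult_closed
      by (simp add: M.finsum_insert Pi_def)
  }
qed

text \<open>Compare the components of degree \<open>e + d\<close> on both sides of \<open>t m = h u\<close>.\<close>

lemma homogeneous_preimage:
  assumes M: "graded_module n M" and N: "graded_module n N" and h: "h \<in> graded_maps n M N"
    and m: "m \<in> hpart N d" and t: "t \<in> cox_set n" and u: "u \<in> carrier M" "t \<odot>\<^bsub>N\<^esub> m = h u"
    and e: "hcomp e t \<noteq> 0"
  shows "\<exists>v\<in>hpart M (e + d). hcomp e t \<odot>\<^bsub>N\<^esub> m = h v"
proof -
  note Mm = graded_is_module[OF M] and Nm = graded_is_module[OF N]
  note hl = graded_mapsD(1)[OF h]
  interpret M: module "cox n" M by (rule Mm)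
  interpret N: module "cox n" N by (rule Nm)
  have mc: "m \<in> carrier N" using hpart_in[OF N m] .
  have tS: "hcomp d t \<in> cox_set n" for d using hp_cox[OF hcomp_in[OF t]] .
  obtain X k where X: "finite X" "\<forall>d. k d \<in> hpart M d" "u = (\<Oplus>\<^bsub>M\<^esub>d\<in>X. k d)"
    using homogeneous_decomposition[OF M u(1)] by blast
  define k' where "k' d = (if d \<in> X then k d else \<zero>\<^bsub>M\<^esub>)" for d
  have k': "k' d \<in> hpart M d" for d using X(2) hpart_zero[OF M] by (simp add: k'_def)
  \<comment> \<open>One index set for the degrees that occur on either side.\<close>
  define Y where "Y = X \<union> (\<lambda>e. e + d) ` degs t"
  have Y: "finite Y" using X(1) by (simp add: Y_def)
  have "(\<Oplus>\<^bsub>M\<^esub>d\<in>Y. k' d) = u"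
    unfolding X(3) using X(1) Y hpart_in[OF M k'] hpart_in[OF M X(2)[rule_format]]
    by (intro M.M.add.finprod_mono_neutral_cong_right) (auto simp: k'_def Y_def)
  then have "h u = (\<Oplus>\<^bsub>N\<^esub>d\<in>Y. h (k' d))"
    using linear_map_finsum[where g = k', OF Mm Nm hl hpart_in[OF M k'] Y] by simp
  moreover have "(\<Oplus>\<^bsub>N\<^esub>d'\<in>Y. hcomp (d' - d) t \<odot>\<^bsub>N\<^esub> m) = t \<odot>\<^bsub>N\<^esub> m"
  proof -
    have "(\<Sum>d'\<in>Y. hcomp (d' - d) t) = (\<Sum>d'\<in>(\<lambda>e. e + d) ` degs t. hcomp (d' - d) t)"
    proof (rule sum.mono_neutral_right[OF Y])
      show "\<forall>d'\<in>Y - (\<lambda>e. e + d) ` degs t. hcomp (d' - d) t = 0"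
      proof
        fix d' assume d': "d' \<in> Y - (\<lambda>e. e + d) ` degs t"
        have "d' = (d' - d) + d" by simp
        then have "d' - d \<notin> degs t" using d' by blast
        then show "hcomp (d' - d) t = 0" by (rule hcomp_notin_degs)
      qed
    qed (auto simp: Y_def)
    also have "\<dots> = (\<Sum>e\<in>degs t. hcomp e t)"
      by (subst sum.reindex) (auto simp: inj_on_def)
    also have "\<dots> = t" by (rule sum_hcomp[symmetric])
    finally show ?thesis using finsum_smult_const[OF Nm mc Y tS] by simp
  qed
  ultimately have eq: "(\<Oplus>\<^bsub>N\<^esub>d'\<in>Y. hcomp (d' - d) t \<odot>\<^bsub>N\<^esub> m) = (\<Oplus>\<^bsub>N\<^esub>d\<in>Y. h (k' d))"
    using u(2) by simp
  have "hcomp (d' - d) t \<odot>\<^bsub>N\<^esub> m \<in> hpart N d'" for d'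
    using hpart_smult[OF N hcomp_in[OF t, of "d' - d"] m] by simp
  from homogeneous_components_unique[OF N Y this graded_mapsD(2)[OF h k'] eq, of "e + d"]
  have "hcomp e t \<odot>\<^bsub>N\<^esub> m = h (k' (e + d))"
    using e hcomp_notin_degs[of e t] by (auto simp: Y_def)
  then show ?thesis using k' by blast
qed

text \<open>The element \<open>m\<close> lifts the section \<open>y / f\<^sup>k\<close>, where \<open>y\<close> is a multiple of \<open>x\<close> by a monomial outside \<open>P\<close> and
  so has the same annihilator modulo \<open>I\<close>. For homogeneous \<open>b\<close> of the degree of a power of \<open>f\<close>, linearity of
  the augmentation on the chart shows that \<open>b m\<close> becomes a boundary there iff \<open>b y\<close> vanishes there, that is,
  iff \<open>b \<in> P\<close>. The general case follows by passing to components, since \<open>P\<close> is homogeneous. So \<open>m\<close>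
  represents a nonzero element of the cokernel of \<open>D\<close> at \<open>P\<close>, and \<open>P\<close> annihilates it.\<close>

lemma augmentation_lift:
  fixes I P :: "'k::field mpoly set" and F0 F1 :: "('k mpoly, 'b) gmodule"
  assumes I: "ring_ideal (cox_set n) I" and P: "prime_in (cox_set n) P"
    and homP: "\<And>a e. a \<in> P \<Longrightarrow> hcomp e a \<in> P"
    and x: "x \<in> hp n d" and ann: "P = {a \<in> cox_set n. a * x \<in> I}"
    and f: "f \<in> charts n" "f \<notin> P"
    and F0: "graded_module n F0" and F1: "graded_module n F1" and D: "D \<in> graded_maps n F1 F0"
    and lin: "\<epsilon> \<in> linear_maps (structure_ring n f) (sections n F0 f) (sections n (cox_mod n I) f)"
    and surj: "\<epsilon> ` carrier (sections n F0 f) = carrier (sections n (cox_mod n I) f)"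
    and ker: "a_kernel (sections n F0 f) (sections n (cox_mod n I) f) \<epsilon> =
      induced_map n F0 D f ` carrier (sections n F1 f)"
  shows "\<exists>m\<in>carrier F0. (\<forall>t\<in>cox_set n - P. \<forall>u\<in>carrier F1. t \<odot>\<^bsub>F0\<^esub> m \<noteq> D u) \<and>
    (\<forall>a\<in>P. a \<odot>\<^bsub>F0\<^esub> m \<in> almost_image (cox_set n - P) F1 F0 D)"
proof -
  let ?M = "cox_mod n I"
  note F0m = graded_is_module[OF F0] and F1m = graded_is_module[OF F1] and Mm = module_cox_mod[OF I]
  note fS = chart_in[OF f(1)] and Dl = graded_mapsD(1)[OF D]
  interpret F0: module "cox n" F0 by (rule F0m)
  interpret F1: module "cox n" F1 by (rule F1m)
  have xS: "x \<in> cox_set n" using hp_cox[OF x] .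
  have "x \<noteq> 0"
  proof
    assume "x = 0"
    then have "1 \<in> P" using ann ring_idealD(2)[OF cox_subring I] by simp
    then show False using prime_inD(2)[OF P] by blast
  qed
  from homogenize_outside_prime[OF P f hp_multidegree[OF x this]] obtain \<nu> e k where
    nu: "\<nu> \<in> hp n e" "e + d = chart_degree n k" "\<nu> \<notin> P" by blast
  define y where "y = \<nu> * x"
  have y: "y \<in> hp n (chart_degree n k)" using hp_mult[OF nu(1) x] nu(2) by (simp add: y_def)
  have yS: "y \<in> cox_set n" using hp_cox[OF y] .
  have nuS: "\<nu> \<in> cox_set n" using hp_cox[OF nu(1)] .
  have anny: "a * y \<in> I \<longleftrightarrow> a \<in> P" if "a \<in> cox_set n" for a
  proof -
    have "a * y \<in> I \<longleftrightarrow> a * \<nu> \<in> P" using ann that nuS by (auto simp: y_def mult.assoc intro: cox_closed)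
    also have "\<dots> \<longleftrightarrow> a \<in> P"
      using prime_inD(3)[OF P that nuS] nu(3) ring_idealD(4)[OF cox_subring prime_inD(1)[OF P] nuS, of a]
      by (auto simp: mult.commute)
    finally show ?thesis .
  qed
  let ?Y = "I +>\<^bsub>cox n\<^esub> y"
  have Yc: "?Y \<in> carrier ?M" using yS by (auto simp: cox_mod_simps[OF I])
  have "loc_frac n ?M f ?Y k \<in> carrier (sections n ?M f)"
    using y chart_pow_hp[OF f(1), of k] by (auto simp: sections_def cox_mod_simps[OF I])
  then have "loc_frac n ?M f ?Y k \<in> \<epsilon> ` carrier (sections n F0 f)" by (simp only: surj)
  then obtain s where s: "loc_frac n ?M f ?Y k = \<epsilon> s" "s \<in> carrier (sections n F0 f)"
    by (rule imageE)
  obtain m l where "s = loc_frac n F0 f m l" and m1: "m \<in> hpart F0 (chart_degree n l)"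
    using s(2) unfolding sections_carrier[OF F0 f(1)] by blast
  then have m: "m \<in> hpart F0 (chart_degree n l)"
      "\<epsilon> (loc_frac n F0 f m l) = loc_frac n ?M f ?Y k"
    using s(1) by simp_all
  have mc: "m \<in> carrier F0" using hpart_in[OF F0 m(1)] .
  have key: "loc_frac n F0 f (b \<odot>\<^bsub>F0\<^esub> m) (j + l) \<in> induced_map n F0 D f ` carrier (sections n F1 f) \<longleftrightarrow> b \<in> P"
    if b: "b \<in> hp n (chart_degree n j)" for b j
  proof -
    have bS: "b \<in> cox_set n" using hp_cox[OF b] .
    have "loc_frac n (cox n) f b j \<in> carrier (structure_ring n f)"
      using frac_in_carrier[OF f(1) b] .
    moreover have "loc_frac n F0 f m l \<in> carrier (sections n F0 f)"
      using m(1) by (auto simp: sections_carrier[OF F0 f(1)])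
    ultimately have "\<epsilon> (loc_frac n (cox n) f b j \<odot>\<^bsub>sections n F0 f\<^esub> loc_frac n F0 f m l) =
        loc_frac n (cox n) f b j \<odot>\<^bsub>sections n ?M f\<^esub> \<epsilon> (loc_frac n F0 f m l)"
      using lin by (auto simp: linear_maps_def)
    then have 1: "\<epsilon> (loc_frac n F0 f (b \<odot>\<^bsub>F0\<^esub> m) (j + l)) = loc_frac n ?M f (I +>\<^bsub>cox n\<^esub> (b * y)) (j + k)"
      unfolding m(2) using sections_smult[OF F0m fS bS mc] sections_smult[OF Mm fS bS Yc]
        cox_mod_simps(4)[OF I bS yS] by simp
    have "b \<odot>\<^bsub>F0\<^esub> m \<in> hpart F0 (chart_degree n (j + l))"
      using hpart_smult[OF F0 b m(1)] by (simp add: chart_degree_add)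
    then have 2: "loc_frac n F0 f (b \<odot>\<^bsub>F0\<^esub> m) (j + l) \<in> carrier (sections n F0 f)"
      by (auto simp: sections_carrier[OF F0 f(1)])
    have "loc_frac n F0 f (b \<odot>\<^bsub>F0\<^esub> m) (j + l) \<in> a_kernel (sections n F0 f) (sections n ?M f) \<epsilon> \<longleftrightarrow>
        (\<exists>q. f ^ q * (b * y) \<in> I)"
      using 1 2 coset_fraction_zero_iff[OF I fS cox_closed(6)[OF bS yS]] by (auto simp: a_kernel_def')
    also have "\<dots> \<longleftrightarrow> (\<exists>q. f ^ q * b \<in> P)"
      using anny[OF cox_closed(6)[OF unital_subring_power[OF cox_subring fS] bS]] by (simp add: mult.assoc)
    also have "\<dots> \<longleftrightarrow> b \<in> P"
      using prime_chart(2)[OF P fS f(2) _ bS] by (auto intro!: exI[of _ 0])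
    finally show ?thesis by (simp add: ker)
  qed
  have "t \<odot>\<^bsub>F0\<^esub> m \<noteq> D u" if t: "t \<in> cox_set n - P" and u: "u \<in> carrier F1" for t u
  proof
    assume eq: "t \<odot>\<^bsub>F0\<^esub> m = D u"
    have "\<exists>e. hcomp e t \<notin> P"
    proof (rule ccontr)
      assume "\<not> ?thesis"
      then have "(\<Sum>e\<in>degs t. hcomp e t) \<in> P"
        by (intro ring_ideal_sum[OF cox_subring prime_inD(1)[OF P]]) auto
      then show False using t sum_hcomp[of t] by simp
    qed
    then obtain e where e: "hcomp e t \<notin> P" by blast
    then have e0: "hcomp e t \<noteq> 0" using ring_idealD(2)[OF cox_subring prime_inD(1)[OF P]] by auto
    have th: "hcomp e t \<in> hp n e" using t by (intro hcomp_in) auto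
    obtain v where v: "v \<in> hpart F1 (e + chart_degree n l)" "hcomp e t \<odot>\<^bsub>F0\<^esub> m = D v"
      using homogeneous_preimage[OF F1 F0 D m(1) _ u eq e0] t by blast
    have vc: "v \<in> carrier F1" using hpart_in[OF F1 v(1)] .
    from homogenize_outside_prime[OF P f hp_multidegree[OF th e0]] obtain \<mu> e' j where
      mu: "\<mu> \<in> hp n e'" "e' + e = chart_degree n j" "\<mu> \<notin> P" by blast
    have muS: "\<mu> \<in> cox_set n" using hp_cox[OF mu(1)] .
    have b: "\<mu> * hcomp e t \<in> hp n (chart_degree n j)" using hp_mult[OF mu(1) th] mu(2) by simp
    have muv: "\<mu> \<odot>\<^bsub>F1\<^esub> v \<in> hpart F1 (chart_degree n (j + l))"
      using hpart_smult[OF F1 mu(1) v(1)] mu(2) by (simp add: chart_degree_add add.assoc[symmetric])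
    have "(\<mu> * hcomp e t) \<odot>\<^bsub>F0\<^esub> m = D (\<mu> \<odot>\<^bsub>F1\<^esub> v)"
      using F0.smult_assoc1[of \<mu> "hcomp e t" m] muS hp_cox[OF th] mc v(2) linear_mapsD(3)[OF Dl muS vc] by simp
    then have "loc_frac n F0 f ((\<mu> * hcomp e t) \<odot>\<^bsub>F0\<^esub> m) (j + l) =
        induced_map n F0 D f (loc_frac n F1 f (\<mu> \<odot>\<^bsub>F1\<^esub> v) (j + l))"
      using induced_map_loc[OF F1m F0m fS Dl hpart_in[OF F1 muv]] by simp
    moreover have "loc_frac n F1 f (\<mu> \<odot>\<^bsub>F1\<^esub> v) (j + l) \<in> carrier (sections n F1 f)"
      using muv by (auto simp: sections_carrier[OF F1 f(1)])
    ultimately have "\<mu> * hcomp e t \<in> P" using key[OF b] by blast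
    then show False using prime_inD(3)[OF P muS hp_cox[OF th]] mu(3) e by blast
  qed
  moreover have "a \<odot>\<^bsub>F0\<^esub> m \<in> almost_image (cox_set n - P) F1 F0 D" if a: "a \<in> P" for a
  proof -
    have aS: "a \<in> cox_set n" using a ann by blast
    have hS: "hcomp e a \<in> cox_set n" for e using hp_cox[OF hcomp_in[OF aS]] .
    have comp: "hcomp e a \<odot>\<^bsub>F0\<^esub> m \<in> almost_image (cox_set n - P) F1 F0 D" for e
    proof (cases "hcomp e a = 0")
      case True
      then show ?thesis
        using F0.smult_l_null[OF mc] almost_image_zero[OF F1m F0m Dl mult_closed_complement[OF cox_subring P]]
        by simp
    next
      case False
      have h: "hcomp e a \<in> hp n e" by (rule hcomp_in[OF aS])
      from homogenize_outside_prime[OF P f hp_multidegree[OF h False]] obtain \<mu> e' j where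
        mu: "\<mu> \<in> hp n e'" "e' + e = chart_degree n j" "\<mu> \<notin> P" by blast
      have muS: "\<mu> \<in> cox_set n" using hp_cox[OF mu(1)] .
      have b: "\<mu> * hcomp e a \<in> hp n (chart_degree n j)" using hp_mult[OF mu(1) h] mu(2) by simp
      have "\<mu> * hcomp e a \<in> P"
        using ring_idealD(4)[OF cox_subring prime_inD(1)[OF P] muS homP[OF a]] .
      then have "loc_frac n F0 f ((\<mu> * hcomp e a) \<odot>\<^bsub>F0\<^esub> m) (j + l) \<in>
          induced_map n F0 D f ` carrier (sections n F1 f)"
        using key[OF b] by blast
      moreover have "(\<mu> * hcomp e a) \<odot>\<^bsub>F0\<^esub> m = \<mu> \<odot>\<^bsub>F0\<^esub> (hcomp e a \<odot>\<^bsub>F0\<^esub> m)"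
        using F0.smult_assoc1[of \<mu> "hcomp e a" m] muS hS mc by simp
      moreover have "hcomp e a \<odot>\<^bsub>F0\<^esub> m \<in> carrier F0" using F0.smult_closed hS mc by simp
      ultimately show ?thesis
        using image_fraction_almost_image[OF F1 F0 D P f _ muS mu(3)] by simp
    qed
    have "a \<odot>\<^bsub>F0\<^esub> m = (\<Oplus>\<^bsub>F0\<^esub>e\<in>degs a. hcomp e a \<odot>\<^bsub>F0\<^esub> m)"
      using finsum_smult_const[where a = "\<lambda>e. hcomp e a", OF F0m mc finite_degs[of a] hS]
        sum_hcomp[of a] by simp
    then show ?thesis
      using almost_image_finsum[where g = "\<lambda>e. hcomp e a \<odot>\<^bsub>F0\<^esub> m",
          OF F1m F0m Dl mult_closed_complement[OF cox_subring P] comp finite_degs[of a]] by simp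
  qed
  ultimately show ?thesis using mc by blast
qed

theorem proposition5p1:
  fixes n :: "nat list"
    and Z :: "'k::field mpoly \<Rightarrow> ('k mpoly \<times> nat) set set"
    and I :: "'k mpoly set"
    and c :: nat
    and F :: "nat \<Rightarrow> ('k mpoly, 'b) gmodule"
    and D :: "nat \<Rightarrow> 'b \<Rightarrow> 'b"
  assumes "closed_subscheme n Z"
    and "subscheme_codim n Z = enat c"
    and "B_saturated_ideal_of n Z I"
    and "virtual_resolution n (cox_mod n I) F D"
    and "has_length F c"
  shows "\<forall>P. associated_prime (cox n) (cox_mod n I) P \<longrightarrow> height (cox n) P = enat c"
proof (intro allI impI)
  fix P assume ass: "associated_prime (cox n) (cox_mod n I) P"
  have hom: "homogeneous_ideal n I" and sat: "B_saturation n I = I"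
    and sheaf: "\<And>f. f \<in> charts n \<Longrightarrow> ideal_sheaf n I f = Z f"
    using assms(3) by (auto simp: B_saturated_ideal_of_def)
  have I: "ring_ideal (cox_set n) I" using hom by (simp add: homogeneous_ideal_def ideal_cox_iff)
  obtain x0 where P: "prime_in (cox_set n) P" and x0: "x0 \<in> cox_set n" "P = {a \<in> cox_set n. a * x0 \<in> I}"
    using ass by (rule associated_prime_cox_modE[OF I])
  obtain f where f: "f \<in> charts n" "f \<notin> P"
    using irrelevant_not_in_associated_prime[OF I sat P x0] by blast
  have homP: "\<And>a e. a \<in> P \<Longrightarrow> hcomp e a \<in> P"
    and "\<exists>d. \<exists>z\<in>hp n d. P = {a \<in> cox_set n. a * z \<in> I}"
    using associated_prime_homogeneous[OF I homogeneous_ideal_hcomp[OF hom] P x0] by auto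
  then obtain d x where x: "x \<in> hp n d" "P = {a \<in> cox_set n. a * x \<in> I}" by blast
  have IP: "I \<subseteq> P"
  proof
    fix a assume a: "a \<in> I"
    then have "a * x \<in> I"
      using ring_idealD(4)[OF cox_subring I hp_cox[OF x(1)] a] by (simp add: mult.commute)
    then show "a \<in> P" using x(2) a ring_idealD(1)[OF cox_subring I] by blast
  qed
  have lower: "enat c \<le> height (cox n) P"
  proof -
    have Zid: "ideal (Z f) (structure_ring n f)" using assms(1) f(1) by (simp add: closed_subscheme_def)
    then have ring: "ring (structure_ring n f)" by (rule ideal.axioms(2))
    let ?q = "prime_on_chart n f P"
    have "Z f \<subseteq> ?q"
      unfolding sheaf[OF f(1), symmetric] ideal_sheaf_def prime_on_chart_def[OF f(1)]
      using IP by (auto simp: chart_pow_hp_iff[OF f(1)])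
    moreover have "primeideal ?q (structure_ring n f)"
      by (rule primeideal_prime_on_chart[OF f(1) ring P f(2)])
    ultimately have "ideal_codim (structure_ring n f) (Z f) \<le> height (structure_ring n f) ?q"
      unfolding ideal_codim_def by (intro INF_lower) auto
    moreover have "enat c \<le> ideal_codim (structure_ring n f) (Z f)"
      unfolding assms(2)[symmetric] subscheme_codim_def by (rule INF_lower[OF f(1)])
    ultimately show ?thesis
      using height_prime_on_chart_le[OF f(1) ring P f(2)] by (meson order_trans)
  qed
  have upper: "height (cox n) P \<le> enat c"
  proof (rule ccontr)
    assume "\<not> ?thesis"
    then obtain k C where k: "c < k" and C: "C k = P" "\<forall>i\<le>k. primeideal (C i) (cox n)"
        "\<forall>i<k. C i \<subset> C (Suc i)"
      unfolding height_def not_le less_Sup_iff by auto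
    obtain a where a: "\<forall>i<k. a i \<in> P" "\<forall>i<k. \<forall>u\<in>cox_set n.
        a i * u \<in> local_ideal (cox_set n) (cox_set n - P) a i \<longrightarrow>
        u \<in> local_ideal (cox_set n) (cox_set n - P) a i"
      using regular_sequence_of_chain[OF finite_variables[of n], of k C] C by (auto simp: primeideal_cox_iff)
    have free: "fg_graded_free n (F i)" and D: "D i \<in> graded_maps n (F (Suc i)) (F i)"
      and complex: "y \<in> carrier (F (Suc (Suc i))) \<Longrightarrow> D i (D (Suc i) y) = \<zero>\<^bsub>F i\<^esub>" for i y
      using assms(4) by (auto simp: virtual_resolution_def)
    have gr: "graded_module n (F i)" for i using free by (simp add: fg_graded_free_def)
    have "\<exists>E. module_basis n (F i) E" for i
    proof -
      obtain E where E: "finite E" "E \<subseteq> (\<Union>d\<in>multidegrees n. hpart (F i) d)"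
          "\<forall>x\<in>carrier (F i). \<exists>!a. a \<in> E \<rightarrow>\<^sub>E carrier (cox n) \<and> x = (\<Oplus>\<^bsub>F i\<^esub>e\<in>E. a e \<odot>\<^bsub>F i\<^esub> e)"
        using free[of i] unfolding fg_graded_free_def by blast
      moreover have "E \<subseteq> carrier (F i)" using E(2) hpart_in[OF gr] by blast
      ultimately show ?thesis using graded_is_module[OF gr] unfolding module_basis_def by blast
    qed
    then obtain E where E: "\<And>i. module_basis n (F i) (E i)" by metis
    from assms(4)[unfolded virtual_resolution_def, THEN conjunct2, THEN conjunct2, THEN conjunct2]
    obtain \<epsilon> where sheaf_map: "\<epsilon> \<in> sheaf_morphisms n (F 0) (cox_mod n I)"
      and all: "\<forall>f\<in>charts n.
        \<epsilon> f ` carrier (sections n (F 0) f) = carrier (sections n (cox_mod n I) f) \<and>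
        a_kernel (sections n (F 0) f) (sections n (cox_mod n I) f) (\<epsilon> f) =
          induced_map n (F 0) (D 0) f ` carrier (sections n (F 1) f) \<and>
        (\<forall>i. a_kernel (sections n (F (Suc i)) f) (sections n (F i) f) (induced_map n (F i) (D i) f) =
          induced_map n (F (Suc i)) (D (Suc i)) f ` carrier (sections n (F (Suc (Suc i))) f))"
      by (rule bexE)
    note exact_on_chart = bspec[OF all f(1)]
    note eps = exact_on_chart[THEN conjunct1] exact_on_chart[THEN conjunct2, THEN conjunct1]
      and ex = exact_on_chart[THEN conjunct2, THEN conjunct2, rule_format]
    have lin: "\<epsilon> f \<in> linear_maps (structure_ring n f) (sections n (F 0) f) (sections n (cox_mod n I) f)"
      using sheaf_map f(1) by (auto simp: sheaf_morphisms_def)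
    obtain m where m: "m \<in> carrier (F 0)"
        "\<forall>t\<in>cox_set n - P. \<forall>u\<in>carrier (F (Suc 0)). t \<odot>\<^bsub>F 0\<^esub> m \<noteq> D 0 u"
        "\<forall>a\<in>P. a \<odot>\<^bsub>F 0\<^esub> m \<in> almost_image (cox_set n - P) (F (Suc 0)) (F 0) (D 0)"
      using augmentation_lift[OF I P homP x f gr gr D lin eps[unfolded One_nat_def]] by blast
    interpret F0: module "cox n" "F 0" by (rule graded_is_module[OF gr])
    have "carrier (F k) \<noteq> {\<zero>\<^bsub>F k\<^esub>}"
    proof (rule free_resolution_reaches_length_of_regular_sequence[OF E graded_mapsD(1)[OF D] complex
          mult_closed_complement[OF cox_subring P] _ _ _ m(1)])
      fix i z assume "z \<in> carrier (F (Suc i))" "D i z = \<zero>\<^bsub>F i\<^esub>"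
      then show "\<exists>t\<in>cox_set n - P. \<exists>u\<in>carrier (F (Suc (Suc i))). t \<odot>\<^bsub>F (Suc i)\<^esub> z = D (Suc i) u"
        using exact_outside_prime[OF gr gr gr D D P f ex] by (auto simp: almost_image_def)
    next
      show "a i \<in> cox_set n" if "i < k" for i
        using that a(1) ring_idealD(1)[OF cox_subring prime_inD(1)[OF P]] by blast
      then have aS: "a i \<in> cox_set n" if "i < k" for i using that by blast
      fix j assume j: "j < k"
      then have "a j \<odot>\<^bsub>F 0\<^esub> m \<in> almost_image (cox_set n - P) (F (Suc 0)) (F 0) (D 0)"
        using m(3) a(1) by blast
      then obtain t u where t: "t \<in> cox_set n - P" "u \<in> carrier (F (Suc 0))"
          "t \<odot>\<^bsub>F 0\<^esub> (a j \<odot>\<^bsub>F 0\<^esub> m) = D 0 u"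
        unfolding almost_image_def by blast
      then have "(t * a j) \<odot>\<^bsub>F 0\<^esub> m = D 0 u"
        using F0.smult_assoc1[of t "a j" m] aS[OF j] m(1) by simp
      then show "\<exists>t\<in>cox_set n - P. \<exists>u\<in>carrier (F (Suc 0)). (t * a j) \<odot>\<^bsub>F 0\<^esub> m = D 0 u"
        using t by blast
    qed (use a(2) m(2) in auto)
    then show False using assms(5) k by (simp add: has_length_def)
  qed
  show "height (cox n) P = enat c" using lower upper by (rule antisym[rotated])
qed

end
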